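(* Let $j\in\{1,\tfrac32,2,\dots\}$ and let $j_1=j$, $j_2=j_3=\tfrac12$. Then the map $\overline{\phi}:\overline{AW}(j,\tfrac12,\tfrac12)\to\mathcal{C}_{j,\frac12,\frac12}$ given by $\overline{\phi}(A)=C_{12}$, $\overline{\phi}(B)=C_{23}$, $\overline{\phi}(K)=C_{123}$ is an algebra isomorphism.
   Context: Throughout, $q\in\mathbb{C}$ is nonzero and not a root of unity, a square root $q^{1/2}$ is fixed so that $q^m$ makes sense for half-integers $m$, and all algebras are unital associative algebras over $\mathbb{C}$. The quantum algebra $U_q(\mathfrak{sl}_2)$ is generated by $E$, $F$ and the invertible element $q^H$ with relations $q^HE=qEq^H$, $q^HF=q^{-1}Fq^H$, $[E,F]=\frac{q^{2H}-q^{-2H}}{q-q^{-1}}$. Its central Casimir element is $\Gamma=(q-q^{-1})^2FE+q\,q^{2H}+q^{-1}q^{-2H}$. The comultiplication $\Delta$ is the algebra homomorphism with $\Delta(E)=E\otimes q^{-H}+q^H\otimes E$, $\Delta(F)=F\otimes q^{-H}+q^H\otimes F$, $\Delta(q^H)=q^H\otimes q^H$; it is coassociative, and $\Delta^{(2)}=(\Delta\otimes\mathrm{id})\Delta=(\mathrm{id}\otimes\Delta)\Delta$. For $j\in\{0,\tfrac12,1,\dots\}$, $M_j$ denotes the spin-$j$ representation, i.e. the irreducible representation of dimension $2j+1$ generated by a vector $v$ with $Ev=0$, $q^Hv=q^jv$, and $\pi_j$ is the representation map. One has $\pi_j(\Gamma)=\chi_j\,\mathrm{Id}$ with $\chi_j=q^{2j+1}+q^{-2j-1}$.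 Write $\pi_{j_1,j_2,j_3}=\pi_{j_1}\otimes\pi_{j_2}\otimes\pi_{j_3}$. The centralizer is $$\mathcal{C}_{j_1,j_2,j_3}=\{m\in\mathrm{End}(M_{j_1}\otimes M_{j_2}\otimes M_{j_3}) : [\pi_{j_1,j_2,j_3}(\Delta^{(2)}(x)),m]=0\ \ \forall x\in U_q(\mathfrak{sl}_2)\}.$$ It contains the images under $\pi_{j_1,j_2,j_3}$: $C_{12}$ of $\Delta(\Gamma)\otimes1$, $C_{23}$ of $1\otimes\Delta(\Gamma)$, and $C_{123}$ of $\Delta^{(2)}(\Gamma)$. Sets: $\mathcal{J}(j_1,j_2)=\{|j_1-j_2|,|j_1-j_2|+1,\dots,j_1+j_2\}$, $\mathcal{J}(j_1,j_2,j_3)=\bigcup_{j\in\mathcal{J}(j_1,j_2)}\mathcal{J}(j,j_3)$, $\mathcal{M}(j_a,j_b,j_c)=\bigcup_{j\in\mathcal{J}(j_a,j_b)}\{\chi_\ell-\chi_j : \ell\in\mathcal{J}(j,j_c)\}$ (all sets without repetition). With $[X,Y]_q=qXY-q^{-1}YX$, the centrally extended Askey--Wilson algebra $AW(3)$ is the algebra generated by $A,B,D$ and central elements $\alpha_1,\alpha_2,\alpha_3,K$ with defining relations $$A+\frac{[B,D]_q}{q^2-q^{-2}}=\frac{\alpha_1\alpha_2+\alpha_3K}{q+q^{-1}},\quad B+\frac{[D,A]_q}{q^2-q^{-2}}=\frac{\alpha_2\alpha_3+\alpha_1K}{q+q^{-1}},\quad D+\frac{[A,B]_q}{q^2-q^{-2}}=\frac{\alpha_1\alpha_3+\alpha_2K}{q+q^{-1}}.$$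 The element $D'\in AW(3)$ is defined by $D'+\frac{[B,A]_q}{q^2-q^{-2}}=\frac{\alpha_1\alpha_3+\alpha_2K}{q+q^{-1}}$, and $$\Omega=qA(\alpha_1\alpha_2+\alpha_3K)+q^{-1}B(\alpha_2\alpha_3+\alpha_1K)+qD(\alpha_1\alpha_3+\alpha_2K)-q^2A^2-q^{-2}B^2-q^2D^2-qABD.$$ The algebra $\overline{AW}(j_1,j_2,j_3)$ is the quotient of $AW(3)$ by the relations: $\alpha_i=\chi_{j_i}$ ($i=1,2,3$); $\prod_{j\in\mathcal{J}(j_1,j_2)}(A-\chi_j)=0$; $\prod_{j\in\mathcal{J}(j_2,j_3)}(B-\chi_j)=0$; $\prod_{j\in\mathcal{J}(j_1,j_2,j_3)}(K-\chi_j)=0$; $\prod_{j\in\mathcal{J}(j_1,j_3)}(D-\chi_j)=0$; $\prod_{j\in\mathcal{J}(j_1,j_3)}(D'-\chi_j)=0$; $\prod_{m\in\mathcal{M}(j_1,j_2,j_3)}(K-A-m)=0$; $\prod_{m\in\mathcal{M}(j_2,j_3,j_1)}(K-B-m)=0$; $\prod_{m\in\mathcal{M}(j_1,j_3,j_2)}(K-D-m)=0$; $\prod_{m\in\mathcal{M}(j_1,j_3,j_2)}(K-D'-m)=0$; and $\Omega=\chi_{j_1}^2+\chi_{j_2}^2+\chi_{j_3}^2+K^2+\chi_{j_1}\chi_{j_2}\chi_{j_3}K-(q+q^{-1})^2$. *)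

theory Defs
  imports
    Complex_Main
    "HOL-Library.Poly_Mapping"
    "HOL-Algebra.QuotRing"
    "Jordan_Normal_Form.Matrix"
begin

section \<open>Algebras over the complex numbers\<close>

text \<open>
  An algebra is a record of type \<^typ>\<open>(complex, 'a) module\<close>. The locale \<^locale>\<open>algebra\<close> of
  HOL-Algebra only covers commutative algebras, so the general notion is introduced here.
\<close>

locale unital_algebra = ring B for B :: "(complex, 'a) module" (structure) +
  assumes smult_closed: "x \<in> carrier B \<Longrightarrow> c \<odot> x \<in> carrier B"
    and smult_add_left: "x \<in> carrier B \<Longrightarrow> (c + d) \<odot> x = c \<odot> x \<oplus> d \<odot> x"
    and smult_add_right: "x \<in> carrier B \<Longrightarrow> y \<in> carrier B \<Longrightarrow> c \<odot> (x \<oplus> y) = c \<odot> x \<oplus> c \<odot> y"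
    and smult_assoc: "x \<in> carrier B \<Longrightarrow> (c * d) \<odot> x = c \<odot> (d \<odot> x)"
    and smult_one: "x \<in> carrier B \<Longrightarrow> 1 \<odot> x = x"
    and smult_mult_left: "x \<in> carrier B \<Longrightarrow> y \<in> carrier B \<Longrightarrow> (c \<odot> x) \<otimes> y = c \<odot> (x \<otimes> y)"
    and smult_mult_right: "x \<in> carrier B \<Longrightarrow> y \<in> carrier B \<Longrightarrow> x \<otimes> (c \<odot> y) = c \<odot> (x \<otimes> y)"

definition alg_hom :: "(complex, 'a) module \<Rightarrow> (complex, 'b) module \<Rightarrow> ('a \<Rightarrow> 'b) set" where
  "alg_hom A B =
     {f \<in> Ring.ring_hom A B. \<forall>c. \<forall>x \<in> carrier A. f (c \<odot>\<^bsub>A\<^esub> x) = c \<odot>\<^bsub>B\<^esub> f x}"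

definition alg_iso :: "(complex, 'a) module \<Rightarrow> (complex, 'b) module \<Rightarrow> ('a \<Rightarrow> 'b) set" where
  "alg_iso A B = {f \<in> alg_hom A B. bij_betw f (carrier A) (carrier B)}"

definition quotient_algebra :: "(complex, 'a) module \<Rightarrow> 'a set \<Rightarrow> (complex, 'a set) module" where
  "quotient_algebra A I = ring.extend (A Quot I)
     (module.fields (\<lambda>c X. \<Union>x\<in>X. I +>\<^bsub>A\<^esub> (c \<odot>\<^bsub>A\<^esub> x)))"


section \<open>Algebras given by generators and relations\<close>

datatype 'g word = Word (letters: "'g list")

instantiation word :: (type) monoid_add
begin

definition zero_word :: "'a word" where "0 = Word []"

definition plus_word :: "'a word \<Rightarrow> 'a word \<Rightarrow> 'a word" where
  "u + v = Word (letters u @ letters v)"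

instance
  by standard (simp_all add: zero_word_def plus_word_def)

end

text \<open>
  The free algebra is the monoid algebra of the free monoid of words, so multiplication in
  \<open>'g free_alg\<close> is the bilinear extension of concatenation.
\<close>

type_synonym 'g free_alg = "'g word \<Rightarrow>\<^sub>0 complex"

definition var :: "'g \<Rightarrow> 'g free_alg" where
  "var g = Poly_Mapping.single (Word [g]) 1"

definition scalar :: "complex \<Rightarrow> 'g free_alg" where
  "scalar c = Poly_Mapping.single 0 c"

definition free_algebra :: "(complex, 'g free_alg) module" where
  "free_algebra = \<lparr>carrier = UNIV, monoid.mult = (*), one = 1, zero = 0, add = (+),
     smult = (\<lambda>c x. scalar c * x)\<rparr>"

text \<open>Evaluation of a noncommutative polynomial at the elements \<^term>\<open>h g\<close> of an algebra.\<close>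

definition eval_free :: "(complex, 'a) module \<Rightarrow> ('g \<Rightarrow> 'a) \<Rightarrow> 'g free_alg \<Rightarrow> 'a" where
  "eval_free B h p =
     (\<Oplus>\<^bsub>B\<^esub>w \<in> Poly_Mapping.keys p.
        Poly_Mapping.lookup p w \<odot>\<^bsub>B\<^esub> foldr (\<lambda>g y. h g \<otimes>\<^bsub>B\<^esub> y) (letters w) \<one>\<^bsub>B\<^esub>)"

definition rel_ideal :: "'g free_alg set \<Rightarrow> 'g free_alg set" where
  "rel_ideal R = genideal free_algebra R"

text \<open>The algebra with generating set \<^typ>\<open>'g\<close> and relations \<open>r = 0\<close> for \<^term>\<open>r \<in> R\<close>.\<close>

definition presented :: "'g free_alg set \<Rightarrow> (complex, 'g free_alg set) module" where
  "presented R = quotient_algebra free_algebra (rel_ideal R)"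

definition cls :: "'g free_alg set \<Rightarrow> 'g free_alg \<Rightarrow> 'g free_alg set" where
  "cls R p = rel_ideal R +>\<^bsub>free_algebra\<^esub> p"

abbreviation generator :: "'g free_alg set \<Rightarrow> 'g \<Rightarrow> 'g free_alg set" where
  "generator R g \<equiv> cls R (var g)"

text \<open>
  The homomorphism from a presented algebra to \<open>B\<close> that sends every generator \<open>g\<close> to \<^term>\<open>h g\<close>.
  The choice of the representative is irrelevant when \<open>h\<close> satisfies the defining relations.
\<close>

definition extend_hom :: "(complex, 'a) module \<Rightarrow> ('g \<Rightarrow> 'a) \<Rightarrow> 'g free_alg set \<Rightarrow> 'a" where
  "extend_hom B h X = eval_free B h (SOME p. p \<in> X)"


text \<open>
  Presented algebras are unital algebras, and \<^const>\<open>extend_hom\<close> is the expected homomorphism.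
\<close>

lemma free_algebra_simps [simp]:
  "carrier free_algebra = UNIV" "x \<otimes>\<^bsub>free_algebra\<^esub> y = x * y" "\<one>\<^bsub>free_algebra\<^esub> = 1"
  "\<zero>\<^bsub>free_algebra\<^esub> = 0" "x \<oplus>\<^bsub>free_algebra\<^esub> y = x + y" "c \<odot>\<^bsub>free_algebra\<^esub> x = scalar c * x"
  by (simp_all add: free_algebra_def)

lemma scalar_simps:
  "scalar 0 = 0" "scalar 1 = 1" "scalar (c + d) = scalar c + scalar d"
  "scalar (c * d) = scalar c * scalar d"
  by (simp_all add: scalar_def single_add mult_single)

lemma free_alg_induct [case_names zero single add]:
  fixes p :: "'g free_alg"
  assumes "P 0" "\<And>w c. P (Poly_Mapping.single w c)" "\<And>x y. P x \<Longrightarrow> P y \<Longrightarrow> P (x + y)"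
  shows "P p"
proof (induction p rule: update_induct)
  case const then show ?case using assms(1) .
next
  case (update f a b)
  have "Poly_Mapping.update a b f = f + Poly_Mapping.single a b"
    using update by (intro poly_mapping_eqI) (auto simp: lookup_add lookup_update lookup_single when_def in_keys_iff)
  then show ?case using assms update by metis
qed

lemma scalar_central: "x * scalar c = scalar c * x"
  by (induction x rule: free_alg_induct) (simp_all add: scalar_def mult_single algebra_simps)

lemma unital_algebra_free: "unital_algebra free_algebra"
proof -
  have "abelian_group (free_algebra :: (complex, 'a free_alg) module)"
    by (rule abelian_groupI) (auto simp: add.assoc add.commute intro: exI[of _ "- _"] )
  then have "ring (free_algebra :: (complex, 'a free_alg) module)"
    by (intro ringI monoidI) (auto simp: algebra_simps mult.assoc)
  then show ?thesis
    by (intro unital_algebra.intro unital_algebra_axioms.intro)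
       (auto simp: scalar_simps algebra_simps mult.assoc, metis mult.assoc scalar_central)
qed

lemma alg_homD:
  assumes "f \<in> alg_hom A B"
  shows "x \<in> carrier A \<Longrightarrow> f x \<in> carrier B"
    "x \<in> carrier A \<Longrightarrow> y \<in> carrier A \<Longrightarrow> f (x \<otimes>\<^bsub>A\<^esub> y) = f x \<otimes>\<^bsub>B\<^esub> f y"
    "x \<in> carrier A \<Longrightarrow> y \<in> carrier A \<Longrightarrow> f (x \<oplus>\<^bsub>A\<^esub> y) = f x \<oplus>\<^bsub>B\<^esub> f y"
    "f \<one>\<^bsub>A\<^esub> = \<one>\<^bsub>B\<^esub>"
    "x \<in> carrier A \<Longrightarrow> f (c \<odot>\<^bsub>A\<^esub> x) = c \<odot>\<^bsub>B\<^esub> f x"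
  using assms by (auto simp: alg_hom_def ring_hom_mult ring_hom_add ring_hom_one ring_hom_closed)

context unital_algebra
begin

lemma smult_zero_left: "x \<in> carrier B \<Longrightarrow> 0 \<odot> x = \<zero>"
  using smult_add_left[of x 0 0] smult_closed[of x 0] by (simp add: l_neg r_zero) 

lemma smult_zero_right: "c \<odot> \<zero> = \<zero>"
  using smult_add_right[of \<zero> \<zero> c] smult_closed[of \<zero> c] by simp

abbreviation word_val :: "('g \<Rightarrow> 'a) \<Rightarrow> 'g word \<Rightarrow> 'a" where
  "word_val h w \<equiv> foldr (\<lambda>g y. h g \<otimes> y) (letters w) \<one>"

context
  fixes h :: "'g \<Rightarrow> 'a"
  assumes h: "\<And>g. h g \<in> carrier B"
begin

lemma word_val_closed: "word_val h w \<in> carrier B"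
proof -
  have "foldr (\<lambda>g y. h g \<otimes> y) xs \<one> \<in> carrier B" for xs
    by (induction xs) (auto simp: h)
  then show ?thesis .
qed

lemma word_val_add: "word_val h (u + v) = word_val h u \<otimes> word_val h v"
proof -
  have "foldr (\<lambda>g y. h g \<otimes> y) (xs @ letters v) \<one>
      = foldr (\<lambda>g y. h g \<otimes> y) xs \<one> \<otimes> word_val h v" for xs
  proof (induction xs)
    case (Cons a xs)
    have "foldr (\<lambda>g y. h g \<otimes> y) xs \<one> \<in> carrier B"
      using word_val_closed[of "Word xs"] by simp
    with Cons show ?case by (simp add: h m_assoc word_val_closed del: foldr_append)
  qed (simp add: word_val_closed)
  then show ?thesis by (simp add: plus_word_def del: foldr_append)
qed

lemma eval_free_superset:
  assumes "finite S" "Poly_Mapping.keys p \<subseteq> S"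
  shows "eval_free B h p = (\<Oplus>w\<in>S. Poly_Mapping.lookup p w \<odot> word_val h w)"
  unfolding eval_free_def
  by (rule add.finprod_mono_neutral_cong_left)
     (use assms in \<open>auto simp: in_keys_iff smult_zero_left smult_closed word_val_closed\<close>)

lemma eval_free_closed: "eval_free B h p \<in> carrier B"
  unfolding eval_free_def
  by (rule finsum_closed) (auto simp: smult_closed word_val_closed)

lemma eval_free_zero: "eval_free B h 0 = \<zero>"
  by (simp add: eval_free_def)

lemma eval_free_add: "eval_free B h (x + y) = eval_free B h x \<oplus> eval_free B h y"
proof -
  let ?S = "Poly_Mapping.keys x \<union> Poly_Mapping.keys y"
  have "eval_free B h (x + y)
      = (\<Oplus>w\<in>?S. Poly_Mapping.lookup x w \<odot> word_val h w \<oplus> Poly_Mapping.lookup y w \<odot> word_val h w)"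
    by (subst eval_free_superset[of ?S])
       (auto simp: keys_add lookup_add smult_add_left word_val_closed smult_closed intro!: finsum_cong')
  also have "\<dots> = eval_free B h x \<oplus> eval_free B h y"
    by (subst finsum_addf)
       (auto simp: smult_closed word_val_closed eval_free_superset[of ?S])
  finally show ?thesis .
qed

lemma eval_free_single: "eval_free B h (Poly_Mapping.single w c) = c \<odot> word_val h w"
  by (subst eval_free_superset[of "{w}"])
     (auto simp: smult_closed word_val_closed lookup_single split: if_splits)

lemma eval_free_var: "eval_free B h (var g) = h g"
  by (simp add: var_def eval_free_single h smult_one)

lemma eval_free_scalar: "eval_free B h (scalar c) = c \<odot> \<one>"
  by (simp add: scalar_def eval_free_single zero_word_def)

lemma eval_free_one: "eval_free B h 1 = \<one>"
  using eval_free_scalar[of 1] by (simp add: scalar_simps smult_one)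

lemma eval_free_mult: "eval_free B h (x * y) = eval_free B h x \<otimes> eval_free B h y"
proof (induction x rule: free_alg_induct)
  case zero
  then show ?case by (simp add: eval_free_zero eval_free_closed)
next
  case (add x1 x2)
  then show ?case by (simp add: distrib_right eval_free_add eval_free_closed l_distr)
next
  case (single u c)
  show ?case
  proof (induction y rule: free_alg_induct)
    case zero
    then show ?case by (simp add: eval_free_zero eval_free_closed)
  next
    case (add x1 x2)
    then show ?case by (simp add: distrib_left eval_free_add eval_free_closed r_distr)
  next
    case (single v d)
    then show ?case
      by (simp add: mult_single eval_free_single word_val_add smult_mult_left smult_mult_right
          word_val_closed smult_closed smult_assoc[symmetric] mult.commute)
  qed
qed

lemma eval_free_smult: "eval_free B h (scalar c * x) = c \<odot> eval_free B h x"
  by (simp add: eval_free_mult eval_free_scalar smult_mult_left eval_free_closed)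

lemma eval_free_hom: "eval_free B h \<in> alg_hom free_algebra B"
  unfolding alg_hom_def
  by (auto intro!: ring_hom_memI simp: eval_free_closed eval_free_add eval_free_one)
     (simp_all add: eval_free_mult eval_free_smult eval_free_scalar smult_mult_left eval_free_closed)

lemma eval_free_uminus: "eval_free B h (- x) = \<ominus> eval_free B h x"
  using eval_free_add[of "-x" x] eval_free_closed[of x] eval_free_closed[of "-x"]
  by (simp add: eval_free_zero minus_equality)

lemma eval_free_diff: "eval_free B h (x - y) = eval_free B h x \<ominus> eval_free B h y"
  using eval_free_add[of x "-y"] by (simp add: eval_free_uminus minus_eq)

lemma eval_free_power: "eval_free B h (x ^ k) = eval_free B h x [^] k"
proof (induction k)
  case (Suc k)
  have "eval_free B h (x ^ Suc k) = eval_free B h (x ^ k * x)" by (simp only: power_Suc2)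
  then show ?case using Suc by (simp add: eval_free_mult)
qed (simp add: eval_free_one)

end

end

interpretation free: unital_algebra free_algebra
  by (rule unital_algebra_free)

lemma free_uminus: "\<ominus>\<^bsub>free_algebra\<^esub> x = - x"
  by (rule free.minus_equality) simp_all

lemma rel_ideal: "ideal (rel_ideal R) free_algebra"
  unfolding rel_ideal_def by (rule free.genideal_ideal) simp

lemma rel_ideal_superset: "r \<in> R \<Longrightarrow> r \<in> rel_ideal R"
  using free.genideal_self[of R] by (auto simp: rel_ideal_def)

lemma rel_ideal_closed:
  "0 \<in> rel_ideal R"
  "x \<in> rel_ideal R \<Longrightarrow> y \<in> rel_ideal R \<Longrightarrow> x + y \<in> rel_ideal R"
  "x \<in> rel_ideal R \<Longrightarrow> y * x \<in> rel_ideal R"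
  "x \<in> rel_ideal R \<Longrightarrow> x * y \<in> rel_ideal R"
  "x \<in> rel_ideal R \<Longrightarrow> - x \<in> rel_ideal R"
proof -
  interpret ideal "rel_ideal R" free_algebra by (rule rel_ideal)
  show "0 \<in> rel_ideal R" using zero_closed by simp
  show "x \<in> rel_ideal R \<Longrightarrow> y \<in> rel_ideal R \<Longrightarrow> x + y \<in> rel_ideal R" using a_closed by simp
  show "x \<in> rel_ideal R \<Longrightarrow> y * x \<in> rel_ideal R" for x y using I_l_closed[of x y] by simp
  show "x \<in> rel_ideal R \<Longrightarrow> x * y \<in> rel_ideal R" using I_r_closed[of x y] by simp
  show "x \<in> rel_ideal R \<Longrightarrow> - x \<in> rel_ideal R"
    using I_r_closed[of x "-1"] by simp
qed

lemma mem_cls_iff: "p \<in> cls R x \<longleftrightarrow> p - x \<in> rel_ideal R"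
  by (auto simp: cls_def a_r_coset_def' intro: bexI[of _ "p - x"])

lemma cls_eq_iff: "cls R x = cls R y \<longleftrightarrow> x - y \<in> rel_ideal R"
proof
  assume "cls R x = cls R y"
  then show "x - y \<in> rel_ideal R"
    by (metis mem_cls_iff diff_self rel_ideal_closed(1))
next
  assume *: "x - y \<in> rel_ideal R"
  have "p - x \<in> rel_ideal R \<longleftrightarrow> p - y \<in> rel_ideal R" for p
    using rel_ideal_closed(2)[of "p - x" R "x - y"] rel_ideal_closed(2)[of "p - y" R "- (x - y)"]
      rel_ideal_closed(5)[OF *] * by auto
  then show "cls R x = cls R y" by (auto simp: mem_cls_iff)
qed

lemma presented_simps:
  "carrier (presented R) = range (cls R)"
  "\<one>\<^bsub>presented R\<^esub> = cls R 1" "\<zero>\<^bsub>presented R\<^esub> = cls R 0"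
  "cls R x \<otimes>\<^bsub>presented R\<^esub> cls R y = cls R (x * y)"
  "cls R x \<oplus>\<^bsub>presented R\<^esub> cls R y = cls R (x + y)"
  "c \<odot>\<^bsub>presented R\<^esub> cls R x = cls R (scalar c * x)"
proof -
  interpret ideal "rel_ideal R" free_algebra by (rule rel_ideal)
  note defs = presented_def quotient_algebra_def ring.defs module.defs FactRing_def
  show "carrier (presented R) = range (cls R)"
    by (auto simp: defs A_RCOSETS_defs cls_def a_r_coset_def)
  show "\<one>\<^bsub>presented R\<^esub> = cls R 1"
    by (simp add: defs cls_def)
  show "\<zero>\<^bsub>presented R\<^esub> = cls R 0"
    by (auto simp: defs mem_cls_iff)
  show "cls R x \<otimes>\<^bsub>presented R\<^esub> cls R y = cls R (x * y)"
    using rcoset_mult_add[of x y] by (simp add: defs cls_def)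
  show "cls R x \<oplus>\<^bsub>presented R\<^esub> cls R y = cls R (x + y)"
    using a_rcos_sum[of x y] by (simp add: defs cls_def)
  have "cls R (scalar c * y) = cls R (scalar c * x)" if "y \<in> cls R x" for y
    using that rel_ideal_closed(3)[of "y - x" R "scalar c"]
    by (simp add: cls_eq_iff mem_cls_iff right_diff_distrib)
  moreover have "x \<in> cls R x" by (simp add: mem_cls_iff rel_ideal_closed)
  ultimately have "(\<Union>y\<in>cls R x. cls R (scalar c * y)) = cls R (scalar c * x)" by blast
  then show "c \<odot>\<^bsub>presented R\<^esub> cls R x = cls R (scalar c * x)"
    by (simp add: defs cls_def)
qed

lemma unital_algebra_presented: "unital_algebra (presented R)"
proof -
  have rep: "\<exists>x. X = cls R x" if "X \<in> carrier (presented R)" for X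
    using that by (auto simp: presented_simps)
  have "abelian_group (presented R)"
  proof (rule abelian_groupI)
    fix X Y Z assume "X \<in> carrier (presented R)" "Y \<in> carrier (presented R)" "Z \<in> carrier (presented R)"
    then obtain x y z where xyz: "X = cls R x" "Y = cls R y" "Z = cls R z" using rep by metis
    show "X \<oplus>\<^bsub>presented R\<^esub> Y \<oplus>\<^bsub>presented R\<^esub> Z = X \<oplus>\<^bsub>presented R\<^esub> (Y \<oplus>\<^bsub>presented R\<^esub> Z)"
      by (simp add: xyz presented_simps add.assoc)
  next
    fix X Y assume "X \<in> carrier (presented R)" "Y \<in> carrier (presented R)"
    then obtain x y where xy: "X = cls R x" "Y = cls R y" using rep by metis
    show "X \<oplus>\<^bsub>presented R\<^esub> Y = Y \<oplus>\<^bsub>presented R\<^esub> X"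
      by (simp add: xy presented_simps add.commute)
    show "X \<oplus>\<^bsub>presented R\<^esub> Y \<in> carrier (presented R)"
      by (simp add: xy presented_simps)
  next
    fix X assume "X \<in> carrier (presented R)"
    then obtain x where x: "X = cls R x" using rep by metis
    have "cls R (- x) \<oplus>\<^bsub>presented R\<^esub> X = \<zero>\<^bsub>presented R\<^esub>" by (simp add: x presented_simps)
    then show "\<exists>Y\<in>carrier (presented R). Y \<oplus>\<^bsub>presented R\<^esub> X = \<zero>\<^bsub>presented R\<^esub>"
      by (auto simp: presented_simps(1))
    show "\<zero>\<^bsub>presented R\<^esub> \<oplus>\<^bsub>presented R\<^esub> X = X" by (simp add: x presented_simps)
  qed (simp add: presented_simps)
  then have "ring (presented R)"
    by (intro ringI monoidI) (auto simp: presented_simps distrib_left distrib_right mult.assoc)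
  moreover have "unital_algebra_axioms (presented R)"
  proof (rule unital_algebra_axioms.intro)
    fix X Y c assume "X \<in> carrier (presented R)" "Y \<in> carrier (presented R)"
    then obtain x y where xy: "X = cls R x" "Y = cls R y" using rep by metis
    have "x * (scalar c * y) = scalar c * (x * y)"
      by (metis mult.assoc scalar_central)
    then show "X \<otimes>\<^bsub>presented R\<^esub> (c \<odot>\<^bsub>presented R\<^esub> Y) = c \<odot>\<^bsub>presented R\<^esub> (X \<otimes>\<^bsub>presented R\<^esub> Y)"
      by (simp only: xy presented_simps)
  qed (auto dest!: rep simp: presented_simps scalar_simps distrib_left distrib_right mult.assoc)
  ultimately show ?thesis by (rule unital_algebra.intro)
qed

lemma cls_hom: "cls R \<in> alg_hom free_algebra (presented R)"
  by (auto simp: alg_hom_def presented_simps intro!: ring_hom_memI)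

lemma (in unital_algebra)
  assumes h: "\<And>g. h g \<in> carrier B" and R: "\<And>r. r \<in> R \<Longrightarrow> eval_free B h r = \<zero>"
  shows extend_hom_cls: "extend_hom B h (cls R p) = eval_free B h p"
    and extend_hom_hom: "extend_hom B h \<in> alg_hom (presented R) B"
proof -
  note ev = eval_free_closed[of h, OF h] eval_free_add[of h, OF h] eval_free_mult[of h, OF h]
    eval_free_zero[of h, OF h] eval_free_one[of h, OF h] eval_free_uminus[of h, OF h]
    eval_free_scalar[of h, OF h] smult_mult_left smult_closed
  have "ideal {p. eval_free B h p = \<zero>} free_algebra"
  proof (rule idealI[OF free.ring_axioms])
    show "subgroup {p. eval_free B h p = \<zero>} (add_monoid free_algebra)"
      by (rule free.add.subgroupI)
         (auto simp: ev free_uminus intro: exI[of _ 0])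
  qed (auto simp: ev)
  then have "rel_ideal R \<subseteq> {p. eval_free B h p = \<zero>}"
    using R unfolding rel_ideal_def by (intro free.genideal_minimal) auto
  then have eq: "eval_free B h x = eval_free B h y" if "x \<in> cls R y" for x y
    using that ev(2)[of "x - y" y] by (auto simp: mem_cls_iff ev(1))
  show *: "extend_hom B h (cls R p) = eval_free B h p" for p
    unfolding extend_hom_def
    by (rule eq, rule someI[of _ p]) (simp add: mem_cls_iff rel_ideal_closed)
  show "extend_hom B h \<in> alg_hom (presented R) B"
    unfolding alg_hom_def
    by (auto intro!: ring_hom_memI simp: presented_simps * ev)
qed


lemma (in unital_algebra) extend_hom_generator:
  assumes h: "\<And>g. h g \<in> carrier B" and R: "\<And>r. r \<in> R \<Longrightarrow> eval_free B h r = \<zero>"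
  shows "extend_hom B h (generator R g) = h g"
  by (simp add: extend_hom_cls[OF h R] eval_free_var[OF h])


section \<open>Tensor products of algebras\<close>

text \<open>
  \<^term>\<open>tensor_rels R S\<close> presents the tensor product of \<^term>\<open>presented R\<close> and \<^term>\<open>presented S\<close>:
  \<open>Inl g\<close> stands for the tensor of \<open>g\<close> and 1, \<open>Inr h\<close> for the tensor of 1 and \<open>h\<close>, and the two
  factors commute.
\<close>

definition tensor_rels ::
  "'g free_alg set \<Rightarrow> 'h free_alg set \<Rightarrow> ('g + 'h) free_alg set" where
  "tensor_rels R S =
     eval_free free_algebra (\<lambda>g. var (Inl g)) ` R
   \<union> eval_free free_algebra (\<lambda>h. var (Inr h)) ` S
   \<union> {var (Inl g) * var (Inr h) - var (Inr h) * var (Inl g) | g h. True}"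

definition pure_tensor ::
  "'g free_alg set \<Rightarrow> 'h free_alg set \<Rightarrow> 'g free_alg set \<Rightarrow> 'h free_alg set
     \<Rightarrow> ('g + 'h) free_alg set" where
  "pure_tensor R S X Y =
     (let T = tensor_rels R S in
        extend_hom (presented T) (\<lambda>g. generator T (Inl g)) X
          \<otimes>\<^bsub>presented T\<^esub> extend_hom (presented T) (\<lambda>h. generator T (Inr h)) Y)"

text \<open>
  The tensor product of the homomorphisms \<^term>\<open>f\<close> from \<^term>\<open>presented R\<close> to \<^term>\<open>presented R'\<close>
  and \<^term>\<open>f'\<close> from \<^term>\<open>presented S\<close> to \<^term>\<open>presented S'\<close>.
\<close>

definition tensor_map ::
  "'g free_alg set \<Rightarrow> 'h free_alg set \<Rightarrow> 'k free_alg set \<Rightarrow> 'l free_alg set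
     \<Rightarrow> ('g free_alg set \<Rightarrow> 'k free_alg set) \<Rightarrow> ('h free_alg set \<Rightarrow> 'l free_alg set)
     \<Rightarrow> ('g + 'h) free_alg set \<Rightarrow> ('k + 'l) free_alg set" where
  "tensor_map R S R' S' f f' =
     extend_hom (presented (tensor_rels R' S'))
       (case_sum
          (\<lambda>g. pure_tensor R' S' (f (generator R g)) \<one>\<^bsub>presented S'\<^esub>)
          (\<lambda>h. pure_tensor R' S' \<one>\<^bsub>presented R'\<^esub> (f' (generator S h))))"

text \<open>The associativity isomorphism from \<open>A \<otimes> (B \<otimes> C)\<close> to \<open>(A \<otimes> B) \<otimes> C\<close>.\<close>

definition tensor_assoc ::
  "'g free_alg set \<Rightarrow> 'h free_alg set \<Rightarrow> 'k free_alg set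
     \<Rightarrow> ('g + ('h + 'k)) free_alg set \<Rightarrow> (('g + 'h) + 'k) free_alg set" where
  "tensor_assoc R S T =
     (let W = tensor_rels (tensor_rels R S) T in
        extend_hom (presented W)
          (case_sum (\<lambda>g. generator W (Inl (Inl g)))
             (case_sum (\<lambda>h. generator W (Inl (Inr h))) (\<lambda>k. generator W (Inr k)))))"


section \<open>The quantum algebra of sl2\<close>

datatype uq_gen = UE | UF | UQ | UQi  \<comment> \<open>\<open>E\<close>, \<open>F\<close>, \<open>q\<^sup>H\<close> and its inverse\<close>

definition Uq_rels :: "complex \<Rightarrow> uq_gen free_alg set" where
  "Uq_rels q =
     {var UQ * var UQi - 1,
      var UQi * var UQ - 1,
      var UQ * var UE - scalar q * var UE * var UQ,
      var UQ * var UF - scalar (inverse q) * var UF * var UQ,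
      var UE * var UF - var UF * var UE
        - scalar (1 / (q - inverse q)) * (var UQ ^ 2 - var UQi ^ 2)}"

abbreviation Uq :: "complex \<Rightarrow> (complex, uq_gen free_alg set) module" where
  "Uq q \<equiv> presented (Uq_rels q)"

definition casimir :: "complex \<Rightarrow> uq_gen free_alg set" where
  "casimir q = cls (Uq_rels q)
     (scalar ((q - inverse q)\<^sup>2) * var UF * var UE
       + scalar q * var UQ ^ 2 + scalar (inverse q) * var UQi ^ 2)"

abbreviation Uq2_rels :: "complex \<Rightarrow> (uq_gen + uq_gen) free_alg set" where
  "Uq2_rels q \<equiv> tensor_rels (Uq_rels q) (Uq_rels q)"

abbreviation Uq3_rels :: "complex \<Rightarrow> ((uq_gen + uq_gen) + uq_gen) free_alg set" where
  "Uq3_rels q \<equiv> tensor_rels (Uq2_rels q) (Uq_rels q)"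

definition comult ::
  "complex \<Rightarrow> uq_gen free_alg set \<Rightarrow> (uq_gen + uq_gen) free_alg set" where
  "comult q =
     (let t = (\<lambda>a b. pure_tensor (Uq_rels q) (Uq_rels q)
                       (generator (Uq_rels q) a) (generator (Uq_rels q) b));
          U2 = presented (Uq2_rels q)
      in extend_hom U2
           (\<lambda>g. case g of
                  UE \<Rightarrow> t UE UQi \<oplus>\<^bsub>U2\<^esub> t UQ UE
                | UF \<Rightarrow> t UF UQi \<oplus>\<^bsub>U2\<^esub> t UQ UF
                | UQ \<Rightarrow> t UQ UQ
                | UQi \<Rightarrow> t UQi UQi))"

definition comult2 ::
  "complex \<Rightarrow> uq_gen free_alg set \<Rightarrow> ((uq_gen + uq_gen) + uq_gen) free_alg set" where
  "comult2 q X =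
     tensor_map (Uq_rels q) (Uq_rels q) (Uq2_rels q) (Uq_rels q) (comult q) (\<lambda>Y. Y)
       (comult q X)"


section \<open>Representations and the centralizer\<close>

text \<open>The algebra of endomorphisms of the \<open>d\<close>-dimensional coordinate space.\<close>

abbreviation mat_alg :: "nat \<Rightarrow> (complex, complex mat) module" where
  "mat_alg d \<equiv> module_mat TYPE(complex) d d"

definition kron :: "complex mat \<Rightarrow> complex mat \<Rightarrow> complex mat" where
  "kron A B = mat (dim_row A * dim_row B) (dim_col A * dim_col B)
     (\<lambda>(i, j). A $$ (i div dim_row B, j div dim_col B) * B $$ (i mod dim_row B, j mod dim_col B))"

text \<open>
  Throughout, a spin \<open>j \<in> {0, 1/2, 1, \<dots>}\<close> is encoded by the natural number \<open>n = 2 j\<close>, and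
  \<open>s\<close> is the chosen square root of \<open>q\<close>, so that \<open>q\<^sup>m = s powi (2 m)\<close> for half-integers \<open>m\<close>.

  In the basis \<open>v, F v, \<dots>, F\<^sup>n v\<close> of \<open>M\<^sub>j\<close>, where \<open>v\<close> is the highest weight vector, \<open>q\<^sup>H\<close> acts on
  \<open>F\<^sup>k v\<close> by \<open>q\<^sup>j\<^sup>-\<^sup>k = s powi (n - 2 k)\<close>, and \<open>E F\<^sup>k v = [k]\<^sub>q [n + 1 - k]\<^sub>q F\<^sup>k\<^sup>-\<^sup>1 v\<close>.
\<close>

definition qnum :: "complex \<Rightarrow> nat \<Rightarrow> complex" where
  "qnum q k = (q ^ k - inverse q ^ k) / (q - inverse q)"

definition spin_mat :: "complex \<Rightarrow> complex \<Rightarrow> nat \<Rightarrow> uq_gen \<Rightarrow> complex mat" where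
  "spin_mat q s n g = mat (n + 1) (n + 1) (\<lambda>(i, k). case g of
       UE \<Rightarrow> if k = i + 1 then qnum q k * qnum q (n + 1 - k) else 0
     | UF \<Rightarrow> if i = k + 1 then 1 else 0
     | UQ \<Rightarrow> if i = k then s powi (int n - 2 * int k) else 0
     | UQi \<Rightarrow> if i = k then s powi (2 * int k - int n) else 0)"

definition spin_rep :: "complex \<Rightarrow> complex \<Rightarrow> nat \<Rightarrow> uq_gen free_alg set \<Rightarrow> complex mat" where
  "spin_rep q s n = extend_hom (mat_alg (n + 1)) (spin_mat q s n)"

text \<open>
  The matrices define the spin representation: it is a homomorphism on the quantum algebra, it has
  a highest weight vector of weight \<open>q\<^sup>j = s\<^sup>n\<close>, and it is irreducible.
\<close>

lemma unital_algebra_mat: "unital_algebra (mat_alg d)"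
proof -
  have "ring (mat_alg d)"
    using ring_mat[where 'a=complex and n=d and b="\<lparr>smult = (\<cdot>\<^sub>m)\<rparr>"]
    by (simp add: ring_mat_def module_mat_def)
  then show ?thesis
    by (intro unital_algebra.intro unital_algebra_axioms.intro)
       (auto simp: module_mat_simps add_smult_distrib_right_mat add_smult_distrib_left_mat intro!: eq_matI simp: algebra_simps)
qed

lemma qnum_nonzero:
  assumes "q \<noteq> 0" "\<And>k::nat. k > 0 \<Longrightarrow> q ^ k \<noteq> 1" "k > 0"
  shows "q - inverse q \<noteq> 0" "qnum q k \<noteq> 0"
proof -
  have *: "q ^ m - inverse q ^ m \<noteq> 0" if "m > 0" for m
  proof
    assume "q ^ m - inverse q ^ m = 0"
    then have "q ^ (m + m) = 1" using assms(1) by (simp add: power_add field_simps)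
    then show False using assms(2)[of "m + m"] that by simp
  qed
  from *[of 1] show **: "q - inverse q \<noteq> 0" by simp
  then show "qnum q k \<noteq> 0" using *[OF assms(3)] by (simp add: qnum_def)
qed

lemma spin_mat_closed: "spin_mat q s n g \<in> carrier_mat (n + 1) (n + 1)"
  by (simp add: spin_mat_def)

lemma dim_spin_mat [simp]: "dim_row (spin_mat q s n g) = n + 1" "dim_col (spin_mat q s n g) = n + 1"
  by (simp_all add: spin_mat_def)

lemma qnum_identity:
  assumes "q \<noteq> 0" "q - inverse q \<noteq> 0" "k \<le> n"
  shows "qnum q (Suc k) * qnum q (n - k) - qnum q k * qnum q (Suc n - k)
      = (q powi (int n - 2 * int k) - q powi (2 * int k - int n)) / (q - inverse q)"
proof -
  obtain m where n: "n = k + m" using assms(3) le_Suc_ex by blast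
  have e: "int n - 2 * int k = int m - int k" "2 * int k - int n = int k - int m" using n by auto
  define x y where "x = q ^ k" and "y = q ^ m"
  have "x \<noteq> 0" "y \<noteq> 0" using assms(1) by (auto simp: x_def y_def)
  then have "(q * x - inverse (q * x)) * (y - inverse y) - (x - inverse x) * (q * y - inverse (q * y))
      = (q - inverse q) * (y / x - x / y)"
    using assms(1) by (simp add: field_simps)
  moreover have "q ^ Suc k = q * x" "inverse q ^ Suc k = inverse (q * x)" "q ^ m = y"
    "inverse q ^ m = inverse y" "q ^ k = x" "inverse q ^ k = inverse x" "q ^ Suc m = q * y"
    "inverse q ^ Suc m = inverse (q * y)" "q powi (int m - int k) = y / x" "q powi (int k - int m) = x / y"
    using assms(1) by (simp_all add: x_def y_def power_inverse power_int_diff)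
  moreover have "n - k = m" "Suc n - k = Suc m" using n by auto
  moreover have "d * z / (d * d) = z / d" if "d \<noteq> 0" for d z :: complex
    using that by simp
  ultimately show ?thesis
    using assms(2) unfolding e qnum_def times_divide_times_eq diff_divide_distrib[symmetric]
    by (simp only:)
qed

lemma spin_mat_vec:
  assumes "w \<in> carrier_vec (n + 1)" "i < n + 1"
  shows "(spin_mat q s n UE *\<^sub>v w) $ i = (if i < n then qnum q (i + 1) * qnum q (n - i) * w $ (i + 1) else 0)"
    "(spin_mat q s n UF *\<^sub>v w) $ i = (if i > 0 then w $ (i - 1) else 0)"
    "(spin_mat q s n UQ *\<^sub>v w) $ i = s powi (int n - 2 * int i) * w $ i"
    "(spin_mat q s n UQi *\<^sub>v w) $ i = s powi (2 * int i - int n) * w $ i"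
proof -
  have *: "(spin_mat q s n g *\<^sub>v w) $ i = (\<Sum>k\<in>{0..<n + 1}. spin_mat q s n g $$ (i, k) * w $ k)" for g
    using assms by (auto simp: scalar_prod_def spin_mat_def)
  have single: "(\<Sum>k\<in>{0..<n + 1}. (if k = j then f k else 0) * w $ k) = (if j < n + 1 then f j * w $ j else 0)"
    for j f by (subst sum.cong[OF refl, where h="\<lambda>k. if k = j then f k * w $ k else 0"]) (auto simp: sum.delta)
  show "(spin_mat q s n UE *\<^sub>v w) $ i = (if i < n then qnum q (i + 1) * qnum q (n - i) * w $ (i + 1) else 0)"
    using single[of "i+1" "\<lambda>k. qnum q k * qnum q (n + 1 - k)"] assms unfolding * by (simp add: spin_mat_def)
  show "(spin_mat q s n UQ *\<^sub>v w) $ i = s powi (int n - 2 * int i) * w $ i"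
    using single[of i "\<lambda>k. s powi (int n - 2 * int k)"] assms unfolding *
    by (simp add: spin_mat_def eq_commute[of i])
  show "(spin_mat q s n UQi *\<^sub>v w) $ i = s powi (2 * int i - int n) * w $ i"
    using single[of i "\<lambda>k. s powi (2 * int k - int n)"] assms unfolding *
    by (simp add: spin_mat_def eq_commute[of i])
  show "(spin_mat q s n UF *\<^sub>v w) $ i = (if i > 0 then w $ (i - 1) else 0)"
  proof (cases i)
    case 0 then show ?thesis using assms unfolding * by (simp add: spin_mat_def)
  next
    case (Suc j) then show ?thesis using single[of j "\<lambda>_. 1"] assms unfolding *
      by (simp add: spin_mat_def eq_commute[of j])
  qed
qed

lemma spin_mat_mult:
  assumes "X \<in> carrier_mat (n + 1) (n + 1)" "i < n + 1" "k < n + 1"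
  shows "(spin_mat q s n UE * X) $$ (i, k)
      = (if i < n then qnum q (i + 1) * qnum q (n - i) * X $$ (i + 1, k) else 0)"
    "(spin_mat q s n UF * X) $$ (i, k) = (if i > 0 then X $$ (i - 1, k) else 0)"
    "(spin_mat q s n UQ * X) $$ (i, k) = s powi (int n - 2 * int i) * X $$ (i, k)"
    "(spin_mat q s n UQi * X) $$ (i, k) = s powi (2 * int i - int n) * X $$ (i, k)"
proof -
  have col: "col X k \<in> carrier_vec (n + 1)" using assms by auto
  have *: "(spin_mat q s n g * X) $$ (i, k) = (spin_mat q s n g *\<^sub>v col X k) $ i" for g
    using assms by simp
  show "(spin_mat q s n UE * X) $$ (i, k)
      = (if i < n then qnum q (i + 1) * qnum q (n - i) * X $$ (i + 1, k) else 0)"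
    "(spin_mat q s n UF * X) $$ (i, k) = (if i > 0 then X $$ (i - 1, k) else 0)"
    "(spin_mat q s n UQ * X) $$ (i, k) = s powi (int n - 2 * int i) * X $$ (i, k)"
    "(spin_mat q s n UQi * X) $$ (i, k) = s powi (2 * int i - int n) * X $$ (i, k)"
    using assms unfolding * spin_mat_vec[OF col assms(2)] by auto
qed

lemma mat_alg_minus:
  assumes "X \<in> carrier_mat d d" "Y \<in> carrier_mat d d"
  shows "X \<ominus>\<^bsub>mat_alg d\<^esub> Y = X - Y"
proof -
  interpret unital_algebra "mat_alg d" by (rule unital_algebra_mat)
  have "\<ominus>\<^bsub>mat_alg d\<^esub> Y = - Y"
    using assms by (intro minus_equality) (auto simp: module_mat_simps)
  then show ?thesis using assms by (auto simp: a_minus_def module_mat_simps)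
qed

lemma spin_mat_relations:
  assumes q: "q \<noteq> 0" "q - inverse q \<noteq> 0" "s ^ 2 = q" and r: "r \<in> Uq_rels q"
  shows "eval_free (mat_alg (n + 1)) (spin_mat q s n) r = \<zero>\<^bsub>mat_alg (n + 1)\<^esub>"
proof -
  interpret unital_algebra "mat_alg (n + 1)" by (rule unital_algebra_mat)
  have s: "s \<noteq> 0" using q(1,3) by auto
  let ?m = "spin_mat q s n"
  have h: "?m g \<in> carrier (mat_alg (n + 1))" for g
    by (simp add: module_mat_simps spin_mat_def)
  note c = spin_mat_closed[of q s n]
  let ?E = "eval_free (mat_alg (n + 1)) ?m"
  have smult: "?E (scalar c * x) = c \<cdot>\<^sub>m ?E x" for c x
    using eval_free_smult[of ?m, OF h] by (simp only: module_mat_simps)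
  have mult: "?E (x * y) = ?E x * ?E y" for x y
    using eval_free_mult[of ?m, OF h] by (simp only: module_mat_simps)
  have one: "?E 1 = 1\<^sub>m (n + 1)"
    using eval_free_one[of ?m, OF h] by (simp only: module_mat_simps)
  have var: "?E (var g) = ?m g" for g
    using eval_free_var[of ?m, OF h] by (simp only:)
  have diff: "eval_free (mat_alg (n + 1)) ?m (x - y)
     = eval_free (mat_alg (n + 1)) ?m x - eval_free (mat_alg (n + 1)) ?m y" for x y
    using eval_free_diff[of ?m x y, OF h] eval_free_closed[of ?m, OF h]
    by (simp add: mat_alg_minus module_mat_simps)
  have entry: "?m g $$ (i, k) = (case g of
       UE \<Rightarrow> if k = i + 1 then qnum q k * qnum q (n + 1 - k) else 0
     | UF \<Rightarrow> if i = k + 1 then 1 else 0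
     | UQ \<Rightarrow> if i = k then s powi (int n - 2 * int k) else 0
     | UQi \<Rightarrow> if i = k then s powi (2 * int k - int n) else 0)" if "i < n + 1" "k < n + 1" for g i k
    using that by (simp add: spin_mat_def)
  have pw: "q powi k = s powi k * s powi k" for k
    unfolding q(3)[symmetric] power2_eq_square by (simp add: power_int_mult_distrib)
  have minus_0: "X - X = 0\<^sub>m (n + 1) (n + 1)" if "X \<in> carrier_mat (n + 1) (n + 1)" for X :: "complex mat"
    using that by (rule minus_r_inv_mat)
  have step: "s powi (int n - 2 * int i) = q * s powi (int n - 2 * (1 + int i))" for i
    using power_int_add[of s 2 "int n - 2 * (1 + int i)"] s q(3) by simp
  from r consider
      "r = var UQ * var UQi - 1" | "r = var UQi * var UQ - 1"
    | "r = var UQ * var UE - scalar q * (var UE * var UQ)"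
    | "r = var UQ * var UF - scalar (inverse q) * (var UF * var UQ)"
    | "r = var UE * var UF - var UF * var UE
        - scalar (1 / (q - inverse q)) * (var UQ * var UQ - var UQi * var UQi)"
    unfolding Uq_rels_def power2_eq_square by (auto simp: mult.assoc)
  then show ?thesis
  proof cases
    case 1
    have "?m UQ * ?m UQi = 1\<^sub>m (n + 1)"
      using s by (intro eq_matI) (auto simp: spin_mat_mult[OF c] entry power_int_add[symmetric] simp del: index_mult_mat(1))
    moreover have "?E r = ?m UQ * ?m UQi - 1\<^sub>m (n + 1)"
      unfolding 1 diff smult unfolding mult one var ..
    ultimately show ?thesis
      by (simp only: module_mat_simps(4)) (rule minus_0, use c in auto)
  next
    case 2
    have "?m UQi * ?m UQ = 1\<^sub>m (n + 1)"
      using s by (intro eq_matI) (auto simp: spin_mat_mult[OF c] entry power_int_add[symmetric] simp del: index_mult_mat(1))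
    moreover have "?E r = ?m UQi * ?m UQ - 1\<^sub>m (n + 1)"
      unfolding 2 diff smult unfolding mult one var ..
    ultimately show ?thesis
      by (simp only: module_mat_simps(4)) (rule minus_0, use c in auto)
  next
    case 3
    have "?m UQ * ?m UE = q \<cdot>\<^sub>m (?m UE * ?m UQ)"
      proof (intro eq_matI)
      show "(?m UQ * ?m UE) $$ (i, k) = (q \<cdot>\<^sub>m (?m UE * ?m UQ)) $$ (i, k)"
        if "i < dim_row (q \<cdot>\<^sub>m (?m UE * ?m UQ))" "k < dim_col (q \<cdot>\<^sub>m (?m UE * ?m UQ))" for i k
        using that step[of i]
        by (auto simp: spin_mat_mult[OF c] entry simp del: index_mult_mat(1))
    qed auto
    moreover have "?E r = ?m UQ * ?m UE - q \<cdot>\<^sub>m (?m UE * ?m UQ)"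
      unfolding 3 diff smult unfolding mult one var ..
    ultimately show ?thesis
      by (simp only: module_mat_simps(4)) (rule minus_0, use c in auto)
  next
    case 4
    have "?m UQ * ?m UF = inverse q \<cdot>\<^sub>m (?m UF * ?m UQ)"
      proof (intro eq_matI)
      show "(?m UQ * ?m UF) $$ (i, k) = (inverse q \<cdot>\<^sub>m (?m UF * ?m UQ)) $$ (i, k)"
        if "i < dim_row (inverse q \<cdot>\<^sub>m (?m UF * ?m UQ))" "k < dim_col (inverse q \<cdot>\<^sub>m (?m UF * ?m UQ))" for i k
        using that q(1) step[of k]
        by (auto simp: spin_mat_mult[OF c] entry simp del: index_mult_mat(1))
    qed auto
    moreover have "?E r = ?m UQ * ?m UF - inverse q \<cdot>\<^sub>m (?m UF * ?m UQ)"
      unfolding 4 diff smult unfolding mult one var ..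
    ultimately show ?thesis
      by (simp only: module_mat_simps(4)) (rule minus_0, use c in auto)
  next
    case 5
    have "?m UE * ?m UF - ?m UF * ?m UE = (1 / (q - inverse q)) \<cdot>\<^sub>m (?m UQ * ?m UQ - ?m UQi * ?m UQi)"
    proof (rule eq_matI)
      fix i k assume "i < dim_row ((1 / (q - inverse q)) \<cdot>\<^sub>m (?m UQ * ?m UQ - ?m UQi * ?m UQi))"
        "k < dim_col ((1 / (q - inverse q)) \<cdot>\<^sub>m (?m UQ * ?m UQ - ?m UQi * ?m UQi))"
      then have ik: "i < n + 1" "k < n + 1" by auto
      show "(?m UE * ?m UF - ?m UF * ?m UE) $$ (i, k)
          = ((1 / (q - inverse q)) \<cdot>\<^sub>m (?m UQ * ?m UQ - ?m UQi * ?m UQi)) $$ (i, k)"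
      proof -
        have q0: "qnum q 0 = 0" by (simp add: qnum_def)
        have "(?m UE * ?m UF) $$ (i, k) = (if i = k then qnum q (Suc i) * qnum q (n - i) else 0)"
          using ik q0 by (cases "i = n") (auto simp: spin_mat_mult[OF c] entry simp del: index_mult_mat(1))
        moreover have "(?m UF * ?m UE) $$ (i, k) = (if i = k then qnum q i * qnum q (Suc n - i) else 0)"
          using ik q0 by (cases i) (auto simp: spin_mat_mult[OF c] entry simp del: index_mult_mat(1))
        moreover have "(?m UQ * ?m UQ) $$ (i, k) = (if i = k then q powi (int n - 2 * int i) else 0)"
          "(?m UQi * ?m UQi) $$ (i, k) = (if i = k then q powi (2 * int i - int n) else 0)"
          using ik by (auto simp: spin_mat_mult[OF c] entry pw simp del: index_mult_mat(1))
        ultimately show ?thesis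
          using ik qnum_identity[OF q(1,2), of i n] by (auto simp del: index_mult_mat(1))
      qed
    qed auto
    moreover have "?E r = ?m UE * ?m UF - ?m UF * ?m UE - (1 / (q - inverse q)) \<cdot>\<^sub>m (?m UQ * ?m UQ - ?m UQi * ?m UQi)"
      unfolding 5 diff smult unfolding mult one var ..
    ultimately show ?thesis
      by (simp only: module_mat_simps(4)) (rule minus_0, use c in auto)
  qed
qed

lemma
  assumes "q \<noteq> 0" "q - inverse q \<noteq> 0" "s ^ 2 = q"
  shows spin_rep_hom: "spin_rep q s n \<in> alg_hom (Uq q) (mat_alg (n + 1))"
    and spin_rep_generator: "spin_rep q s n (generator (Uq_rels q) g) = spin_mat q s n g"
proof -
  interpret unital_algebra "mat_alg (n + 1)" by (rule unital_algebra_mat)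
  note * = spin_mat_closed[of q s n, folded module_mat_simps(5)[where ty = "TYPE(complex)"]]
    spin_mat_relations[OF assms]
  show "spin_rep q s n \<in> alg_hom (Uq q) (mat_alg (n + 1))"
    unfolding spin_rep_def by (rule extend_hom_hom[OF *])
  show "spin_rep q s n (generator (Uq_rels q) g) = spin_mat q s n g"
    unfolding spin_rep_def by (rule extend_hom_generator[OF *])
qed

lemma spin_rep_highest_weight:
  fixes n :: nat
  assumes "q \<noteq> 0" "q - inverse q \<noteq> 0" "s ^ 2 = q"
  defines "v \<equiv> unit_vec (n + 1) 0"
  shows "spin_rep q s n (generator (Uq_rels q) UE) *\<^sub>v v = 0\<^sub>v (n + 1)"
    and "spin_rep q s n (generator (Uq_rels q) UQ) *\<^sub>v v = s ^ n \<cdot>\<^sub>v v"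
proof -
  have v: "v \<in> carrier_vec (n + 1)" by (simp add: v_def)
  note gen = spin_rep_generator[OF assms(1-3)]
  show "spin_rep q s n (generator (Uq_rels q) UE) *\<^sub>v v = 0\<^sub>v (n + 1)"
    unfolding gen by (rule eq_vecI) (auto simp del: index_mult_mat_vec simp: spin_mat_vec[simplified] v_def)
  show "spin_rep q s n (generator (Uq_rels q) UQ) *\<^sub>v v = s ^ n \<cdot>\<^sub>v v"
    unfolding gen by (rule eq_vecI) (auto simp del: index_mult_mat_vec simp: spin_mat_vec[simplified] v_def)
qed

lemma spin_rep_irreducible:
  assumes q: "q \<noteq> 0" "\<And>k::nat. k > 0 \<Longrightarrow> q ^ k \<noteq> 1" "s ^ 2 = q"
    and W: "W \<subseteq> carrier_vec (n + 1)" "W \<noteq> {}" "W \<noteq> {0\<^sub>v (n + 1)}"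
    and add: "\<And>u w. u \<in> W \<Longrightarrow> w \<in> W \<Longrightarrow> u + w \<in> W"
    and smult: "\<And>c w. w \<in> W \<Longrightarrow> c \<cdot>\<^sub>v w \<in> W"
    and inv: "\<And>x w. x \<in> carrier (Uq q) \<Longrightarrow> w \<in> W \<Longrightarrow> spin_rep q s n x *\<^sub>v w \<in> W"
  shows "W = carrier_vec (n + 1)"
proof -
  have nz: "q - inverse q \<noteq> 0" "\<And>k. k > 0 \<Longrightarrow> qnum q k \<noteq> 0"
    using qnum_nonzero[of q] q(1,2) by blast+
  have gen: "spin_mat q s n g *\<^sub>v w \<in> W" if "w \<in> W" for g w
    using inv[OF _ that, of "generator (Uq_rels q) g"] spin_rep_generator[OF q(1) nz(1) q(3)]
    by (simp add: presented_simps)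
  have top: "unit_vec (n + 1) 0 \<in> W"
    if "w \<in> W" "m \<le> n" "w $ m \<noteq> 0" "\<And>i. m < i \<Longrightarrow> i \<le> n \<Longrightarrow> w $ i = 0" for m w
    using that
  proof (induction m arbitrary: w)
    case 0
    have w: "w \<in> carrier_vec (n + 1)" using 0(1) W(1) by blast
    have "unit_vec (n + 1) 0 = (1 / w $ 0) \<cdot>\<^sub>v w"
      using w 0(3,4) by (intro eq_vecI) auto
    then show ?case using smult[OF 0(1)] by simp
  next
    case (Suc m)
    have w: "w \<in> carrier_vec (n + 1)" using Suc.prems(1) W(1) by blast
    show ?case
    proof (rule Suc.IH[OF gen[OF Suc.prems(1), of UE]])
      show "(spin_mat q s n UE *\<^sub>v w) $ m \<noteq> 0"
        using Suc.prems spin_mat_vec(1)[OF w, of m] nz(2)[of "m + 1"] nz(2)[of "n - m"] by simp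
      show "(spin_mat q s n UE *\<^sub>v w) $ i = 0" if "m < i" "i \<le> n" for i
        using that Suc.prems spin_mat_vec(1)[OF w, of i] by simp
    qed (use Suc.prems in simp)
  qed
  obtain w where w: "w \<in> W" "w \<noteq> 0\<^sub>v (n + 1)" using W(2,3) by blast
  then have wc: "w \<in> carrier_vec (n + 1)" using W(1) by blast
  define m where "m = Max {i. i \<le> n \<and> w $ i \<noteq> 0}"
  have fin: "finite {i. i \<le> n \<and> w $ i \<noteq> 0}" by simp
  have "{i. i \<le> n \<and> w $ i \<noteq> 0} \<noteq> {}"
  proof
    assume "{i. i \<le> n \<and> w $ i \<noteq> 0} = {}"
    then have "w = 0\<^sub>v (n + 1)" using wc by (intro eq_vecI) auto
    then show False using w(2) by simp
  qed
  then have "m \<in> {i. i \<le> n \<and> w $ i \<noteq> 0}" unfolding m_def by (rule Max_in[OF fin])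
  moreover have "w $ i = 0" if "m < i" "i \<le> n" for i
  proof (rule ccontr)
    assume "w $ i \<noteq> 0"
    then have "i \<le> m" using that unfolding m_def by (intro Max_ge[OF fin]) simp
    then show False using that by simp
  qed
  ultimately have e0: "unit_vec (n + 1) 0 \<in> W" using top[OF w(1), of m] by blast
  have e: "unit_vec (n + 1) k \<in> W" if "k \<le> n" for k
    using that
  proof (induction k)
    case (Suc k)
    have "spin_mat q s n UF *\<^sub>v unit_vec (n + 1) k = unit_vec (n + 1) (Suc k)"
      using Suc.prems spin_mat_vec(2)[of "unit_vec (n + 1) k" n]
      by (intro eq_vecI) (auto simp del: index_mult_mat_vec simp:)
    then show ?case using gen[OF Suc.IH, of UF] Suc.prems by simp
  qed (use e0 in simp)
  have "u \<in> W" if u: "u \<in> carrier_vec (n + 1)" for u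
  proof -
    have "vec (n + 1) (\<lambda>i. if i < k then u $ i else 0) \<in> W" if "k \<le> n + 1" for k
      using that
    proof (induction k)
      case 0
      have "vec (n + 1) (\<lambda>i. if i < 0 then u $ i else 0) = 0 \<cdot>\<^sub>v unit_vec (n + 1) 0"
        by (intro eq_vecI) auto
      then show ?case using smult[OF e0] by metis
    next
      case (Suc k)
      have "vec (n + 1) (\<lambda>i. if i < Suc k then u $ i else 0)
          = vec (n + 1) (\<lambda>i. if i < k then u $ i else 0) + u $ k \<cdot>\<^sub>v unit_vec (n + 1) k"
        using Suc.prems by (intro eq_vecI) (auto simp: less_Suc_eq unit_vec_def)
      then show ?case using add[OF Suc.IH smult[OF e[of k]]] Suc.prems by simp
    qed
    from this[of "n + 1"] have "vec (n + 1) (\<lambda>i. if i < n + 1 then u $ i else 0) \<in> W" by simp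
    also have "vec (n + 1) (\<lambda>i. if i < n + 1 then u $ i else 0) = u"
      using u by (intro eq_vecI) auto
    finally show ?thesis .
  qed
  then show ?thesis using W(1) by blast
qed

text \<open>
  The tensor product of the representations \<^term>\<open>f\<close> of \<^term>\<open>presented R\<close> in dimension \<open>d\<close> and
  \<^term>\<open>f'\<close> of \<^term>\<open>presented S\<close> in dimension \<open>d'\<close>.
\<close>

definition tensor_rep ::
  "'g free_alg set \<Rightarrow> 'h free_alg set \<Rightarrow> nat \<Rightarrow> nat
     \<Rightarrow> ('g free_alg set \<Rightarrow> complex mat) \<Rightarrow> ('h free_alg set \<Rightarrow> complex mat)
     \<Rightarrow> ('g + 'h) free_alg set \<Rightarrow> complex mat" where
  "tensor_rep R S d d' f f' =
     extend_hom (mat_alg (d * d'))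
       (case_sum (\<lambda>g. kron (f (generator R g)) (1\<^sub>m d')) (\<lambda>h. kron (1\<^sub>m d) (f' (generator S h))))"

definition spin_rep3 ::
  "complex \<Rightarrow> complex \<Rightarrow> nat \<Rightarrow> nat \<Rightarrow> nat
     \<Rightarrow> ((uq_gen + uq_gen) + uq_gen) free_alg set \<Rightarrow> complex mat" where
  "spin_rep3 q s n1 n2 n3 =
     tensor_rep (Uq2_rels q) (Uq_rels q) ((n1 + 1) * (n2 + 1)) (n3 + 1)
       (tensor_rep (Uq_rels q) (Uq_rels q) (n1 + 1) (n2 + 1) (spin_rep q s n1) (spin_rep q s n2))
       (spin_rep q s n3)"

definition centralizer ::
  "complex \<Rightarrow> complex \<Rightarrow> nat \<Rightarrow> nat \<Rightarrow> nat \<Rightarrow> (complex, complex mat) module" where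
  "centralizer q s n1 n2 n3 =
     (let M = mat_alg ((n1 + 1) * (n2 + 1) * (n3 + 1)) in
        M\<lparr>carrier := {m \<in> carrier M. \<forall>x \<in> carrier (Uq q).
            spin_rep3 q s n1 n2 n3 (comult2 q x) * m - m * spin_rep3 q s n1 n2 n3 (comult2 q x)
              = \<zero>\<^bsub>M\<^esub>}\<rparr>)"

definition C12 :: "complex \<Rightarrow> complex \<Rightarrow> nat \<Rightarrow> nat \<Rightarrow> nat \<Rightarrow> complex mat" where
  "C12 q s n1 n2 n3 = spin_rep3 q s n1 n2 n3
     (pure_tensor (Uq2_rels q) (Uq_rels q) (comult q (casimir q)) \<one>\<^bsub>Uq q\<^esub>)"

definition C23 :: "complex \<Rightarrow> complex \<Rightarrow> nat \<Rightarrow> nat \<Rightarrow> nat \<Rightarrow> complex mat" where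
  "C23 q s n1 n2 n3 = spin_rep3 q s n1 n2 n3
     (tensor_assoc (Uq_rels q) (Uq_rels q) (Uq_rels q)
       (pure_tensor (Uq_rels q) (Uq2_rels q) \<one>\<^bsub>Uq q\<^esub> (comult q (casimir q))))"

definition C123 :: "complex \<Rightarrow> complex \<Rightarrow> nat \<Rightarrow> nat \<Rightarrow> nat \<Rightarrow> complex mat" where
  "C123 q s n1 n2 n3 = spin_rep3 q s n1 n2 n3 (comult2 q (casimir q))"


section \<open>The Askey-Wilson algebra and its quotient\<close>

definition chi :: "complex \<Rightarrow> nat \<Rightarrow> complex" where
  "chi q n = q ^ (n + 1) + inverse q ^ (n + 1)"

text \<open>The sets of spins, in the doubled encoding; hence the steps of size two.\<close>

definition spins2 :: "nat \<Rightarrow> nat \<Rightarrow> nat set" where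
  "spins2 a b = {c. \<exists>k::nat. int c = \<bar>int a - int b\<bar> + 2 * int k \<and> c \<le> a + b}"

definition spins3 :: "nat \<Rightarrow> nat \<Rightarrow> nat \<Rightarrow> nat set" where
  "spins3 a b c = (\<Union>j \<in> spins2 a b. spins2 j c)"

definition chi_diffs :: "complex \<Rightarrow> nat \<Rightarrow> nat \<Rightarrow> nat \<Rightarrow> complex set" where
  "chi_diffs q a b c = (\<Union>j \<in> spins2 a b. {chi q l - chi q j | l. l \<in> spins2 j c})"

datatype aw_gen = GA | GB | GD | GK | G1 | G2 | G3  \<comment> \<open>\<open>G1\<close>, \<open>G2\<close>, \<open>G3\<close> are the \<open>\<alpha>\<^sub>i\<close>\<close>

definition q_comm :: "complex \<Rightarrow> 'g free_alg \<Rightarrow> 'g free_alg \<Rightarrow> 'g free_alg" where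
  "q_comm q x y = scalar q * x * y - scalar (inverse q) * y * x"

definition AW_rels :: "complex \<Rightarrow> aw_gen free_alg set" where
  "AW_rels q =
     (let A = var GA; B = var GB; D = var GD; K = var GK; a1 = var G1; a2 = var G2; a3 = var G3;
          u = scalar (1 / (q^2 - inverse q ^ 2)); v = scalar (1 / (q + inverse q))
      in {var z * var g - var g * var z | z g. z \<in> {GK, G1, G2, G3}}
       \<union> {A + u * q_comm q B D - v * (a1 * a2 + a3 * K),
          B + u * q_comm q D A - v * (a2 * a3 + a1 * K),
          D + u * q_comm q A B - v * (a1 * a3 + a2 * K)})"

definition AW_D' :: "complex \<Rightarrow> aw_gen free_alg" where
  "AW_D' q = scalar (1 / (q + inverse q)) * (var G1 * var G3 + var G2 * var GK)
     - scalar (1 / (q^2 - inverse q ^ 2)) * q_comm q (var GB) (var GA)"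

definition AW_Omega :: "complex \<Rightarrow> aw_gen free_alg" where
  "AW_Omega q =
     (let A = var GA; B = var GB; D = var GD; K = var GK; a1 = var G1; a2 = var G2; a3 = var G3
      in scalar q * A * (a1 * a2 + a3 * K) + scalar (inverse q) * B * (a2 * a3 + a1 * K)
         + scalar q * D * (a1 * a3 + a2 * K)
         - scalar (q^2) * A^2 - scalar (inverse q ^ 2) * B^2 - scalar (q^2) * D^2
         - scalar q * A * B * D)"

text \<open>
  The product of the elements \<open>x - c i\<close> for \<open>i \<in> S\<close>. These factors commute with each other, so the
  order in which they are multiplied does not matter.
\<close>

definition root_prod :: "'i set \<Rightarrow> ('i \<Rightarrow> complex) \<Rightarrow> 'g free_alg \<Rightarrow> 'g free_alg" where
  "root_prod S c x = Finite_Set.fold (\<lambda>i y. (x - scalar (c i)) * y) 1 S"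

definition AWbar_rels :: "complex \<Rightarrow> nat \<Rightarrow> nat \<Rightarrow> nat \<Rightarrow> aw_gen free_alg set" where
  "AWbar_rels q n1 n2 n3 =
     (let A = var GA; B = var GB; D = var GD; D' = AW_D' q; K = var GK;
          x1 = chi q n1; x2 = chi q n2; x3 = chi q n3
      in AW_rels q
       \<union> {var G1 - scalar x1, var G2 - scalar x2, var G3 - scalar x3,
          root_prod (spins2 n1 n2) (chi q) A,
          root_prod (spins2 n2 n3) (chi q) B,
          root_prod (spins3 n1 n2 n3) (chi q) K,
          root_prod (spins2 n1 n3) (chi q) D,
          root_prod (spins2 n1 n3) (chi q) D',
          root_prod (chi_diffs q n1 n2 n3) id (K - A),
          root_prod (chi_diffs q n2 n3 n1) id (K - B),
          root_prod (chi_diffs q n1 n3 n2) id (K - D),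
          root_prod (chi_diffs q n1 n3 n2) id (K - D'),
          AW_Omega q - (scalar (x1^2 + x2^2 + x3^2) + K^2 + scalar (x1 * x2 * x3) * K
                        - scalar ((q + inverse q)^2))})"

abbreviation AWbar :: "complex \<Rightarrow> nat \<Rightarrow> nat \<Rightarrow> nat \<Rightarrow> (complex, aw_gen free_alg set) module" where
  "AWbar q n1 n2 n3 \<equiv> presented (AWbar_rels q n1 n2 n3)"

abbreviation AWbar_gen :: "complex \<Rightarrow> nat \<Rightarrow> nat \<Rightarrow> nat \<Rightarrow> aw_gen \<Rightarrow> aw_gen free_alg set" where
  "AWbar_gen q n1 n2 n3 \<equiv> generator (AWbar_rels q n1 n2 n3)"

end

theory Submission
  imports Defs
begin

text \<open>
  A highest weight vector of \<open>M\<^sub>j \<otimes> M\<^sub>1\<^sub>/\<^sub>2 \<otimes> M\<^sub>1\<^sub>/\<^sub>2\<close> is determined by its component in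
  \<open>v \<otimes> M\<^sub>1\<^sub>/\<^sub>2 \<otimes> M\<^sub>1\<^sub>/\<^sub>2\<close>, where \<open>v\<close> is the highest weight vector of \<open>M\<^sub>j\<close>. Hence the highest weight spaces of spin \<open>j + 1\<close>, \<open>j\<close>, \<open>j - 1\<close> have
  dimensions 1, 2, 1, and the action of the centralizer on them embeds it in the product of \<open>\<complex>\<close>, the
  two by two matrices and \<open>\<complex>\<close>. On the other side, \<open>K\<close> is central and annihilated by a polynomial with
  three simple roots. Modulo an outer root the relations for \<open>K - A\<close> and \<open>K - D\<close> force \<open>A\<close> and
  \<open>D\<close>, and then \<open>B\<close>, to be scalars. Modulo the middle root \<open>A\<close> and \<open>B\<close> satisfy quadratic relations;
  eliminating \<open>D\<close> gives a cubic relation that the quadratic one for \<open>A\<close> collapses to a formula for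
  \<open>AB + BA\<close> linear in \<open>1, A, B\<close>, so \<open>1, A, B, AB\<close> span. Hence the quotient has dimension at most 6.
  Its three explicit representations of dimensions 1, 2, 1 show that it is the same product, and they
  agree with the action of \<open>C\<^sub>1\<^sub>2\<close>, \<open>C\<^sub>2\<^sub>3\<close>, \<open>C\<^sub>1\<^sub>2\<^sub>3\<close> on the highest weight spaces.
\<close>

text \<open>The Askey-Wilson relations are never verified in the triple tensor product itself. They
  hold in the three small representations and lift to the centralizer because it acts faithfully on
  highest weight vectors; surjectivity is inherited in the same way, since the quotient already
  fills the whole product of blocks. Faithfulness is a direct computation: F generates the module
  from four explicit highest weight vectors, which rests on two coefficients being nonzero. The
  basis of the middle space is chosen by tensor coordinates, not as an eigenbasis of A, so that all
  matrix entries are Laurent polynomials in q and x = q^(n+1) and the identities can be multiplied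
  out using q p = 1 and x y = 1. Spin 1/2 is excluded for a visible reason: removing ABA divides by
  a multiple of q^4 + p^4 - x^2 - y^2, which vanishes for n = 1. The image of D is not prescribed;
  as a polynomial in the other generators it carries no freedom, and this also gives
  uniqueness.\<close>

section \<open>Products of linear factors and two-sided ideals of the free algebra\<close>

lemma root_prod_commute:
  "comp_fun_commute (\<lambda>i y. ((x :: 'g free_alg) - scalar (c i)) * y)"
proof
  have *: "(x - scalar (c i)) * ((x - scalar (c j)) * z) = (x - scalar (c j)) * ((x - scalar (c i)) * z)" for i j z
  proof -
    have "scalar (c i) * scalar (c j) = scalar (c j) * (scalar (c i) :: 'g free_alg)"
      by (rule scalar_central)
    then have "(x - scalar (c i)) * (x - scalar (c j)) = (x - scalar (c j)) * (x - scalar (c i))"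
      by (simp add: left_diff_distrib right_diff_distrib scalar_central[of x])
    then show ?thesis by (simp only: mult.assoc[symmetric])
  qed
  show "(*) (x - scalar (c j)) \<circ> (*) (x - scalar (c i)) = (*) (x - scalar (c i)) \<circ> (*) (x - scalar (c j))" for i j
    by (rule ext) (simp only: o_apply *)
qed

lemma root_prod_remove:
  assumes "finite S" "i \<in> S"
  shows "root_prod S c x = (x - scalar (c i)) * root_prod (S - {i}) c x"
  unfolding root_prod_def
  by (rule comp_fun_commute_on.fold_rec[of UNIV])
     (use assms root_prod_commute[of x c] in \<open>auto simp: comp_fun_commute_def'\<close>)

lemma root_prod_insert:
  assumes "finite S" "i \<notin> S"
  shows "root_prod (insert i S) c x = (x - scalar (c i)) * root_prod S c x"
  using root_prod_remove[of "insert i S" i c x] assms by simp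

lemma root_prod_empty [simp]: "root_prod {} c x = 1"
  by (simp add: root_prod_def)

lemma root_prod_remove2:
  assumes "finite S" "i \<in> S" "j \<in> S" "i \<noteq> j"
  shows "root_prod S c x = (x - scalar (c i)) * ((x - scalar (c j)) * root_prod (S - {i, j}) c x)"
proof -
  have "S - {i, j} = S - {i} - {j}" by auto
  then show ?thesis
    using assms root_prod_remove[of S i c x] root_prod_remove[of "S - {i}" j c x] by simp
qed

text \<open>A bare predicate instead of the \<open>ideal\<close> locale, because the proof works
  modulo several ideals at once: \<open>rel_ideal R\<close> and the larger annihilators called
  \<open>block\<close>.\<close>

definition two_sided :: "'g free_alg set \<Rightarrow> bool" where
  "two_sided J \<longleftrightarrow> 0 \<in> J \<and> (\<forall>x\<in>J. \<forall>y\<in>J. x + y \<in> J) \<and> (\<forall>x\<in>J. \<forall>y. y * x \<in> J \<and> x * y \<in> J)"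

lemma two_sidedD:
  assumes "two_sided J"
  shows "0 \<in> J" "x \<in> J \<Longrightarrow> y \<in> J \<Longrightarrow> x + y \<in> J" "x \<in> J \<Longrightarrow> y * x \<in> J" "x \<in> J \<Longrightarrow> x * y \<in> J"
    "x \<in> J \<Longrightarrow> - x \<in> J" "x \<in> J \<Longrightarrow> y \<in> J \<Longrightarrow> x - y \<in> J"
proof -
  show *: "0 \<in> J" "x \<in> J \<Longrightarrow> y \<in> J \<Longrightarrow> x + y \<in> J" "x \<in> J \<Longrightarrow> y * x \<in> J" "x \<in> J \<Longrightarrow> x * y \<in> J" for x y
    using assms by (auto simp: two_sided_def)
  show "x \<in> J \<Longrightarrow> - x \<in> J" for x using *(3)[of x "-1"] by simp
  then show "x \<in> J \<Longrightarrow> y \<in> J \<Longrightarrow> x - y \<in> J" using *(2)[of x "- y"] by simp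
qed

lemma two_sided_rel_ideal: "two_sided (rel_ideal R)"
  by (simp add: two_sided_def rel_ideal_closed)

lemma two_sided_scalar_cancel:
  assumes "two_sided J" "scalar c * x \<in> J" "c \<noteq> 0"
  shows "x \<in> J"
proof -
  have "scalar (inverse c) * (scalar c * x) \<in> J" by (rule two_sidedD(3)[OF assms(1,2)])
  also have "scalar (inverse c) * (scalar c * x) = scalar (inverse c * c) * x"
    by (simp add: scalar_simps mult.assoc)
  finally show ?thesis using assms(3) by (simp add: scalar_simps)
qed

lemma scalar_diff: "scalar (a - b) = (scalar a - scalar b :: 'g free_alg)"
  by (simp add: scalar_def single_diff)

text \<open>Modulo J the element u = x - a satisfies u(x - b) = 0, so multiplication by u replaces x
  by b and k by c. Hence u times the product over S is a nonzero multiple of u, while it also lies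
  in J.\<close>

lemma root_excluded:
  fixes x k :: "'g free_alg"
  assumes J: "two_sided J" and k: "k - scalar c \<in> J"
    and q: "(x - scalar a) * (x - scalar b) \<in> J"
    and S: "finite S" "root_prod S id (k - x) \<in> J" "\<And>m. m \<in> S \<Longrightarrow> c - b \<noteq> m"
  shows "x - scalar a \<in> J"
proof -
  note J' = two_sidedD[OF J]
  \<comment> \<open>The scalar is the product of the numbers c - b - m over S, built one factor at a
    time.\<close>
  have "\<exists>d. d \<noteq> 0 \<and> (x - scalar a) * root_prod S id (k - x) - scalar d * (x - scalar a) \<in> J"
    using S(1,3)
  proof (induction S rule: finite_induct)
    case empty
    then show ?case by (auto intro!: exI[of _ 1] simp: scalar_simps J'(1))
  next
    case (insert m S)
    then obtain d where d: "d \<noteq> 0" "(x - scalar a) * root_prod S id (k - x) - scalar d * (x - scalar a) \<in> J"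
      by blast
    let ?u = "x - scalar a" and ?P = "root_prod S id (k - x)" and ?e = "c - b - m"
    have "?u * (k - x - scalar m) - scalar ?e * ?u
        = ?u * (k - scalar c) - (x - scalar a) * (x - scalar b)"
    proof -
      have "scalar ?e = scalar c - scalar b - (scalar m :: 'g free_alg)"
        by (simp add: scalar_diff)
      moreover have "?u * (k - x - scalar m) = ?u * (k - scalar c) - ?u * (x - scalar b)
          + ?u * (scalar c - scalar b - scalar m)"
        by (simp add: algebra_simps)
      moreover have "?u * scalar e = scalar e * ?u" for e by (rule scalar_central)
      ultimately show ?thesis by (simp add: left_diff_distrib right_diff_distrib)
    qed
    also have "\<dots> \<in> J" by (intro J' k q)
    finally have 1: "(?u * (k - x - scalar m) - scalar ?e * ?u) * ?P \<in> J" by (rule J')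
    have 2: "scalar ?e * (?u * ?P - scalar d * ?u) \<in> J" by (rule J'(3)[OF d(2)])
    have "?u * root_prod (insert m S) id (k - x) - scalar (?e * d) * ?u
        = (?u * (k - x - scalar m) - scalar ?e * ?u) * ?P + scalar ?e * (?u * ?P - scalar d * ?u)"
      unfolding root_prod_insert[OF insert(1,2)] id_apply[of m] scalar_simps(4)
      by (simp only: left_diff_distrib right_diff_distrib mult.assoc) simp
    also have "\<dots> \<in> J" by (intro J'(2) 1 2)
    finally have "?u * root_prod (insert m S) id (k - x) - scalar (?e * d) * ?u \<in> J" .
    then show ?case using insert(4)[of m] d(1) by (intro exI[of _ "?e * d"] conjI) (simp, assumption)
  qed
  then obtain d where d: "d \<noteq> 0" "(x - scalar a) * root_prod S id (k - x) - scalar d * (x - scalar a) \<in> J"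
    by auto
  have "(x - scalar a) * root_prod S id (k - x) - ((x - scalar a) * root_prod S id (k - x) - scalar d * (x - scalar a)) \<in> J"
    by (intro J'(6) J'(3) S d)
  then have "scalar d * (x - scalar a) \<in> J" by simp
  then show ?thesis using two_sided_scalar_cancel[OF J] d(1) by blast
qed

text \<open>Serves two purposes: a span stable under left multiplication by generators is recognised
  as everything, and identities between evaluations are checked one generator at a time.\<close>

lemma var_induct [case_names add smult one var]:
  fixes p :: "'g free_alg"
  assumes add: "\<And>x y. P x \<Longrightarrow> P y \<Longrightarrow> P (x + y)" and sc: "\<And>c x. P x \<Longrightarrow> P (scalar c * x)"
    and one: "P 1" and var: "\<And>g x. P x \<Longrightarrow> P (var g * x)"
  shows "P p"
proof (induction p rule: free_alg_induct)
  case zero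
  then show ?case using sc[OF one, of 0] by (simp add: scalar_simps)
next
  case (single w c)
  have "P (Poly_Mapping.single (Word xs) 1)" for xs
  proof (induction xs)
    case Nil
    then show ?case using one by (simp add: zero_word_def[symmetric])
  next
    case (Cons g xs)
    then show ?case using var[OF Cons, of g] by (simp add: var_def mult_single plus_word_def)
  qed
  from sc[OF this[of "letters w"], of c] show ?case by (simp add: scalar_def mult_single)
qed (rule add)

text \<open>Taking the commutator with z is a derivation, so its vanishing modulo J on generators
  spreads to the free algebra.\<close>

lemma central_mod:
  assumes J: "two_sided J" and z: "\<And>g. z * var g - var g * z \<in> J"
  shows "z * p - p * z \<in> J"
proof (induction p rule: var_induct)
  fix x y assume "z * x - x * z \<in> J" "z * y - y * z \<in> J"
  from two_sidedD(2)[OF J this] show "z * (x + y) - (x + y) * z \<in> J" by (simp add: algebra_simps)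
next
  fix x c assume "z * x - x * z \<in> J"
  from two_sidedD(3)[OF J this, of "scalar c"] show "z * (scalar c * x) - scalar c * x * z \<in> J"
    by (simp add: right_diff_distrib mult.assoc[symmetric] scalar_central[of z])
next
  show "z * 1 - 1 * z \<in> J" using two_sidedD(1)[OF J] by simp
next
  fix g x assume x: "z * x - x * z \<in> J"
  have "z * (var g * x) - var g * x * z = (z * var g - var g * z) * x + var g * (z * x - x * z)"
    by (simp add: algebra_simps)
  also have "\<dots> \<in> J" by (intro two_sidedD(2-4)[OF J] x z)
  finally show "z * (var g * x) - var g * x * z \<in> J" .
qed

section \<open>Evaluation in two by two matrices\<close>

text \<open>Explicit entries let every matrix identity be settled by multiplying out. The
  one-dimensional representations are placed here too, as scalar matrices, so that all three blocks
  share one evaluation map.\<close>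

datatype m2 = M2 complex complex complex complex

instantiation m2 :: ring_1
begin

definition "0 = M2 0 0 0 0"
definition "1 = M2 1 0 0 1"
fun plus_m2 where "M2 a b c d + M2 a' b' c' d' = M2 (a + a') (b + b') (c + c') (d + d')"
fun minus_m2 where "M2 a b c d - M2 a' b' c' d' = M2 (a - a') (b - b') (c - c') (d - d')"
fun uminus_m2 where "- M2 a b c d = M2 (- a) (- b) (- c) (- d)"
fun times_m2 where "M2 a b c d * M2 a' b' c' d'
  = M2 (a * a' + b * c') (a * b' + b * d') (c * a' + d * c') (c * b' + d * d')"

instance
proof
  fix x y z :: m2
  show "x * y * z = x * (y * z)" "x + y + z = x + (y + z)" "x + y = y + x"
    "(x + y) * z = x * z + y * z" "x * (y + z) = x * y + x * z" "x - y = x + - y"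
    by (cases x; cases y; cases z; simp add: algebra_simps)+
  show "1 * x = x" "x * 1 = x" "0 + x = x" "- x + x = 0" by (cases x; simp add: zero_m2_def one_m2_def)+
  show "0 \<noteq> (1 :: m2)" by (simp add: zero_m2_def one_m2_def)
qed

end

definition sc2 :: "complex \<Rightarrow> m2" where
  "sc2 c = M2 c 0 0 c"

lemma sc2_simps: "sc2 a + sc2 b = sc2 (a + b)" "sc2 a - sc2 b = sc2 (a - b)" "sc2 a * sc2 b = sc2 (a * b)"
  "sc2 0 = 0" "sc2 1 = 1" "sc2 a = sc2 b \<longleftrightarrow> a = b" "sc2 a = 0 \<longleftrightarrow> a = 0"
  by (simp_all add: sc2_def zero_m2_def one_m2_def)

definition m2_alg :: "(complex, m2) module" where
  "m2_alg = \<lparr>carrier = UNIV, monoid.mult = (*), one = 1, zero = 0, add = (+),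
     smult = (\<lambda>c x. sc2 c * x)\<rparr>"

lemma m2_alg_simps [simp]:
  "carrier m2_alg = UNIV" "x \<otimes>\<^bsub>m2_alg\<^esub> y = x * y" "\<one>\<^bsub>m2_alg\<^esub> = 1"
  "\<zero>\<^bsub>m2_alg\<^esub> = 0" "x \<oplus>\<^bsub>m2_alg\<^esub> y = x + y" "c \<odot>\<^bsub>m2_alg\<^esub> x = sc2 c * x"
  by (simp_all add: m2_alg_def)

lemma sc2_central: "x * sc2 c = sc2 c * x"
  by (cases x) (simp add: sc2_def mult.commute)

interpretation m2: unital_algebra m2_alg
proof -
  have "abelian_group m2_alg"
  proof (rule abelian_groupI)
    show "\<exists>y\<in>carrier m2_alg. y \<oplus>\<^bsub>m2_alg\<^esub> x = \<zero>\<^bsub>m2_alg\<^esub>" for x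
      by (rule bexI[of _ "- x"]) simp_all
  qed (simp_all add: ac_simps)
  then have "ring m2_alg"
    by (intro ringI monoidI) (simp_all add: distrib_left distrib_right mult.assoc)
  then show "unital_algebra m2_alg"
  proof (intro unital_algebra.intro unital_algebra_axioms.intro)
    fix x y :: m2 and a b c
    show "x \<otimes>\<^bsub>m2_alg\<^esub> (c \<odot>\<^bsub>m2_alg\<^esub> y) = c \<odot>\<^bsub>m2_alg\<^esub> (x \<otimes>\<^bsub>m2_alg\<^esub> y)"
      by (cases x; cases y) (simp add: sc2_def algebra_simps)
    show "(a + b) \<odot>\<^bsub>m2_alg\<^esub> x = a \<odot>\<^bsub>m2_alg\<^esub> x \<oplus>\<^bsub>m2_alg\<^esub> b \<odot>\<^bsub>m2_alg\<^esub> x"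
      "(a * b) \<odot>\<^bsub>m2_alg\<^esub> x = a \<odot>\<^bsub>m2_alg\<^esub> (b \<odot>\<^bsub>m2_alg\<^esub> x)" "1 \<odot>\<^bsub>m2_alg\<^esub> x = x"
      by (cases x; simp add: sc2_def algebra_simps)+
  qed (simp_all add: distrib_left mult.assoc)
qed

abbreviation ev :: "('g \<Rightarrow> m2) \<Rightarrow> 'g free_alg \<Rightarrow> m2" where
  "ev \<equiv> eval_free m2_alg"

lemma ev_simps:
  "ev h (x + y) = ev h x + ev h y" "ev h (x * y) = ev h x * ev h y" "ev h 0 = 0" "ev h 1 = 1"
  "ev h (x - y) = ev h x - ev h y" "ev h (var g) = h g" "ev h (scalar c) = sc2 c"
  "ev h (x\<^sup>2) = ev h x * ev h x"
proof -
  have "\<ominus>\<^bsub>m2_alg\<^esub> x = - x" for x by (rule m2.minus_equality) simp_all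
  then show "ev h (x - y) = ev h x - ev h y" by (simp add: m2.eval_free_diff a_minus_def)
qed (simp_all add: m2.eval_free_add m2.eval_free_mult m2.eval_free_zero m2.eval_free_one
  m2.eval_free_var m2.eval_free_scalar power2_eq_square)

lemma ev_root_prod1:
  assumes "finite S" "i \<in> S" "ev h x = sc2 (c i)"
  shows "ev h (root_prod S c x) = 0"
  using assms by (simp add: root_prod_remove[OF assms(1,2)] ev_simps)

lemma ev_root_prod2:
  assumes "finite S" "i \<in> S" "j \<in> S" "i \<noteq> j" "(ev h x - sc2 (c i)) * (ev h x - sc2 (c j)) = 0"
  shows "ev h (root_prod S c x) = 0"
  using assms(5) by (simp add: root_prod_remove2[OF assms(1-4)] ev_simps mult.assoc[symmetric])

section \<open>The sets of spins and the numbers chi\<close>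

lemma spins2_one:
  assumes "n \<ge> 1"
  shows "spins2 n 1 = {n - 1, n + 1}"
proof (intro equalityI subsetI)
  fix x assume "x \<in> spins2 n 1"
  then obtain k :: nat where *: "int x = \<bar>int n - int 1\<bar> + 2 * int k" "x \<le> n + 1"
    by (auto simp: spins2_def)
  then have "k = 0 \<or> k = 1" using assms by linarith
  then show "x \<in> {n - 1, n + 1}" using * assms by auto
next
  fix x assume "x \<in> {n - 1, n + 1}"
  then consider "x = n - 1" | "x = n + 1" by auto
  then show "x \<in> spins2 n 1"
    using assms by cases (auto simp: spins2_def of_nat_diff intro: exI[of _ 0] exI[of _ 1])
qed

lemma spins2_commute: "spins2 a b = spins2 b a"
  by (simp add: spins2_def abs_minus_commute add.commute)

lemma spins2_two:
  assumes "n \<ge> 2"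
  shows "spins2 2 n = {n - 2, n, n + 2}"
proof (intro equalityI subsetI)
  fix x assume "x \<in> spins2 2 n"
  then obtain k :: nat where *: "int x = \<bar>int n - int 2\<bar> + 2 * int k" "x \<le> n + 2"
    unfolding spins2_commute[of 2] by (auto simp: spins2_def)
  then have "k = 0 \<or> k = 1 \<or> k = 2" using assms by linarith
  then show "x \<in> {n - 2, n, n + 2}" using * assms by auto
next
  fix x assume "x \<in> {n - 2, n, n + 2}"
  then consider "x = n - 2" | "x = n" | "x = n + 2" by auto
  then show "x \<in> spins2 2 n"
    unfolding spins2_commute[of 2]
    using assms by cases (auto simp: spins2_def of_nat_diff intro: exI[of _ 0] exI[of _ 1] exI[of _ 2])
qed

lemma spins2_zero: "spins2 0 n = {n}"
  by (auto simp: spins2_def)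

text \<open>Coupling the two spins 1/2 first gives 0 or 2 in doubled units; these contribute one and
  three elements to the last set.\<close>

lemma spins_sets:
  assumes "n \<ge> 2"
  shows "spins2 n 1 = {n - 1, n + 1}" "spins2 1 1 = {0, 2}" "spins3 n 1 1 = {n - 2, n, n + 2}"
    "chi_diffs q n 1 1 = {chi q (n - 2) - chi q (n - 1), chi q n - chi q (n - 1),
      chi q n - chi q (n + 1), chi q (n + 2) - chi q (n + 1)}"
    "chi_diffs q 1 1 n = {chi q n - chi q 0, chi q (n - 2) - chi q 2, chi q n - chi q 2, chi q (n + 2) - chi q 2}"
proof -
  have e: "n - 1 - 1 = n - 2" "n - 1 + 1 = n" "n + 1 - 1 = n" "n + 1 + 1 = n + 2" using assms by auto
  have l: "1 \<le> n" "1 \<le> n - 1" "1 \<le> n + 1" using assms by linarith+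
  show 1: "spins2 n 1 = {n - 1, n + 1}" "spins2 1 1 = {0, 2}"
    using spins2_one[OF l(1)] spins2_one[OF le_refl, unfolded one_add_one diff_self_eq_0] by -
  have 2: "spins2 (n - 1) 1 = {n - 2, n}" "spins2 (n + 1) 1 = {n, n + 2}"
    using spins2_one[OF l(2), unfolded e] spins2_one[OF l(3), unfolded e] by -
  show "spins3 n 1 1 = {n - 2, n, n + 2}"
    unfolding spins3_def 1 UN_insert 2 by blast
  have 3: "{f l | l. l \<in> {a, b}} = {f a, f b}" "{f l | l. l \<in> {a}} = {f a}"
    "{f l | l. l \<in> {a, b, c}} = {f a, f b, f c}" for f :: "nat \<Rightarrow> complex" and a b c
    by blast+
  show "chi_diffs q n 1 1 = {chi q (n - 2) - chi q (n - 1), chi q n - chi q (n - 1),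
      chi q n - chi q (n + 1), chi q (n + 2) - chi q (n + 1)}"
    unfolding chi_diffs_def 1 UN_insert 2 3 by blast
  show "chi_diffs q 1 1 n = {chi q n - chi q 0, chi q (n - 2) - chi q 2, chi q n - chi q 2, chi q (n + 2) - chi q 2}"
    unfolding chi_diffs_def 1 UN_insert spins2_zero spins2_two[OF assms] 3 by blast
qed

text \<open>Turns every value of \<open>chi\<close> near n into a Laurent polynomial in q and
  q^(n+1), the form in which all later identities are multiplied out.\<close>

lemma chi_shift:
  assumes "q \<noteq> 0" "n \<ge> 2"
  shows "chi q n = q ^ (n + 1) + 1 / q ^ (n + 1)"
    "chi q (n + 1) = q * q ^ (n + 1) + 1 / (q * q ^ (n + 1))"
    "chi q (n - 1) = q ^ (n + 1) / q + q / q ^ (n + 1)"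
    "chi q (n + 2) = q\<^sup>2 * q ^ (n + 1) + 1 / (q\<^sup>2 * q ^ (n + 1))"
    "chi q (n - 2) = q ^ (n + 1) / q\<^sup>2 + q\<^sup>2 / q ^ (n + 1)"
    "chi q 0 = q + 1 / q" "chi q 1 = q\<^sup>2 + 1 / q\<^sup>2" "chi q 2 = q ^ 3 + 1 / q ^ 3"
proof -
  \<comment> \<open>Writing n as k + 2 removes the truncated subtractions n - 1 and n - 2.\<close>
  obtain k where k: "n = k + 2" using assms(2) by (metis le_add_diff_inverse2)
  have p: "q ^ (n + 1) = q\<^sup>2 * q ^ (k + 1)" "q ^ (n - 1 + 1) = q * q ^ (k + 1)" "q ^ (n - 2 + 1) = q ^ (k + 1)"
    "q ^ (n + 1 + 1) = q ^ 3 * q ^ (k + 1)" "q ^ (n + 2 + 1) = q ^ 4 * q ^ (k + 1)"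
    unfolding k by (simp_all add: power_add power2_eq_square power3_eq_cube power4_eq_xxxx)
  have z: "q ^ (k + 1) \<noteq> 0" using assms(1) by simp
  show "chi q n = q ^ (n + 1) + 1 / q ^ (n + 1)"
    "chi q (n + 1) = q * q ^ (n + 1) + 1 / (q * q ^ (n + 1))"
    "chi q (n + 2) = q\<^sup>2 * q ^ (n + 1) + 1 / (q\<^sup>2 * q ^ (n + 1))"
    "chi q (n - 1) = q ^ (n + 1) / q + q / q ^ (n + 1)"
    "chi q (n - 2) = q ^ (n + 1) / q\<^sup>2 + q\<^sup>2 / q ^ (n + 1)"
    unfolding chi_def power_inverse[symmetric] inverse_eq_divide p power_one_over
    using z assms(1) by (simp_all add: power2_eq_square power3_eq_cube power4_eq_xxxx)
  show "chi q 0 = q + 1 / q" "chi q 1 = q\<^sup>2 + 1 / q\<^sup>2" "chi q 2 = q ^ 3 + 1 / q ^ 3"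
    by (simp_all add: chi_def inverse_eq_divide power_one_over numeral_2_eq_2 numeral_3_eq_3)
qed

section \<open>Consequences of q not being a root of unity\<close>

locale generic =
  fixes q :: complex
  assumes q0: "q \<noteq> 0" and q1: "\<And>k::nat. k > 0 \<Longrightarrow> q ^ k \<noteq> 1"
begin

lemma q_power_eq_iff: "q ^ a = q ^ b \<longleftrightarrow> a = b"
proof -
  have *: "a = b" if "q ^ a = q ^ b" "a \<le> b" for a b
  proof -
    have "q ^ a * q ^ (b - a) = q ^ b" using that(2) by (simp add: power_add[symmetric])
    also have "\<dots> = q ^ a * 1" using that(1) by simp
    finally have "q ^ (b - a) = 1" using q0 by (simp only: mult_cancel_left power_eq_0_iff) simp
    then have "\<not> b - a > 0" using q1 by blast
    then show "a = b" using that(2) by linarith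
  qed
  then show ?thesis using *[of a b] *[of b a] by (metis nat_le_linear)
qed

text \<open>Squaring would turn such an equality into one between distinct even powers of q.\<close>

lemma q_power_neg: "q ^ a \<noteq> - (q ^ b)" if "a \<noteq> b"
proof
  assume "q ^ a = - (q ^ b)"
  then have "q ^ (2 * a) = q ^ (2 * b)" by (metis power_even_eq power2_minus)
  then show False using that q_power_eq_iff by simp
qed

text \<open>With x and y the powers of q behind the two sides, equality becomes (x - y)(x y - 1) =
  0, and x y is a positive power of q. The separation of the eigenvalues of A, B and K rests on
  this.\<close>

lemma chi_eq_iff: "chi q a = chi q b \<longleftrightarrow> a = b"
proof
  assume "chi q a = chi q b"
  define x y where "x = q ^ (a + 1)" and "y = q ^ (b + 1)"
  have nz: "x \<noteq> 0" "y \<noteq> 0" using q0 by (auto simp: x_def y_def)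
  have "x + 1 / x = y + 1 / y"
    using \<open>chi q a = chi q b\<close> unfolding chi_def x_def y_def inverse_eq_divide power_one_over .
  then have "(x + 1 / x) * (x * y) = (y + 1 / y) * (x * y)" by simp
  then have "(x - y) * (x * y - 1) = 0" using nz by (simp add: algebra_simps)
  moreover have "x * y \<noteq> 1" using q1[of "a + 1 + (b + 1)"] by (simp only: x_def y_def power_add[symmetric]) simp
  ultimately have "x = y" by simp
  then show "a = b" using q_power_eq_iff[of "a + 1" "b + 1"] by (simp add: x_def y_def)
qed simp

lemma q_nonzero:
  "q\<^sup>2 \<noteq> 1" "q ^ 4 \<noteq> 1" "q - 1 / q \<noteq> 0" "q + 1 / q \<noteq> 0" "q\<^sup>2 - 1 / q\<^sup>2 \<noteq> 0" "q\<^sup>2 + 1 / q\<^sup>2 \<noteq> 0"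
proof -
  have *: "q\<^sup>2 \<noteq> 1" "q ^ 4 \<noteq> 1" "q ^ 8 \<noteq> 1" using q1[of 2] q1[of 4] q1[of 8] by auto
  then show "q\<^sup>2 \<noteq> 1" "q ^ 4 \<noteq> 1" by auto
  have **: "q\<^sup>2 \<noteq> -1" "q ^ 4 \<noteq> -1"
    using q_power_neg[of 2 0] q_power_neg[of 4 0] by auto
  have "(q - 1 / q) * q = q\<^sup>2 - 1" "(q + 1 / q) * q = q\<^sup>2 - (- 1)"
    "(q\<^sup>2 - 1 / q\<^sup>2) * q\<^sup>2 = q ^ 4 - 1" "(q\<^sup>2 + 1 / q\<^sup>2) * q\<^sup>2 = q ^ 4 - (- 1)"
    using q0 by (simp_all add: left_diff_distrib distrib_right power2_eq_square power4_eq_xxxx)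
  moreover have "q\<^sup>2 - 1 \<noteq> 0" "q ^ 4 - 1 \<noteq> 0" "q\<^sup>2 - (- 1) \<noteq> 0" "q ^ 4 - (- 1) \<noteq> 0"
    using * ** by (simp_all only: right_minus_eq not_False_eq_True)
  ultimately show "q - 1 / q \<noteq> 0" "q + 1 / q \<noteq> 0" "q\<^sup>2 - 1 / q\<^sup>2 \<noteq> 0" "q\<^sup>2 + 1 / q\<^sup>2 \<noteq> 0"
    by (metis mult_zero_left)+
qed

end

section \<open>Three representations of the quotient\<close>

text \<open>A checklist free of denominators for a candidate representation. Multiplying the
  defining relations by q^2 - p^2 = (q - p)(q + p) turns the factor 1 / (q + p) into q - p. The
  value of D' is a parameter pinned down by its own relation, so that it can be given explicitly for
  each representation.\<close>

lemma ev_AWbar_rels: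
  fixes h :: "aw_gen \<Rightarrow> m2" and q :: complex and n :: nat
  defines "p \<equiv> inverse q" and "x1 \<equiv> chi q n" and "x2 \<equiv> chi q 1"
  assumes n: "n \<ge> 2" and w: "q\<^sup>2 - p\<^sup>2 \<noteq> 0"
    and h: "h GK = sc2 k" "h G1 = sc2 x1" "h G2 = sc2 x2" "h G3 = sc2 x2"
    and AW: "sc2 (q\<^sup>2 - p\<^sup>2) * h GA + (sc2 q * h GB * h GD - sc2 p * h GD * h GB)
        = sc2 ((q - p) * (x1 * x2 + x2 * k))"
      "sc2 (q\<^sup>2 - p\<^sup>2) * h GB + (sc2 q * h GD * h GA - sc2 p * h GA * h GD)
        = sc2 ((q - p) * (x2 * x2 + x1 * k))"
      "sc2 (q\<^sup>2 - p\<^sup>2) * h GD + (sc2 q * h GA * h GB - sc2 p * h GB * h GA)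
        = sc2 ((q - p) * (x1 * x2 + x2 * k))"
      "sc2 (q\<^sup>2 - p\<^sup>2) * D' + (sc2 q * h GB * h GA - sc2 p * h GA * h GB)
        = sc2 ((q - p) * (x1 * x2 + x2 * k))"
    and quad: "\<And>x. x \<in> {h GA, h GD, D'} \<Longrightarrow> (x - sc2 (chi q (n - 1))) * (x - sc2 (chi q (n + 1))) = 0"
      "(h GB - sc2 (chi q 0)) * (h GB - sc2 (chi q 2)) = 0"
      "k \<in> {chi q (n - 2), chi q n, chi q (n + 2)}"
    and diffs: "\<And>x. ev h x \<in> {h GA, h GD, D'} \<Longrightarrow> ev h (root_prod (chi_diffs q n 1 1) id (var GK - x)) = 0"
      "ev h (root_prod (chi_diffs q 1 1 n) id (var GK - var GB)) = 0"
    and Om: "sc2 q * h GA * sc2 (x1 * x2 + x2 * k) + sc2 p * h GB * sc2 (x2 * x2 + x1 * k)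
        + sc2 q * h GD * sc2 (x1 * x2 + x2 * k) - sc2 (q\<^sup>2) * (h GA * h GA) - sc2 (p\<^sup>2) * (h GB * h GB)
        - sc2 (q\<^sup>2) * (h GD * h GD) - sc2 q * h GA * h GB * h GD
        = sc2 (x1\<^sup>2 + x2\<^sup>2 + x2\<^sup>2 + k\<^sup>2 + x1 * x2 * x2 * k - (q + p)\<^sup>2)"
    and r: "r \<in> AWbar_rels q n 1 1"
  shows "ev h r = 0"
proof -
  have wf: "q\<^sup>2 - p\<^sup>2 = (q - p) * (q + p)" by (simp add: power2_eq_square algebra_simps)
  with w have nz: "q - p \<noteq> 0" "q + p \<noteq> 0" by auto
  have v: "1 / (q\<^sup>2 - p\<^sup>2) * ((q - p) * c) = 1 / (q + p) * c" for c
    unfolding wf using nz by simp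
  have scaled: "X + sc2 (1 / (q\<^sup>2 - p\<^sup>2)) * Y = sc2 (1 / (q + p) * c)"
    if "sc2 (q\<^sup>2 - p\<^sup>2) * X + Y = sc2 ((q - p) * c)" for X Y c
  proof -
    have "sc2 (1 / (q\<^sup>2 - p\<^sup>2)) * (sc2 (q\<^sup>2 - p\<^sup>2) * X + Y) = sc2 (1 / (q + p) * c)"
      unfolding that sc2_simps(3) v ..
    moreover have "sc2 (1 / (q\<^sup>2 - p\<^sup>2)) * (sc2 (q\<^sup>2 - p\<^sup>2) * X) = X"
      using w by (simp only: mult.assoc[symmetric] sc2_simps) (simp add: sc2_simps)
    ultimately show ?thesis by (simp only: distrib_left)
  qed
  note AW' = AW[THEN scaled]
  have D': "ev h (AW_D' q) = D'"
    using AW'(4) unfolding AW_D'_def q_comm_def p_def[symmetric]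
    by (simp add: ev_simps h sc2_simps algebra_simps)
  note fin = finite.emptyI finite.insertI
  have diff: "n - 1 \<noteq> n + 1" "(0::nat) \<noteq> 2" by auto
  have A: "ev h (root_prod (spins2 n 1) (chi q) x) = 0" if "ev h x \<in> {h GA, h GD, D'}" for x
    unfolding spins_sets(1)[OF n]
    by (rule ev_root_prod2[of _ "n - 1" "n + 1"]) (use quad(1)[OF that] in auto)
  have B: "ev h (root_prod (spins2 1 1) (chi q) (var GB)) = 0"
    unfolding spins_sets(2)[OF n]
    by (rule ev_root_prod2[of _ 0 2]) (use quad(2) in \<open>auto simp: ev_simps\<close>)
  have K: "ev h (root_prod (spins3 n 1 1) (chi q) (var GK)) = 0"
    unfolding spins_sets(3)[OF n] using quad(3)
    by (elim insertE emptyE; intro ev_root_prod1[of _ "n - 2"] ev_root_prod1[of _ "n"] ev_root_prod1[of _ "n + 2"])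
       (auto simp: ev_simps h intro: ev_root_prod1[of _ "n - 2"] ev_root_prod1[of _ "n"] ev_root_prod1[of _ "n + 2"])
  have central: "h g * sc2 c = sc2 c * h g" for g c
    by (rule sc2_central)
  have AWr: "ev h r = 0" if "r \<in> AW_rels q"
    using that unfolding AW_rels_def Let_def q_comm_def p_def[symmetric]
    using AW'(1-3) by (auto simp: ev_simps h sc2_simps central)
  have Om': "ev h (AW_Omega q - (scalar (x1\<^sup>2 + x2\<^sup>2 + x2\<^sup>2) + var GK ^ 2 + scalar (x1 * x2 * x2) * var GK
                        - scalar ((q + inverse q)^2))) = 0"
    using Om unfolding AW_Omega_def Let_def p_def[symmetric]
    by (simp add: ev_simps h sc2_simps power2_eq_square)
  from r consider "r \<in> AW_rels q" | "r \<in> {var G1 - scalar x1, var G2 - scalar x2, var G3 - scalar x2}"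
    | "r = root_prod (spins2 n 1) (chi q) (var GA)" | "r = root_prod (spins2 1 1) (chi q) (var GB)"
    | "r = root_prod (spins3 n 1 1) (chi q) (var GK)"
    | "r = root_prod (spins2 n 1) (chi q) (var GD)" | "r = root_prod (spins2 n 1) (chi q) (AW_D' q)"
    | "r = root_prod (chi_diffs q n 1 1) id (var GK - var GA)"
    | "r = root_prod (chi_diffs q 1 1 n) id (var GK - var GB)"
    | "r = root_prod (chi_diffs q n 1 1) id (var GK - var GD)"
    | "r = root_prod (chi_diffs q n 1 1) id (var GK - AW_D' q)"
    | "r = AW_Omega q - (scalar (x1\<^sup>2 + x2\<^sup>2 + x2\<^sup>2) + var GK ^ 2 + scalar (x1 * x2 * x2) * var GK
                        - scalar ((q + inverse q)^2))"
    unfolding AWbar_rels_def Let_def x1_def x2_def by blast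
  then show ?thesis
    by cases (use AWr A B K Om' diffs D' in \<open>auto simp: ev_simps h sc2_simps\<close>)
qed

text \<open>Together with \<open>ring_distribs\<close> and \<open>mult_ac\<close> these rules
  normalise Laurent polynomials: the nested versions cancel an inverse pair that the ordering of
  factors has made adjacent inside a longer product.\<close>

lemma inverse_pair_simps:
  fixes a b z :: complex
  assumes "a * b = 1"
  shows "a * b = 1" "b * a = 1" "a * (b * z) = z" "b * (a * z) = z"
  using assms by (simp_all add: mult.assoc[symmetric] mult.commute)

text \<open>Here a is the common value of A and D, b that of B and k that of K in the upper
  one-dimensional representation. Exchanging x and y gives the lower one, so one computation serves
  both.\<close>

lemma scalar_identities:
  fixes q p x y :: complex
  assumes "q * p = 1" "x * y = 1"
  defines "a \<equiv> q * x + p * y" and "b \<equiv> q ^ 3 + p ^ 3" and "k \<equiv> q\<^sup>2 * x + p\<^sup>2 * y"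
    and "x1 \<equiv> x + y" and "x2 \<equiv> q\<^sup>2 + p\<^sup>2"
  shows "(q\<^sup>2 - p\<^sup>2) * a + (q * b * a - p * a * b) = (q - p) * (x1 * x2 + x2 * k)"
    "(q\<^sup>2 - p\<^sup>2) * b + (q * a * a - p * a * a) = (q - p) * (x2 * x2 + x1 * k)"
    "q * a * (x1 * x2 + x2 * k) + p * b * (x2 * x2 + x1 * k)
        + q * a * (x1 * x2 + x2 * k) - q\<^sup>2 * (a * a) - p\<^sup>2 * (b * b)
        - q\<^sup>2 * (a * a) - q * a * b * a
        = x1\<^sup>2 + x2\<^sup>2 + x2\<^sup>2 + k\<^sup>2 + x1 * x2 * x2 * k - (q + p)\<^sup>2"
  unfolding assms(3-7)
  by (simp_all add: ring_distribs power2_eq_square power3_eq_cube mult_ac inverse_pair_simps[OF assms(1)]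
      inverse_pair_simps[OF assms(2)])

locale spin_pair = generic +
  fixes n :: nat
  assumes n2: "n \<ge> 2"
begin

text \<open>With n the doubled spin, x is q^(2j+1), so that \<open>chi q n\<close> is x + y. Naming
  the inverses p and y keeps all formulas free of division.\<close>

definition p where "p = inverse q"
definition x where "x = q ^ (n + 1)"
definition y where "y = inverse x"

lemma pq: "q * p = 1" and xy: "x * y = 1"
proof -
  have "x \<noteq> 0" using q0 by (simp add: x_def)
  then show "q * p = 1" "x * y = 1" using q0 by (simp_all add: p_def y_def)
qed

lemma chi_xy:
  "chi q n = x + y" "chi q (n + 1) = q * x + p * y" "chi q (n - 1) = p * x + q * y"
  "chi q (n + 2) = q\<^sup>2 * x + p\<^sup>2 * y" "chi q (n - 2) = p\<^sup>2 * x + q\<^sup>2 * y"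
  "chi q 0 = q + p" "chi q 1 = q\<^sup>2 + p\<^sup>2" "chi q 2 = q ^ 3 + p ^ 3"
  unfolding chi_shift[OF q0 n2, folded x_def] p_def y_def
  by (simp_all add: divide_inverse power_inverse mult.commute)

lemma w_nonzero: "q\<^sup>2 - p\<^sup>2 \<noteq> 0" "q - p \<noteq> 0" "q + p \<noteq> 0" "q\<^sup>2 + p\<^sup>2 \<noteq> 0"
  using q_nonzero by (simp_all add: p_def inverse_eq_divide power_one_over)

text \<open>Total spin j + 1 forces the couplings: spin j + 1/2 in the first two factors and spin 1
  in the last two. The entries are the corresponding values of \<open>chi\<close>.\<close>

definition hi :: "aw_gen \<Rightarrow> m2" where
  "hi g = sc2 (case g of GA \<Rightarrow> q * x + p * y | GB \<Rightarrow> q ^ 3 + p ^ 3 | GD \<Rightarrow> q * x + p * y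
     | GK \<Rightarrow> q\<^sup>2 * x + p\<^sup>2 * y | G1 \<Rightarrow> x + y | G2 \<Rightarrow> q\<^sup>2 + p\<^sup>2 | G3 \<Rightarrow> q\<^sup>2 + p\<^sup>2)"

text \<open>Total spin j - 1 forces spin j - 1/2 in the first two factors and again spin 1 in the
  last two.\<close>

definition lo :: "aw_gen \<Rightarrow> m2" where
  "lo g = sc2 (case g of GA \<Rightarrow> p * x + q * y | GB \<Rightarrow> q ^ 3 + p ^ 3 | GD \<Rightarrow> p * x + q * y
     | GK \<Rightarrow> p\<^sup>2 * x + q\<^sup>2 * y | G1 \<Rightarrow> x + y | G2 \<Rightarrow> q\<^sup>2 + p\<^sup>2 | G3 \<Rightarrow> q\<^sup>2 + p\<^sup>2)"

definition h0 where "h0 = (q - p)\<^sup>2"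

text \<open>The matrices of A and B are read off from the action of \<open>C12\<close> and
  \<open>C23\<close> on the highest weight vectors \<open>w01\<close> and \<open>w10\<close>,
  columns being images; that of D is what the third defining relation makes of them. A is triangular
  with eigenvalues \<open>chi q (n + 1)\<close> and \<open>chi q (n - 1)\<close>, while B has the
  eigenvalues \<open>chi q 0\<close> and \<open>chi q 2\<close>.\<close>

definition mid :: "aw_gen \<Rightarrow> m2" where
  "mid g = (case g of
       GA \<Rightarrow> M2 (q * x + p * y) 0 (- h0 * x) (p * x + q * y)
     | GB \<Rightarrow> M2 (q + p + h0 * q) h0 h0 (q + p + h0 * p)
     | GD \<Rightarrow> M2 (x * (- (q ^ 3) + 3 * q - 2 * p + p ^ 3) + q * y) (- h0 * x) (h0 * (x * (1 + h0) - y))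
         (x * (q ^ 3 - 2 * q + 3 * p - p ^ 3) + p * y)
     | GK \<Rightarrow> sc2 (x + y) | G1 \<Rightarrow> sc2 (x + y) | G2 \<Rightarrow> sc2 (q\<^sup>2 + p\<^sup>2) | G3 \<Rightarrow> sc2 (q\<^sup>2 + p\<^sup>2))"

lemma hi_relations:
  assumes "r \<in> AWbar_rels q n 1 1"
  shows "ev hi r = 0"
proof (rule ev_AWbar_rels[OF n2 _ _ _ _ _ _ _ _ _ _ _ _ _ _ _ assms, folded p_def, unfolded chi_xy spins_sets[OF n2]])
  show "hi GK = sc2 (q\<^sup>2 * x + p\<^sup>2 * y)" by (simp add: hi_def)
  show "ev hi (root_prod {p\<^sup>2 * x + q\<^sup>2 * y - (p * x + q * y), x + y - (p * x + q * y), x + y - (q * x + p * y),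
      q\<^sup>2 * x + p\<^sup>2 * y - (q * x + p * y)} id (var GK - z)) = 0" if "ev hi z \<in> {hi GA, hi GD, hi GA}" for z
    by (rule ev_root_prod1[where i = "q\<^sup>2 * x + p\<^sup>2 * y - (q * x + p * y)"])
       (use that in \<open>auto simp: ev_simps hi_def sc2_simps\<close>)
  show "ev hi (root_prod {x + y - (q + p), p\<^sup>2 * x + q\<^sup>2 * y - (q ^ 3 + p ^ 3), x + y - (q ^ 3 + p ^ 3),
      q\<^sup>2 * x + p\<^sup>2 * y - (q ^ 3 + p ^ 3)} id (var GK - var GB)) = 0"
    by (rule ev_root_prod1[where i = "q\<^sup>2 * x + p\<^sup>2 * y - (q ^ 3 + p ^ 3)"])
       (auto simp: ev_simps hi_def sc2_simps)
qed (use scalar_identities[OF pq xy] w_nonzero in \<open>auto simp: hi_def sc2_simps ac_simps\<close>)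

lemma lo_relations:
  assumes "r \<in> AWbar_rels q n 1 1"
  shows "ev lo r = 0"
proof (rule ev_AWbar_rels[OF n2 _ _ _ _ _ _ _ _ _ _ _ _ _ _ _ assms, folded p_def, unfolded chi_xy spins_sets[OF n2]])
  show "lo GK = sc2 (p\<^sup>2 * x + q\<^sup>2 * y)" by (simp add: lo_def)
  show "ev lo (root_prod {p\<^sup>2 * x + q\<^sup>2 * y - (p * x + q * y), x + y - (p * x + q * y), x + y - (q * x + p * y),
      q\<^sup>2 * x + p\<^sup>2 * y - (q * x + p * y)} id (var GK - z)) = 0" if "ev lo z \<in> {lo GA, lo GD, lo GA}" for z
    by (rule ev_root_prod1[where i = "p\<^sup>2 * x + q\<^sup>2 * y - (p * x + q * y)"])
       (use that in \<open>auto simp: ev_simps lo_def sc2_simps\<close>)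
  show "ev lo (root_prod {x + y - (q + p), p\<^sup>2 * x + q\<^sup>2 * y - (q ^ 3 + p ^ 3), x + y - (q ^ 3 + p ^ 3),
      q\<^sup>2 * x + p\<^sup>2 * y - (q ^ 3 + p ^ 3)} id (var GK - var GB)) = 0"
    by (rule ev_root_prod1[where i = "p\<^sup>2 * x + q\<^sup>2 * y - (q ^ 3 + p ^ 3)"])
       (auto simp: ev_simps lo_def sc2_simps)
qed (use scalar_identities[OF pq, of y x] xy w_nonzero in \<open>auto simp: lo_def sc2_simps ac_simps\<close>)

lemma mid_relations:
  assumes "r \<in> AWbar_rels q n 1 1"
  shows "ev mid r = 0"
proof -
  \<comment> \<open>Computed from the relation defining D'; it comes out upper triangular while A is
    lower triangular.\<close>
  let ?D' = "M2 (p * x + q * y) (- h0 * y) 0 (q * x + p * y)"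
  note nf = mid_def sc2_def h0_def zero_m2_def ring_distribs power2_eq_square power3_eq_cube mult_ac
    inverse_pair_simps[OF pq] inverse_pair_simps[OF xy]
  have eig: "(z - sc2 (p * x + q * y)) * (z - sc2 (q * x + p * y)) = 0" if "z \<in> {mid GA, mid GD, ?D'}" for z
    using that by (elim insertE emptyE; simp add: nf)
  have ne0: "c - a \<noteq> c - b" if "a \<noteq> b" for a b c :: complex
    using that by simp
  show ?thesis
  proof (rule ev_AWbar_rels[OF n2 _ _ _ _ _ _ _ _ _ _ _ _ _ _ _ assms, folded p_def, unfolded chi_xy spins_sets[OF n2]])
    show "mid GK = sc2 (x + y)" by (simp add: mid_def)
    \<comment> \<open>On this block K is the scalar x + y, so K - z satisfies the reflected
      quadratic of z. Its roots are the two middle elements of the set of differences, and they must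
      be distinct to count as two factors of the product.\<close>
    have ne: "x + y - (p * x + q * y) \<noteq> x + y - (q * x + p * y)"
      by (rule ne0) (use chi_eq_iff[of "n - 1" "n + 1"] in \<open>simp add: chi_xy(2,3) del: One_nat_def add_Suc_right\<close>)
    show "ev mid (root_prod {p\<^sup>2 * x + q\<^sup>2 * y - (p * x + q * y), x + y - (p * x + q * y), x + y - (q * x + p * y),
        q\<^sup>2 * x + p\<^sup>2 * y - (q * x + p * y)} id (var GK - z)) = 0" if "ev mid z \<in> {mid GA, mid GD, ?D'}" for z
    proof (rule ev_root_prod2[OF _ _ _ ne])
      have mk: "mid GK = sc2 (x + y)" by (simp add: mid_def)
      have *: "sc2 (x + y) - w - sc2 (x + y - c) = - (w - sc2 c)" for w c
        by (cases w) (simp add: sc2_def)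
      show "(ev mid (var GK - z) - sc2 (id (x + y - (p * x + q * y)))) *
          (ev mid (var GK - z) - sc2 (id (x + y - (q * x + p * y)))) = 0"
        using eig[OF that] unfolding id_apply ev_simps mk * minus_mult_minus .
    qed auto
    have ne': "x + y - (q + p) \<noteq> x + y - (q ^ 3 + p ^ 3)"
      by (rule ne0) (use chi_eq_iff[of 0 2] in \<open>simp add: chi_xy(6,8)\<close>)
    show "ev mid (root_prod {x + y - (q + p), p\<^sup>2 * x + q\<^sup>2 * y - (q ^ 3 + p ^ 3), x + y - (q ^ 3 + p ^ 3),
        q\<^sup>2 * x + p\<^sup>2 * y - (q ^ 3 + p ^ 3)} id (var GK - var GB)) = 0"
      by (rule ev_root_prod2[OF _ _ _ ne']) (simp_all add: ev_simps nf)
  qed (use w_nonzero eig in \<open>(fact | simp add: nf | simp add: mid_def)+\<close>)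
qed

end

section \<open>The quotient modulo a central character of K\<close>

text \<open>A subalgebra by \<open>scalar_modD\<close>; it is everything precisely when the quotient
  by J is at most one-dimensional.\<close>

definition scalar_mod :: "'g free_alg set \<Rightarrow> 'g free_alg set" where
  "scalar_mod J = {p. \<exists>c. p - scalar c \<in> J}"

lemma scalar_modD:
  assumes J: "two_sided J"
  shows "scalar c \<in> scalar_mod J" "x \<in> J \<Longrightarrow> x \<in> scalar_mod J"
    "x \<in> scalar_mod J \<Longrightarrow> y \<in> scalar_mod J \<Longrightarrow> x + y \<in> scalar_mod J"
    "x \<in> scalar_mod J \<Longrightarrow> y \<in> scalar_mod J \<Longrightarrow> x - y \<in> scalar_mod J"
    "x \<in> scalar_mod J \<Longrightarrow> y \<in> scalar_mod J \<Longrightarrow> x * y \<in> scalar_mod J"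
proof -
  note J' = two_sidedD[OF J]
  show "scalar c \<in> scalar_mod J" using J' by (auto simp: scalar_mod_def intro: exI[of _ c])
  show "x \<in> scalar_mod J" if "x \<in> J" using that by (auto simp: scalar_mod_def scalar_simps intro: exI[of _ 0])
  assume "x \<in> scalar_mod J" "y \<in> scalar_mod J"
  then obtain c d where cd: "x - scalar c \<in> J" "y - scalar d \<in> J" by (auto simp: scalar_mod_def)
  have "x + y - scalar (c + d) = (x - scalar c) + (y - scalar d)" by (simp add: scalar_simps)
  then have "x + y - scalar (c + d) \<in> J" using J'(2)[OF cd] by (simp only:)
  then show "x + y \<in> scalar_mod J" unfolding scalar_mod_def by blast
  have "x - y - scalar (c - d) = (x - scalar c) - (y - scalar d)" by (simp add: scalar_diff)
  then have "x - y - scalar (c - d) \<in> J" using J'(6)[OF cd] by (simp only:)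
  then show "x - y \<in> scalar_mod J" unfolding scalar_mod_def by blast
  have "x * y - scalar (c * d) = (x - scalar c) * y + scalar c * (y - scalar d)"
    by (simp add: scalar_simps algebra_simps)
  then have "x * y - scalar (c * d) \<in> J"
    using J'(2)[OF J'(4)[OF cd(1), of y] J'(3)[OF cd(2), of "scalar c"]] by (simp only:)
  then show "x * y \<in> scalar_mod J" unfolding scalar_mod_def by blast
qed

text \<open>Write S = AB + BA and Z = ABA. The quadratic relation turns r itself, and its left
  multiple by A, into two relations that involve products of A and B only through S and Z; that the
  second one is symmetric in AB and BA is what the hypothesis \<open>id\<close> provides.
  Eliminating Z from this linear system leaves S with the coefficient in the hypothesis
  \<open>c\<close>.\<close>

lemma anticommutator_reduction:
  fixes A B :: "'g free_alg"
  assumes J: "two_sided J"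
    and a: "A * A - scalar t * A + scalar d \<in> J"
    and r: "A * A * B + B * A * A - scalar P * (A * B * A) + scalar w * B + scalar g * A + scalar k \<in> J"
    and id: "t * t - d - d + w = P * d" and c: "P * P * d - t * t * (P - 1) \<noteq> 0"
  shows "\<exists>c0 c1 c2. A * B + B * A - (scalar c0 + scalar c1 * A + scalar c2 * B) \<in> J"
proof -
  note J' = two_sidedD[OF J]
  note cen = scalar_central[of A] scalar_central[of B]
  have cen2: "A * (scalar c * z) = scalar c * (A * z)" "B * (scalar c * z) = scalar c * (B * z)" for c z
    by (simp_all only: mult.assoc[symmetric] cen)
  have comm: "scalar c * (scalar d * z) = scalar d * (scalar c * z)" for c d and z :: "'g free_alg"
    by (simp add: mult.assoc[symmetric] scalar_central[of "scalar c"])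
  have comm0: "scalar c * scalar d = scalar d * (scalar c :: 'g free_alg)" for c d
    by (rule scalar_central)
  note nf = distrib_left distrib_right left_diff_distrib right_diff_distrib mult.assoc cen cen2 comm comm0
    add_ac diff_conv_add_uminus
  let ?a = "A * A - scalar t * A + scalar d"
  let ?r = "A * A * B + B * A * A - scalar P * (A * B * A) + scalar w * B + scalar g * A + scalar k"
  let ?S = "A * B + B * A" and ?Z = "A * B * A"
  \<comment> \<open>This is r with A^2 replaced by tA - d on both sides of B.\<close>
  define X where "X = scalar t * ?S - scalar P * ?Z + scalar w * B - scalar d * B - scalar d * B + scalar g * A + scalar k"
  have "X = ?r - ?a * B - B * ?a" unfolding X_def by (simp add: algebra_simps cen cen2)
  then have X: "X \<in> J" using J'(6)[OF J'(6)[OF r J'(4)[OF a]] J'(3)[OF a]] by simp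
  \<comment> \<open>This is A r with every A^2 reduced; the coefficients of AB and BA still look
    different here.\<close>
  define Y where "Y = (scalar t * scalar t - scalar d - scalar d + scalar w) * (A * B)
      + scalar P * scalar d * (B * A) + scalar t * ?Z - scalar P * (scalar t * ?Z) - scalar t * scalar d * B
      + scalar g * scalar t * A + scalar k * A - scalar g * scalar d"
  have "Y = A * ?r - ?a * A * B - scalar t * ?a * B - A * B * ?a + scalar P * ?a * B * A - scalar g * ?a"
    unfolding Y_def by (simp add: algebra_simps cen cen2 comm comm0)
  also have "\<dots> \<in> J"
    by (intro J'(2,6) J'(3)[OF r] J'(4)[OF J'(4)[OF a]] J'(4)[OF J'(3)[OF a]] J'(3)[OF a]
        J'(4)[OF J'(4)[OF J'(3)[OF a]]])
  finally have Y: "Y \<in> J" .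
  have "scalar t * scalar t - scalar d - scalar d + scalar w = (scalar P * scalar d :: 'g free_alg)"
    using arg_cong[OF id, of "scalar :: _ \<Rightarrow> 'g free_alg"] by (simp only: scalar_simps scalar_diff)
  then have Y': "Y = scalar P * scalar d * ?S + scalar t * ?Z - scalar P * (scalar t * ?Z) - scalar t * scalar d * B
      + scalar g * scalar t * A + scalar k * A - scalar g * scalar d"
    unfolding Y_def by (simp add: algebra_simps)
  \<comment> \<open>The determinant of the system in S and Z. The next three numbers collect the
    remaining terms of P Y - t(P - 1) X.\<close>
  define e where "e = P * P * d - t * t * (P - 1)"
  define c0 c1 c2 where "c0 = P * g * d + t * (P - 1) * k" and "c1 = t * (P - 1) * g - P * (g * t + k)"
    and "c2 = P * t * d - t * (P - 1) * (d + d - w)"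
  have "scalar e * ?S - (scalar c0 + scalar c1 * A + scalar c2 * B)
      = scalar P * Y - (scalar t * scalar P - scalar t) * X"
    unfolding e_def c0_def c1_def c2_def X_def Y' scalar_simps(2-4) scalar_diff
    by (simp add: algebra_simps comm comm0)
  also have "\<dots> \<in> J" by (intro J'(6) J'(3) X Y)
  finally have E: "scalar e * ?S - (scalar c0 + scalar c1 * A + scalar c2 * B) \<in> J" .
  have "scalar e * (?S - (scalar (c0 / e) + scalar (c1 / e) * A + scalar (c2 / e) * B))
      = scalar e * ?S - (scalar (e * (c0 / e)) + scalar (e * (c1 / e)) * A + scalar (e * (c2 / e)) * B)"
    unfolding scalar_simps(4) by (simp add: algebra_simps)
  also have "\<dots> = scalar e * ?S - (scalar c0 + scalar c1 * A + scalar c2 * B)"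
    using c by (simp add: e_def)
  finally show ?thesis using two_sided_scalar_cancel[OF J, of e] E c unfolding e_def by metis
qed

context spin_pair
begin

abbreviation "R \<equiv> AWbar_rels q n 1 1"

lemma R_mem:
  "root_prod (spins2 n 1) (chi q) (var GA) \<in> R" "root_prod (spins2 1 1) (chi q) (var GB) \<in> R"
  "root_prod (spins3 n 1 1) (chi q) (var GK) \<in> R" "root_prod (spins2 n 1) (chi q) (var GD) \<in> R"
  "root_prod (chi_diffs q n 1 1) id (var GK - var GA) \<in> R"
  "root_prod (chi_diffs q n 1 1) id (var GK - var GD) \<in> R"
  "var G1 - scalar (x + y) \<in> R" "var G2 - scalar (q\<^sup>2 + p\<^sup>2) \<in> R" "var G3 - scalar (q\<^sup>2 + p\<^sup>2) \<in> R"
  "var GK * var g - var g * var GK \<in> R"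
  "var GB + scalar (1 / (q\<^sup>2 - p\<^sup>2)) * q_comm q (var GD) (var GA)
     - scalar (1 / (q + p)) * (var G2 * var G3 + var G1 * var GK) \<in> R"
  "var GD + scalar (1 / (q\<^sup>2 - p\<^sup>2)) * q_comm q (var GA) (var GB)
     - scalar (1 / (q + p)) * (var G1 * var G3 + var G2 * var GK) \<in> R"
  unfolding AWbar_rels_def AW_rels_def Let_def chi_xy p_def[symmetric] by blast+

text \<open>The difference of both sides factors as (q + 1)^2 (q - 1)(z - p^3 / z) with z = q^(m+1),
  and a zero of the last factor would give q^(2m+5) = 1. This is what keeps the differences tested
  in \<open>scalar_block\<close> outside \<open>chi_diffs\<close>.\<close>

lemma chi_sum_neq: "chi q (m + 3) + chi q (m + 2) \<noteq> chi q (m + 1) + chi q m"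
proof
  assume eq: "chi q (m + 3) + chi q (m + 2) = chi q (m + 1) + chi q m"
  define z where "z = q ^ (m + 1)"
  have nz: "z \<noteq> 0" using q0 by (simp add: z_def)
  then have z: "z * inverse z = 1" by simp
  have e': "q ^ (m + 3 + 1) = q ^ 3 * z" "q ^ (m + 2 + 1) = q\<^sup>2 * z" "q ^ (m + 1 + 1) = q * z"
    unfolding z_def by (simp_all add: power_add power2_eq_square power3_eq_cube power4_eq_xxxx mult_ac)
  have e: "chi q (m + 3) = q ^ 3 * z + p ^ 3 * inverse z" "chi q (m + 2) = q\<^sup>2 * z + p\<^sup>2 * inverse z"
    "chi q (m + 1) = q * z + p * inverse z" "chi q m = z + inverse z"
    unfolding chi_def p_def power_inverse e' inverse_mult_distrib z_def by (rule refl)+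
  have "(q + 1)\<^sup>2 * (q - 1) * (z - p ^ 3 * inverse z)
      = chi q (m + 3) + chi q (m + 2) - (chi q (m + 1) + chi q m)"
    unfolding e by (simp add: ring_distribs power2_eq_square power3_eq_cube mult_ac inverse_pair_simps[OF pq])
  also have "\<dots> = 0" unfolding eq by simp
  moreover have "(q + 1) * (q - 1) \<noteq> 0"
  proof -
    have "(q + 1) * (q - 1) = q\<^sup>2 - 1" by (simp add: power2_eq_square algebra_simps)
    moreover have "q\<^sup>2 - 1 \<noteq> 0" using q_nonzero(1) by simp
    ultimately show ?thesis by (simp only: not_False_eq_True)
  qed
  ultimately have "z - p ^ 3 * inverse z = 0" by auto
  then have eqz: "p ^ 3 * inverse z = z" by simp
  have "(q * p) ^ 3 * (z * inverse z) = q ^ 3 * (p ^ 3 * inverse z) * z"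
    by (simp only: power_mult_distrib mult_ac)
  then have "q ^ 3 * z * z = 1" unfolding eqz pq z by simp
  then have "q ^ (3 + (m + 1) + (m + 1)) = 1" unfolding z_def power_add .
  then show False using q1[of "3 + (m + 1) + (m + 1)"] by simp
qed

text \<open>Each of A and D has two candidate values. For \<open>chi q j\<close> the difference from
  k is not an admissible value of K - A or K - D, so both equal \<open>chi q i\<close>; B is then a
  scalar by the relation expressing it through D and A.\<close>

lemma scalar_block:
  assumes J: "two_sided J" "R \<subseteq> J" and k: "var GK - scalar k \<in> J"
    and ij: "{i, j} = {n - 1, n + 1}" and ex: "\<And>m. m \<in> chi_diffs q n 1 1 \<Longrightarrow> k - chi q j \<noteq> m"
  shows "r \<in> scalar_mod J"
proof -
  note R' = R_mem[THEN subsetD[OF J(2)]]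
  note M = scalar_modD[OF J(1)]
  have ne: "i \<noteq> j" using ij n2 by (auto simp: doubleton_eq_iff)
  have fin: "finite (chi_diffs q n 1 1)" by (simp only: spins_sets[OF n2]) simp
  have quad: "root_prod (spins2 n 1) (chi q) z = (z - scalar (chi q i)) * (z - scalar (chi q j))" for z :: "aw_gen free_alg"
  proof -
    have "spins2 n 1 = {i, j}" "{i, j} - {i, j} = {}" using spins_sets(1)[OF n2] ij by auto
    then show ?thesis using root_prod_remove2[of "spins2 n 1" i j "chi q" z] ne by simp
  qed
  have sub: "z \<in> scalar_mod J" if "z - scalar c \<in> J" for z c
    using that by (auto simp: scalar_mod_def)
  have A: "var GA \<in> scalar_mod J"
    by (rule sub, rule root_excluded[OF J(1) k _ fin R'(5) ex]) (use R'(1) quad in simp)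
  have D: "var GD \<in> scalar_mod J"
    by (rule sub, rule root_excluded[OF J(1) k _ fin R'(6) ex]) (use R'(4) quad in simp)
  note G = R'(7-9)[THEN sub] k[THEN sub]
  have B: "var GB \<in> scalar_mod J"
  proof -
    let ?X = "scalar (1 / (q\<^sup>2 - p\<^sup>2)) * q_comm q (var GD) (var GA)"
    let ?Y = "scalar (1 / (q + p)) * (var G2 * var G3 + var G1 * var GK)"
    have "(var GB + ?X - ?Y) - ?X + ?Y \<in> scalar_mod J"
      unfolding q_comm_def by (intro M(3,4,5) M(1) M(2)[OF R'(11)[unfolded q_comm_def]] A D G)
    then show ?thesis by simp
  qed
  have "var g \<in> scalar_mod J" for g
    using A B D G by (cases g) auto
  then show ?thesis
    by (induction r rule: var_induct) (use M scalar_simps(2) in \<open>metis+\<close>)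
qed

definition mid_span :: "aw_gen free_alg set \<Rightarrow> aw_gen free_alg set" where
  "mid_span J = {r. \<exists>a b c d. r - (scalar a + scalar b * var GA + scalar c * var GB + scalar d * (var GA * var GB)) \<in> J}"

text \<open>The span of 1, A, B, AB modulo J is stable under left multiplication by every generator.
  The difficulty is to express BA: eliminating D gives a relation of degree three, which
  \<open>anticommutator_reduction\<close> lowers to degree two.\<close>

lemma mid_block:
  assumes J: "two_sided J" "R \<subseteq> J" and k: "var GK - scalar (x + y) \<in> J"
  shows "r \<in> mid_span J"
proof -
  note R' = R_mem[THEN subsetD[OF J(2)]]
  note J' = two_sidedD[OF J(1)]
  define A B D where "A = var GA" and "B = var GB" and "D = var GD"
  \<comment> \<open>Sum and product of the two roots of A, then of the two roots of B. P is the
    common value of \<open>G2\<close> and \<open>G3\<close> and reappears as the coefficient of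
    ABA.\<close>
  define t d t' d' P where "t = (q + p) * (x + y)" and "d = x\<^sup>2 + y\<^sup>2 + q\<^sup>2 + p\<^sup>2"
    and "t' = q + p + q ^ 3 + p ^ 3" and "d' = (q + p) * (q ^ 3 + p ^ 3)" and "P = q\<^sup>2 + p\<^sup>2"
  let ?L = "mid_span J"
  have Ldef: "r \<in> ?L \<longleftrightarrow> (\<exists>a b c d. r - (scalar a + scalar b * A + scalar c * B + scalar d * (A * B)) \<in> J)" for r
    by (simp add: mid_span_def A_def B_def)
  have Ladd: "r + r' \<in> ?L" if rr: "r \<in> ?L" "r' \<in> ?L" for r r'
  proof -
    obtain a b c d a' b' c' d' where
      "r - (scalar a + scalar b * A + scalar c * B + scalar d * (A * B)) \<in> J"
      "r' - (scalar a' + scalar b' * A + scalar c' * B + scalar d' * (A * B)) \<in> J"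
      using rr unfolding Ldef by blast
    from J'(2)[OF this] have "r + r' - (scalar (a + a') + scalar (b + b') * A + scalar (c + c') * B + scalar (d + d') * (A * B)) \<in> J"
      unfolding scalar_simps(3) by (simp add: algebra_simps)
    then show ?thesis unfolding Ldef by blast
  qed
  have Lsc: "scalar e * r \<in> ?L" if rr: "r \<in> ?L" for e r
  proof -
    obtain a b c d where "r - (scalar a + scalar b * A + scalar c * B + scalar d * (A * B)) \<in> J"
      using rr unfolding Ldef by blast
    from J'(3)[OF this, of "scalar e"]
    have "scalar e * r - (scalar (e * a) + scalar (e * b) * A + scalar (e * c) * B + scalar (e * d) * (A * B)) \<in> J"
      unfolding scalar_simps(4) by (simp add: algebra_simps)
    then show ?thesis unfolding Ldef by blast
  qed
  have LJ: "r \<in> ?L" if "r \<in> J" for r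
    using that unfolding Ldef by (auto intro!: exI[of _ 0] simp: scalar_simps)
  have Lcong: "r \<in> ?L" if "r - r' \<in> J" "r' \<in> ?L" for r r'
    using Ladd[OF LJ[OF that(1)] that(2)] by simp
  have Lsc1: "scalar e \<in> ?L" for e
    unfolding Ldef by (rule exI[of _ e], rule exI[of _ 0], rule exI[of _ 0], rule exI[of _ 0]) (simp add: scalar_simps J'(1))
  have LA: "A \<in> ?L"
    unfolding Ldef by (rule exI[of _ 0], rule exI[of _ 1], rule exI[of _ 0], rule exI[of _ 0]) (simp add: scalar_simps J'(1))
  have LB: "B \<in> ?L"
    unfolding Ldef by (rule exI[of _ 0], rule exI[of _ 0], rule exI[of _ 1], rule exI[of _ 0]) (simp add: scalar_simps J'(1))
  have LAB: "A * B \<in> ?L"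
    unfolding Ldef by (rule exI[of _ 0], rule exI[of _ 0], rule exI[of _ 0], rule exI[of _ 1]) (simp add: scalar_simps J'(1))
  have Ldiff: "r - r' \<in> ?L" if "r \<in> ?L" "r' \<in> ?L" for r r'
  proof -
    have "scalar (- 1) = (- 1 :: aw_gen free_alg)" using scalar_diff[of 0 1] by (simp add: scalar_simps)
    then show ?thesis using Ladd[OF that(1) Lsc[OF that(2), of "- 1"]] by simp
  qed
  note cen = scalar_central[of A] scalar_central[of B]
  have cen2: "A * (scalar c * z) = scalar c * (A * z)" "B * (scalar c * z) = scalar c * (B * z)" for c z
    by (simp_all only: mult.assoc[symmetric] cen)
  have quad: "z * z - scalar (u + v) * z + scalar (u * v) = (z - scalar u) * (z - scalar v)" for z :: "aw_gen free_alg" and u v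
    by (simp add: scalar_simps left_diff_distrib right_diff_distrib distrib_right scalar_central[of z])
  have a: "A * A - scalar t * A + scalar d \<in> J"
  proof -
    have "root_prod (spins2 n 1) (chi q) A = (A - scalar (chi q (n - 1))) * (A - scalar (chi q (n + 1)))"
      unfolding spins_sets(1)[OF n2] using n2 by (subst root_prod_remove2[of _ "n - 1" "n + 1"]) auto
    then have "(A - scalar (p * x + q * y)) * (A - scalar (q * x + p * y)) \<in> J"
      using R'(1) unfolding A_def chi_xy by simp
    moreover have "p * x + q * y + (q * x + p * y) = t" unfolding t_def by (simp add: algebra_simps)
    moreover have "(p * x + q * y) * (q * x + p * y) = d" unfolding d_def
      by (simp add: ring_distribs power2_eq_square mult_ac inverse_pair_simps[OF pq] inverse_pair_simps[OF xy])
    ultimately show ?thesis using quad[of A "p * x + q * y" "q * x + p * y"] by simp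
  qed
  have b: "B * B - scalar t' * B + scalar d' \<in> J"
  proof -
    have "root_prod (spins2 1 1) (chi q) B = (B - scalar (chi q 0)) * (B - scalar (chi q 2))"
      unfolding spins_sets(2)[OF n2] by (subst root_prod_remove2[of _ 0 2]) auto
    then have "(B - scalar (q + p)) * (B - scalar (q ^ 3 + p ^ 3)) \<in> J"
      using R'(2) unfolding B_def chi_xy by simp
    then show ?thesis using quad[of B "q + p" "q ^ 3 + p ^ 3"] by (simp add: t'_def d'_def add.assoc)
  qed
  have r: "A * A * B + B * A * A - scalar P * (A * B * A) + scalar ((q\<^sup>2 - p\<^sup>2)\<^sup>2) * B
      + scalar ((q - p) * ((q - p) * (2 * (x + y) * P))) * A + scalar (- ((q\<^sup>2 - p\<^sup>2) * ((q - p) * (P * P + (x + y) * (x + y))))) \<in> J"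
    (is "?r \<in> J")
  proof -
    let ?w = "q\<^sup>2 - p\<^sup>2" and ?x1 = "x + y"
    have v: "1 / (q + p) = (q - p) / ?w"
    proof -
      have "?w = (q - p) * (q + p)" by (simp add: power2_eq_square algebra_simps)
      then show ?thesis using w_nonzero by simp
    qed
    have k2: "var G1 * var G3 + var G2 * var GK - scalar (2 * ?x1 * P) \<in> J"
      "var G2 * var G3 + var G1 * var GK - scalar (P * P + ?x1 * ?x1) \<in> J"
    proof -
      have prod: "z * z' - scalar (c * c') \<in> J" if "z - scalar c \<in> J" "z' - scalar c' \<in> J" for z z' c c'
        using J'(2)[OF J'(4)[OF that(1), of z'] J'(3)[OF that(2), of "scalar c"]]
        unfolding scalar_simps(4) by (simp add: algebra_simps)
      note G = R'(7-9)[folded P_def]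
      have e2: "2 * ?x1 * P = ?x1 * P + P * ?x1" by simp
      show "var G1 * var G3 + var G2 * var GK - scalar (2 * ?x1 * P) \<in> J"
        using J'(2)[OF prod[OF G(1,3)] prod[OF G(2) k]] unfolding e2 scalar_simps(3)[of "?x1 * P"]
        by (simp only: add_diff_add)
      show "var G2 * var G3 + var G1 * var GK - scalar (P * P + ?x1 * ?x1) \<in> J"
        using J'(2)[OF prod[OF G(2,3)] prod[OF G(1) k]] unfolding scalar_simps(3)[of "P * P"]
        by (simp only: add_diff_add)
    qed
    \<comment> \<open>An Askey-Wilson relation multiplied by q^2 - p^2, with its central right-hand
      side replaced by a number.\<close>
    have clear: "scalar ?w * X + (scalar q * (U * V) - scalar p * (V * U)) - scalar ((q - p) * c) \<in> J"
      if "X + scalar (1 / ?w) * q_comm q U V - scalar (1 / (q + p)) * Y \<in> J" "Y - scalar c \<in> J" for X U V Y c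
    proof -
      have "scalar ?w * (X + scalar (1 / ?w) * q_comm q U V - scalar (1 / (q + p)) * Y)
          + scalar (q - p) * (Y - scalar c) \<in> J"
        by (intro J'(2,3) that)
      also have "scalar ?w * (X + scalar (1 / ?w) * q_comm q U V - scalar (1 / (q + p)) * Y)
          = scalar ?w * X + scalar (?w * (1 / ?w)) * q_comm q U V - scalar (?w * (1 / (q + p))) * Y"
        unfolding scalar_simps(4) by (simp add: algebra_simps)
      also have "\<dots> = scalar ?w * X + q_comm q U V - scalar (q - p) * Y"
      proof -
        have "?w * (1 / ?w) = 1" "?w * (1 / (q + p)) = q - p" using w_nonzero(1) v by simp_all
        then show ?thesis by (simp only: scalar_simps(2) mult_1_left)
      qed
      finally have "scalar ?w * X + q_comm q U V - scalar (q - p) * Y + scalar (q - p) * (Y - scalar c) \<in> J" .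
      then show ?thesis
        unfolding q_comm_def p_def[symmetric] scalar_simps(4) by (simp add: algebra_simps)
    qed
    define X where "X = scalar ?w * B + (scalar q * (D * A) - scalar p * (A * D)) - scalar ((q - p) * (P * P + ?x1 * ?x1))"
    define Y where "Y = scalar ?w * D + (scalar q * (A * B) - scalar p * (B * A)) - scalar ((q - p) * (2 * ?x1 * P))"
    have XY: "X \<in> J" "Y \<in> J"
      using clear[OF R'(11) k2(2)] clear[OF R'(12) k2(1)] by (simp_all add: X_def Y_def A_def B_def D_def)
    have comm: "scalar c * (scalar d * z) = scalar d * (scalar c * z)" "scalar c * scalar d = scalar d * (scalar c :: aw_gen free_alg)"
      for c d and z :: "aw_gen free_alg"
      by (simp_all add: mult.assoc[symmetric] scalar_central[of "scalar c"])
    \<comment> \<open>X contains D as w(q DA - p AD) and Y contains it as wD, so this combination is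
      free of D.\<close>
    have "scalar ?w * X - scalar q * (Y * A) + scalar p * (A * Y) \<in> J"
      by (intro J'(2,6,3,4) XY)
    also have "scalar ?w * X - scalar q * (Y * A) + scalar p * (A * Y)
        = scalar (?w * ?w) * B - scalar (?w * ((q - p) * (P * P + ?x1 * ?x1)))
          + scalar (q * ((q - p) * (2 * ?x1 * P)) - p * ((q - p) * (2 * ?x1 * P))) * A
          - scalar (q * q + p * p) * (A * B * A) + scalar (q * p) * (B * A * A) + scalar (p * q) * (A * A * B)"
      unfolding X_def Y_def scalar_simps scalar_diff by (simp add: algebra_simps cen cen2 comm)
    also have "\<dots> = ?r"
    proof -
      have "p * q = 1" using pq by (simp add: mult.commute)
      moreover have "q * ((q - p) * (2 * ?x1 * P)) - p * ((q - p) * (2 * ?x1 * P)) = (q - p) * ((q - p) * (2 * ?x1 * P))"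
        by (simp add: left_diff_distrib)
      moreover have "scalar (- c) = - (scalar c :: aw_gen free_alg)" for c using scalar_diff[of 0 c] by (simp add: scalar_simps)
      ultimately show ?thesis unfolding P_def pq by (simp add: scalar_simps(2) power2_eq_square)
    qed
    finally show ?thesis .
  qed
  have "\<exists>c0 c1 c2. A * B + B * A - (scalar c0 + scalar c1 * A + scalar c2 * B) \<in> J"
  proof (rule anticommutator_reduction[OF J(1) a r])
    show "t * t - d - d + (q\<^sup>2 - p\<^sup>2)\<^sup>2 = P * d"
      unfolding t_def d_def P_def
      by (simp add: ring_distribs power2_eq_square mult_ac inverse_pair_simps[OF pq] inverse_pair_simps[OF xy])
    \<comment> \<open>The last bracket is the difference of \<open>chi q 3\<close> and
      \<open>chi q (2 * n + 1)\<close>, nonzero because n is not 1.\<close>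
    have "P * P * d - t * t * (P - 1) = (q - p)\<^sup>2 * (q ^ 4 + p ^ 4 - (x\<^sup>2 + y\<^sup>2))"
      unfolding t_def d_def P_def
      by (simp add: ring_distribs power2_eq_square power4_eq_xxxx mult_ac inverse_pair_simps[OF pq] inverse_pair_simps[OF xy])
    moreover have "chi q 3 = q ^ 4 + p ^ 4" "chi q (2 * n + 1) = x\<^sup>2 + y\<^sup>2"
    proof -
      have "q ^ (2 * n + 1 + 1) = x\<^sup>2"
        unfolding x_def power2_eq_square power_add[symmetric] by (simp add: mult_2)
      then show "chi q (2 * n + 1) = x\<^sup>2 + y\<^sup>2" unfolding chi_def power_inverse y_def by simp
    qed (simp add: chi_def p_def)
    moreover have "chi q 3 \<noteq> chi q (2 * n + 1)" unfolding chi_eq_iff using n2 by simp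
    ultimately show "P * P * d - t * t * (P - 1) \<noteq> 0" using w_nonzero(2) by simp
  qed
  then obtain c0 c1 c2 where S: "A * B + B * A - (scalar c0 + scalar c1 * A + scalar c2 * B) \<in> J" by blast
  have LAA: "A * A \<in> ?L"
    by (rule Lcong[of _ "scalar t * A - scalar d"]) (use a in \<open>simp_all add: Lsc Lsc1 LA Ldiff algebra_simps\<close>)
  have LBB: "B * B \<in> ?L"
    by (rule Lcong[of _ "scalar t' * B - scalar d'"]) (use b in \<open>simp_all add: Lsc Lsc1 LB Ldiff algebra_simps\<close>)
  have LBA: "B * A \<in> ?L"
    by (rule Lcong[of _ "scalar c0 + scalar c1 * A + scalar c2 * B - A * B"])
       (use S in \<open>simp_all add: Lsc Lsc1 LA LB LAB Ladd Ldiff algebra_simps\<close>)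
  have LAAB: "A * (A * B) \<in> ?L"
  proof (rule Lcong[of _ "scalar t * (A * B) - scalar d * B"])
    show "A * (A * B) - (scalar t * (A * B) - scalar d * B) \<in> J"
      using J'(4)[OF a, of B] by (simp add: algebra_simps)
  qed (intro Ldiff Lsc LAB LB)
  have LABB: "A * (B * B) \<in> ?L"
  proof (rule Lcong[of _ "scalar t' * (A * B) - scalar d' * A"])
    show "A * (B * B) - (scalar t' * (A * B) - scalar d' * A) \<in> J"
      using J'(3)[OF b, of A] by (simp add: algebra_simps cen cen2)
  qed (intro Ldiff Lsc LAB LA)
  \<comment> \<open>Multiplying the anticommutator formula by B on the right turns BAB into a
    combination of B, AB and B^2, minus A B^2.\<close>
  have LBAB: "B * (A * B) \<in> ?L"
  proof (rule Lcong[of _ "scalar c0 * B + scalar c1 * (A * B) + scalar c2 * (B * B) - A * (B * B)"])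
    show "B * (A * B) - (scalar c0 * B + scalar c1 * (A * B) + scalar c2 * (B * B) - A * (B * B)) \<in> J"
      using J'(4)[OF S, of B] by (simp add: algebra_simps)
  qed (intro Ladd Ldiff Lsc LAB LBB LABB LB)
  have left: "u * r \<in> ?L" if r: "r \<in> ?L" and u: "u \<in> {A, B}" for u r
  proof -
    obtain a b c d where r': "r - (scalar a + scalar b * A + scalar c * B + scalar d * (A * B)) \<in> J"
      using r unfolding Ldef by blast
    show ?thesis
    proof (rule Lcong[of _ "scalar a * u + scalar b * (u * A) + scalar c * (u * B) + scalar d * (u * (A * B))"])
      have "u * scalar c = scalar c * u" "u * (scalar c * z) = scalar c * (u * z)" for c z
        using u cen cen2 by auto
      then show "u * r - (scalar a * u + scalar b * (u * A) + scalar c * (u * B) + scalar d * (u * (A * B))) \<in> J"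
        using J'(3)[OF r', of u] by (simp add: algebra_simps)
    qed (use u in \<open>auto intro!: Ladd Lsc LA LB LAB LAA LBB LBA LAAB LBAB\<close>)
  qed
  have scl: "z * r \<in> ?L" if "z - scalar c \<in> J" "r \<in> ?L" for z c r
    by (rule Lcong[of _ "scalar c * r"]) (use J'(4)[OF that(1), of r] Lsc[OF that(2)] in \<open>simp_all add: algebra_simps\<close>)
  have D: "D * r \<in> ?L" if "r \<in> ?L" for r
  proof (rule Lcong)
    let ?Z = "scalar (1 / (q + p)) * (var G1 * (var G3 * r) + var G2 * (var GK * r))
      - scalar (1 / (q\<^sup>2 - p\<^sup>2)) * (scalar q * (A * (B * r)) - scalar (inverse q) * (B * (A * r)))"
    show "D * r - ?Z \<in> J"
      using J'(4)[OF R'(12), of r] by (simp add: algebra_simps q_comm_def A_def B_def D_def)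
    show "?Z \<in> ?L"
      by (intro Ladd Ldiff Lsc scl[OF R'(7)] scl[OF R'(8)] scl[OF R'(9)] scl[OF k] left that) simp_all
  qed
  have "var g * r \<in> ?L" if "r \<in> ?L" for g r
    using that left[OF that] D[OF that] scl[OF R'(7) that] scl[OF R'(8) that] scl[OF R'(9) that] scl[OF k that]
    by (cases g) (auto simp: A_def B_def D_def)
  then show ?thesis
    by (induction r rule: var_induct) (use Ladd Lsc Lsc1[of 1] in \<open>simp_all add: scalar_simps\<close>)
qed

end

section \<open>The quotient as a product of three blocks\<close>

lemma ev_rel_ideal:
  assumes "\<And>r. r \<in> R \<Longrightarrow> ev h r = 0" "r \<in> rel_ideal R"
  shows "ev h r = 0"
proof -
  have "cls R r = cls R 0" using assms(2) by (simp add: cls_eq_iff)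
  then have "extend_hom m2_alg h (cls R r) = extend_hom m2_alg h (cls R 0)" by simp
  then show ?thesis
    using m2.extend_hom_cls[of h R] assms(1) by (simp add: m2.eval_free_zero)
qed

lemma central_mod_mult:
  assumes J: "two_sided J" and "\<And>r. z * r - r * z \<in> J" "\<And>r. z' * r - r * z' \<in> J"
  shows "z * z' * r - r * (z * z') \<in> J"
proof -
  have "z * z' * r - r * (z * z') = z * (z' * r - r * z') + (z * r - r * z) * z'"
    by (simp add: algebra_simps)
  also have "\<dots> \<in> J" by (intro two_sidedD[OF J] assms)
  finally show ?thesis .
qed

text \<open>Left multiples stay inside because z can be moved past any factor modulo J.\<close>

lemma two_sided_annihilator:
  assumes J: "two_sided J" and z: "\<And>r. z * r - r * z \<in> J"
  shows "two_sided {r. z * r \<in> J}"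
  unfolding two_sided_def
proof (intro conjI ballI allI)
  fix r s assume r: "r \<in> {r. z * r \<in> J}"
  have "z * (s * r) = (z * s - s * z) * r + s * (z * r)" by (simp add: algebra_simps)
  also have "\<dots> \<in> J" by (rule two_sidedD(2)[OF J two_sidedD(4)[OF J z] two_sidedD(3)[OF J]]) (use r in simp)
  finally show "s * r \<in> {r. z * r \<in> J}" by simp
  show "r * s \<in> {r. z * r \<in> J}" using two_sidedD(4)[OF J, of "z * r" s] r by (simp add: mult.assoc)
next
  fix r s assume "r \<in> {r. z * r \<in> J}" "s \<in> {r. z * r \<in> J}"
  then show "r + s \<in> {r. z * r \<in> J}" using two_sidedD(2)[OF J] by (simp add: distrib_left)
qed (simp add: two_sidedD[OF J])

text \<open>Replace AB by (A - a)B, which like A - a has zero first row. The upper right entry then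
  determines the coefficient of B, and a two by two system with rows b - a, k and e, l remains for
  the coefficients of A and AB; the assumption \<open>D\<close> says that its determinant is
  nonzero.\<close>

lemma m2_basis:
  fixes a b e h u v :: complex
  defines "A \<equiv> M2 a 0 e b" and "B \<equiv> M2 u h h v"
  assumes h: "h \<noteq> 0" and D: "(b - a) * (e * u + (b - a) * h) - e * (e * h + (b - a) * v) \<noteq> 0"
  shows "\<exists>c0 c1 c2 c3. M = sc2 c0 + sc2 c1 * A + sc2 c2 * B + sc2 c3 * (A * B)"
    and "sc2 c0 + sc2 c1 * A + sc2 c2 * B + sc2 c3 * (A * B) = 0 \<Longrightarrow> c0 = 0 \<and> c1 = 0 \<and> c2 = 0 \<and> c3 = 0"
proof -
  define k l where "k = e * h + (b - a) * v" and "l = e * u + (b - a) * h"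
  define E where "E = (b - a) * l - e * k"
  have E: "E \<noteq> 0" using D by (simp add: E_def k_def l_def)
  show "\<exists>c0 c1 c2 c3. M = sc2 c0 + sc2 c1 * A + sc2 c2 * B + sc2 c3 * (A * B)"
  proof (cases M)
    case (M2 m1 m2 m3 m4)
    define c where "c = m2 / h"
    define s r where "s = m4 - c * v - (m1 - c * u)" and "r = m3 - c * h"
    \<comment> \<open>Cramer's rule for the remaining system.\<close>
    define c1 c3 where "c1 = (s * l - r * k) / E" and "c3 = ((b - a) * r - e * s) / E"
    have "c1 * (b - a) + c3 * k = ((s * l - r * k) * (b - a) + ((b - a) * r - e * s) * k) / E"
      by (simp add: c1_def c3_def add_divide_distrib)
    also have "\<dots> = s * E / E" by (rule arg_cong[of _ _ "\<lambda>z. z / E"]) (simp add: E_def algebra_simps)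
    finally have 1: "c1 * (b - a) + c3 * k = s" using E by simp
    have "c1 * e + c3 * l = ((s * l - r * k) * e + ((b - a) * r - e * s) * l) / E"
      by (simp add: c1_def c3_def add_divide_distrib)
    also have "\<dots> = r * E / E" by (rule arg_cong[of _ _ "\<lambda>z. z / E"]) (simp add: E_def algebra_simps)
    finally have 2: "c1 * e + c3 * l = r" using E by simp
    have 3: "m2 = c * h" using h by (simp add: c_def)
    have "M = sc2 (m1 - c * u - c1 * a) + sc2 c1 * A + sc2 (c - c3 * a) * B + sc2 c3 * (A * B)"
      unfolding M2 A_def B_def sc2_def using 1 2 3
      by (simp add: k_def l_def s_def r_def algebra_simps)
    then show ?thesis by blast
  qed
  assume 0: "sc2 c0 + sc2 c1 * A + sc2 c2 * B + sc2 c3 * (A * B) = 0"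
  then have eqs: "c0 + c1 * a + c2 * u + c3 * (a * u) = 0" "c2 * h + c3 * (a * h) = 0"
    "c1 * e + c2 * h + c3 * (e * u + b * h) = 0" "c0 + c1 * b + c2 * v + c3 * (e * h + b * v) = 0"
    by (simp_all add: A_def B_def sc2_def zero_m2_def)
  have "(c2 + c3 * a) * h = 0" using eqs(2) by (simp add: algebra_simps)
  then have c2: "c2 = - (c3 * a)" using h by (simp add: eq_neg_iff_add_eq_0)
  have 1: "c1 * (b - a) + c3 * k = 0" "c1 * e + c3 * l = 0"
  proof -
    have "c1 * (b - a) + c3 * k = (c0 + c1 * b + c2 * v + c3 * (e * h + b * v)) - (c0 + c1 * a + c2 * u + c3 * (a * u))"
      unfolding c2 k_def by (simp add: algebra_simps)
    then show "c1 * (b - a) + c3 * k = 0" unfolding eqs by simp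
    have "c1 * e + c3 * l = c1 * e + c2 * h + c3 * (e * u + b * h)"
      unfolding c2 l_def by (simp add: algebra_simps)
    then show "c1 * e + c3 * l = 0" unfolding eqs by simp
  qed
  have "c3 * E = (c1 * e + c3 * l) * (b - a) - (c1 * (b - a) + c3 * k) * e"
    by (simp add: E_def algebra_simps)
  then have c3: "c3 = 0" using 1 E by simp
  have "c1 * E = (c1 * (b - a) + c3 * k) * l - (c1 * e + c3 * l) * k"
    by (simp add: E_def algebra_simps)
  then have "c1 = 0" using 1 E by simp
  then show "c0 = 0 \<and> c1 = 0 \<and> c2 = 0 \<and> c3 = 0" using c2 c3 eqs(1) by simp
qed

text \<open>Three of the four comparisons reduce to distinct values of \<open>chi\<close>; the
  comparison with c - b is the one that calls for the inequality between sums from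
  \<open>chi_sum_neq\<close>.\<close>

lemma diff_notin:
  fixes a b c l u :: complex
  assumes "u \<noteq> l" "u \<noteq> c" "a \<noteq> b" "u + b \<noteq> c + a"
  shows "u - a \<notin> {l - a, c - a, c - b, u - b}"
  using assms by (auto simp: algebra_simps)

context spin_pair
begin

text \<open>The determinant in \<open>m2_basis\<close> equals h0^2 times the difference of
  \<open>chi q (2 * n + 1)\<close> and \<open>chi q 1\<close>. So the middle representation is
  irreducible and its image is the full matrix algebra.\<close>

lemma mid_basis:
  shows "\<exists>c0 c1 c2 c3. M = sc2 c0 + sc2 c1 * mid GA + sc2 c2 * mid GB + sc2 c3 * (mid GA * mid GB)"
    and "sc2 c0 + sc2 c1 * mid GA + sc2 c2 * mid GB + sc2 c3 * (mid GA * mid GB) = 0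
      \<Longrightarrow> c0 = 0 \<and> c1 = 0 \<and> c2 = 0 \<and> c3 = 0"
proof -
  let ?a = "q * x + p * y" and ?b = "p * x + q * y" and ?e = "- h0 * x"
  let ?u = "q + p + h0 * q" and ?v = "q + p + h0 * p"
  have "(?b - ?a) * (?e * ?u + (?b - ?a) * h0) - ?e * (?e * h0 + (?b - ?a) * ?v)
      = h0\<^sup>2 * (x\<^sup>2 + y\<^sup>2 - (q\<^sup>2 + p\<^sup>2))"
    unfolding h0_def
    by (simp add: ring_distribs power2_eq_square power3_eq_cube mult_ac inverse_pair_simps[OF pq] inverse_pair_simps[OF xy])
  moreover have "chi q (2 * n + 1) = x\<^sup>2 + y\<^sup>2"
  proof -
    have "q ^ (2 * n + 1 + 1) = x\<^sup>2"
      unfolding x_def power2_eq_square power_add[symmetric] by (simp add: mult_2)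
    then show "chi q (2 * n + 1) = x\<^sup>2 + y\<^sup>2" unfolding chi_def power_inverse y_def by simp
  qed
  moreover have "chi q (2 * n + 1) \<noteq> chi q 1" unfolding chi_eq_iff using n2 by simp
  moreover have "h0 \<noteq> 0" using w_nonzero by (simp add: h0_def)
  ultimately have D: "(?b - ?a) * (?e * ?u + (?b - ?a) * h0) - ?e * (?e * h0 + (?b - ?a) * ?v) \<noteq> 0"
    unfolding chi_xy by simp
  have m: "mid GA = M2 ?a 0 ?e ?b" "mid GB = M2 ?u h0 h0 ?v" by (simp_all add: mid_def)
  show "\<exists>c0 c1 c2 c3. M = sc2 c0 + sc2 c1 * mid GA + sc2 c2 * mid GB + sc2 c3 * (mid GA * mid GB)"
    "sc2 c0 + sc2 c1 * mid GA + sc2 c2 * mid GB + sc2 c3 * (mid GA * mid GB) = 0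
      \<Longrightarrow> c0 = 0 \<and> c1 = 0 \<and> c2 = 0 \<and> c3 = 0"
    unfolding m using m2_basis[OF \<open>h0 \<noteq> 0\<close> D] by blast+
qed

abbreviation (input) "kh \<equiv> q\<^sup>2 * x + p\<^sup>2 * y"
abbreviation (input) "km \<equiv> x + y"
abbreviation (input) "kl \<equiv> p\<^sup>2 * x + q\<^sup>2 * y"
abbreviation "Kf c \<equiv> var GK - scalar c"

lemma k_distinct: "kh \<noteq> km" "kh \<noteq> kl" "km \<noteq> kl"
  using chi_eq_iff[of "n + 2" n] chi_eq_iff[of "n + 2" "n - 2"] chi_eq_iff[of n "n - 2"] n2
  unfolding chi_xy by auto

lemma ev_ideal:
  assumes "r \<in> rel_ideal R"
  shows "ev hi r = 0" "ev mid r = 0" "ev lo r = 0"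
  using ev_rel_ideal[OF _ assms] hi_relations mid_relations lo_relations by auto

lemma K_central: "Kf c * r - r * Kf c \<in> rel_ideal R"
proof (rule central_mod[OF two_sided_rel_ideal])
  fix g
  have "Kf c * var g - var g * Kf c = var GK * var g - var g * var GK"
    by (simp add: algebra_simps scalar_central[of "var g"])
  then show "Kf c * var g - var g * Kf c \<in> rel_ideal R"
    using rel_ideal_superset[OF R_mem(10)] by simp
qed

lemma Kf_commute: "Kf a * Kf b = Kf b * Kf a"
proof -
  have "scalar a * scalar b = scalar b * (scalar a :: aw_gen free_alg)" by (rule scalar_central)
  then show ?thesis by (simp add: left_diff_distrib right_diff_distrib scalar_central[of "var GK"])
qed

lemma K_cubic:
  "Kf km * Kf kl * Kf kh \<in> rel_ideal R" "Kf kh * Kf kl * Kf km \<in> rel_ideal R"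
  "Kf kh * Kf km * Kf kl \<in> rel_ideal R"
proof -
  have "root_prod (spins3 n 1 1) (chi q) (var GK) = Kf (chi q (n - 2)) * (Kf (chi q n) * root_prod ({n - 2, n, n + 2} - {n - 2, n}) (chi q) (var GK))"
    unfolding spins_sets(3)[OF n2] using n2 by (intro root_prod_remove2) auto
  also have "{n - 2, n, n + 2} - {n - 2, n} = {n + 2}" using n2 by auto
  also have "root_prod {n + 2} (chi q) (var GK) = Kf (chi q (n + 2))"
    using root_prod_insert[of "{}" "n + 2" "chi q" "var GK"] by simp
  finally have 1: "Kf kl * (Kf km * Kf kh) \<in> rel_ideal R"
    using rel_ideal_superset[OF R_mem(3)] unfolding chi_xy by simp
  have lc: "Kf a * (Kf b * z) = Kf b * (Kf a * z)" for a b z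
    by (simp only: mult.assoc[symmetric] Kf_commute[of a b])
  have "Kf km * Kf kl * Kf kh = Kf kl * (Kf km * Kf kh)"
    by (simp only: mult.assoc lc[of km kl])
  moreover have "Kf kh * Kf km * Kf kl = Kf kl * (Kf km * Kf kh)"
    unfolding Kf_commute[of kh km] by (simp only: mult.assoc Kf_commute[of kh kl] lc[of km kl])
  moreover have "Kf kh * Kf kl * Kf km = Kf kl * (Kf km * Kf kh)"
    by (simp only: mult.assoc lc[of kh kl] Kf_commute[of kh km])
  ultimately show "Kf km * Kf kl * Kf kh \<in> rel_ideal R" "Kf kh * Kf kl * Kf km \<in> rel_ideal R"
    "Kf kh * Kf km * Kf kl \<in> rel_ideal R" using 1 by simp_all
qed

text \<open>The ideal quotient of \<open>rel_ideal R\<close> by the central element (K - a)(K - b).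
  Working modulo it amounts to projecting with the central idempotent of the third root of
  K.\<close>

definition block :: "complex \<Rightarrow> complex \<Rightarrow> aw_gen free_alg set" where
  "block a b = {r. Kf a * Kf b * r \<in> rel_ideal R}"

lemma block: "two_sided (block a b)" "R \<subseteq> block a b"
  unfolding block_def
  by (rule two_sided_annihilator[OF two_sided_rel_ideal], rule central_mod_mult[OF two_sided_rel_ideal],
      (rule K_central)+)
     (auto intro: rel_ideal_closed(3) rel_ideal_superset)

text \<open>Differences such as (K - a) - (K - b) are nonzero scalars, so two products sharing a
  factor leave that factor times r in the ideal; doing this twice leaves r itself.\<close>

lemma block_combine:
  assumes "r \<in> block a b" "r \<in> block a c" "r \<in> block b c" "a \<noteq> b" "b \<noteq> c" "a \<noteq> c"
  shows "r \<in> rel_ideal R"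
proof -
  note I = two_sidedD[OF two_sided_rel_ideal[of R]]
  have step: "Kf d * r \<in> rel_ideal R" if "Kf d * Kf e * r \<in> rel_ideal R" "Kf d * Kf f * r \<in> rel_ideal R" "e \<noteq> f" for d e f
  proof -
    have "scalar (f - e) * (Kf d * r) = Kf d * Kf e * r - Kf d * Kf f * r"
      by (simp add: scalar_diff left_diff_distrib right_diff_distrib scalar_central[of "Kf d"]
          scalar_central[of "var GK"] mult.assoc[symmetric] scalar_central[of "scalar d"])
    then have "scalar (f - e) * (Kf d * r) \<in> rel_ideal R" using I(6)[OF that(1,2)] by simp
    then show ?thesis using two_sided_scalar_cancel[OF two_sided_rel_ideal, of "f - e"] that(3) by simp
  qed
  have a: "Kf a * r \<in> rel_ideal R" using step[of a b c] assms by (simp add: block_def)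
  have b: "Kf b * r \<in> rel_ideal R" using step[of b a c] assms Kf_commute[of a b] by (simp add: block_def)
  have "scalar (b - a) * r = Kf a * r - Kf b * r" by (simp add: scalar_diff algebra_simps)
  then have "scalar (b - a) * r \<in> rel_ideal R" using I(6)[OF a b] by simp
  then show ?thesis using two_sided_scalar_cancel[OF two_sided_rel_ideal, of "b - a"] assms(4) by simp
qed

lemma ev_K: "ev hi (Kf c) = sc2 (kh - c)" "ev mid (Kf c) = sc2 (km - c)" "ev lo (Kf c) = sc2 (kl - c)"
  by (simp_all add: ev_simps hi_def mid_def lo_def sc2_simps)

lemma sc2_mult_eq_0: "sc2 c * z = 0 \<Longrightarrow> c \<noteq> 0 \<Longrightarrow> z = 0"
  by (cases z) (simp add: sc2_def zero_m2_def)

text \<open>In each representation K is a scalar different from the two roots in question, so the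
  prefactor defining the block becomes invertible there.\<close>

lemma ev_block:
  "r \<in> block km kl \<Longrightarrow> ev hi r = 0" "r \<in> block kh kl \<Longrightarrow> ev mid r = 0" "r \<in> block kh km \<Longrightarrow> ev lo r = 0"
proof -
  have *: "ev h r = 0" if "ev h (Kf a * Kf b * r) = 0"
    "ev h (Kf a) = sc2 (k - a)" "ev h (Kf b) = sc2 (k - b)" "k \<noteq> a" "k \<noteq> b" for h a b k
  proof (rule sc2_mult_eq_0)
    show "sc2 ((k - a) * (k - b)) * ev h r = 0"
      using that(1) by (simp only: ev_simps(2) that(2,3) sc2_simps)
  qed (use that in simp)
  note ne = k_distinct k_distinct[symmetric]
  show "ev hi r = 0" if "r \<in> block km kl"
    by (rule *[OF ev_ideal(1) ev_K(1) ev_K(1) ne(1,2)]) (use that in \<open>simp only: block_def mem_Collect_eq\<close>)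
  show "ev mid r = 0" if "r \<in> block kh kl"
    by (rule *[OF ev_ideal(2) ev_K(2) ev_K(2) ne(4,3)]) (use that in \<open>simp only: block_def mem_Collect_eq\<close>)
  show "ev lo r = 0" if "r \<in> block kh km"
    by (rule *[OF ev_ideal(3) ev_K(3) ev_K(3) ne(5,6)]) (use that in \<open>simp only: block_def mem_Collect_eq\<close>)
qed

text \<open>In each block r has a normal form, a scalar or a combination of 1, A, B, AB, whose
  coefficients are seen by the matching representation. If all of them vanish, r lies in all three
  ideals, and \<open>block_combine\<close> applies.\<close>

theorem ev_kernel:
  assumes "ev hi r = 0" "ev mid r = 0" "ev lo r = 0"
  shows "r \<in> rel_ideal R"
proof -
  have sub: "Kf c \<in> block a b \<longleftrightarrow> Kf a * Kf b * Kf c \<in> rel_ideal R" for a b c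
    by (simp add: block_def)
  have ne: "chi q i \<noteq> chi q j" if "i \<noteq> j" for i j using that chi_eq_iff by simp
  have idx: "n + 2 \<noteq> n - 2" "n + 2 \<noteq> n" "n - 1 \<noteq> n + 1" "n - 2 \<noteq> n" using n2 by auto
  have "r \<in> scalar_mod (block km kl)"
  proof (rule scalar_block[OF block, where k = "chi q (n + 2)" and i = "n + 1" and j = "n - 1"])
    show "Kf (chi q (n + 2)) \<in> block km kl" unfolding chi_xy sub by (rule K_cubic)
    show "chi q (n + 2) - chi q (n - 1) \<noteq> m" if m: "m \<in> chi_diffs q n 1 1" for m
    proof -
      \<comment> \<open>The instance m = n - 1 of \<open>chi_sum_neq\<close> rules out the value
        \<open>chi q (n - 1)\<close> of A and D when K is \<open>chi q (n + 2)\<close>.\<close>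
      have "n - 1 + 3 = n + 2" "n - 1 + 2 = n + 1" "n - 1 + 1 = n" using n2 by auto
      then have "chi q (n + 2) + chi q (n + 1) \<noteq> chi q n + chi q (n - 1)" using chi_sum_neq[of "n - 1"] by metis
      from diff_notin[OF ne[OF idx(1)] ne[OF idx(2)] ne[OF idx(3)] this] show ?thesis
        using m unfolding spins_sets[OF n2] by metis
    qed
  qed auto
  then obtain c where c: "r - scalar c \<in> block km kl" by (auto simp: scalar_mod_def)
  have "c = 0" using ev_block(1)[OF c] assms(1) by (simp add: ev_simps sc2_simps)
  then have h: "r \<in> block km kl" using c by (simp add: scalar_simps)
  have "r \<in> scalar_mod (block kh km)"
  proof (rule scalar_block[OF block, where k = "chi q (n - 2)" and i = "n - 1" and j = "n + 1"])
    show "Kf (chi q (n - 2)) \<in> block kh km" unfolding chi_xy sub by (rule K_cubic)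
    show "chi q (n - 2) - chi q (n + 1) \<noteq> m" if m: "m \<in> chi_diffs q n 1 1" for m
    proof -
      \<comment> \<open>Here m = n - 2, ruling out \<open>chi q (n + 1)\<close> when K is
        \<open>chi q (n - 2)\<close>.\<close>
      have "n - 2 + 3 = n + 1" "n - 2 + 2 = n" "n - 2 + 1 = n - 1" using n2 by auto
      then have "chi q (n - 2) + chi q (n - 1) \<noteq> chi q n + chi q (n + 1)"
        using chi_sum_neq[of "n - 2"] by (metis add.commute)
      from diff_notin[OF ne[OF idx(1)[symmetric]] ne[OF idx(4)] ne[OF idx(3)[symmetric]] this] show ?thesis
        using m unfolding spins_sets[OF n2] by blast
    qed
  qed auto
  then obtain c where c: "r - scalar c \<in> block kh km" by (auto simp: scalar_mod_def)
  have "c = 0" using ev_block(3)[OF c] assms(3) by (simp add: ev_simps sc2_simps)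
  then have l: "r \<in> block kh km" using c by (simp add: scalar_simps)
  have "r \<in> mid_span (block kh kl)"
    by (rule mid_block[OF block]) (unfold sub, rule K_cubic)
  then obtain a b c d where m: "r - (scalar a + scalar b * var GA + scalar c * var GB + scalar d * (var GA * var GB)) \<in> block kh kl"
    by (auto simp: mid_span_def)
  have "sc2 a + sc2 b * mid GA + sc2 c * mid GB + sc2 d * (mid GA * mid GB) = 0"
    using ev_block(2)[OF m] unfolding ev_simps(1,2,5,6,7) assms(2)
    by (simp only: diff_0 neg_equal_0_iff_equal)
  from mid_basis(2)[OF this] have m: "r \<in> block kh kl" using m by (simp add: scalar_simps)
  show ?thesis
    by (rule block_combine[of _ kh km kl]) (use h l m k_distinct in auto)
qed

text \<open>Lagrange interpolation in K: each quadratic factor isolates one block, and a preimage z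
  of M is inserted in the middle one.\<close>

theorem ev_surj: "\<exists>r. ev hi r = sc2 a \<and> ev mid r = M \<and> ev lo r = sc2 b"
proof -
  obtain c0 c1 c2 c3 where M: "M = sc2 c0 + sc2 c1 * mid GA + sc2 c2 * mid GB + sc2 c3 * (mid GA * mid GB)"
    using mid_basis(1) by blast
  have nz: "(kh - km) * (kh - kl) \<noteq> 0" "(km - kh) * (km - kl) \<noteq> 0" "(kl - kh) * (kl - km) \<noteq> 0"
    using k_distinct by auto
  have "ev mid (scalar c0 + scalar c1 * var GA + scalar c2 * var GB + scalar c3 * (var GA * var GB)) = M"
    unfolding M by (simp add: ev_simps)
  then obtain z where z: "ev mid z = M" by blast
  let ?r = "scalar (a / ((kh - km) * (kh - kl))) * (Kf km * Kf kl)
    + scalar (1 / ((km - kh) * (km - kl))) * (Kf kh * Kf kl) * z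
    + scalar (b / ((kl - kh) * (kl - km))) * (Kf kh * Kf km)"
  have c: "a / ((kh - km) * (kh - kl)) * ((kh - km) * (kh - kl)) = a"
    "1 / ((km - kh) * (km - kl)) * ((km - kh) * (km - kl)) = 1"
    "b / ((kl - kh) * (kl - km)) * ((kl - kh) * (kl - km)) = b"
    using nz by simp_all
  have "ev hi ?r = sc2 a" "ev mid ?r = M" "ev lo ?r = sc2 b"
    unfolding ev_simps(1,2,7) ev_K z sc2_simps c by (simp_all add: sc2_simps)
  then show ?thesis by blast
qed

end

section \<open>Homomorphisms of presented algebras\<close>

lemma eval_free_hom_image:
  assumes A: "unital_algebra A" and B: "unital_algebra B" and f: "f \<in> alg_hom A B"
    and h: "\<And>g. h g \<in> carrier A"
  shows "f (eval_free A h r) = eval_free B (\<lambda>g. f (h g)) r"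
proof -
  interpret A: unital_algebra A by (rule A)
  interpret B: unital_algebra B by (rule B)
  note fD = alg_homD[OF f]
  have h': "f (h g) \<in> carrier B" for g using fD(1) h by blast
  note a = A.eval_free_closed[of h, OF h] and b = B.eval_free_closed[of "\<lambda>g. f (h g)", OF h']
  show ?thesis
  proof (induction r rule: var_induct)
    case (add x y)
    then show ?case by (simp add: A.eval_free_add[OF h] B.eval_free_add[OF h'] fD(3) a)
  next
    case (smult c x)
    then show ?case by (simp add: A.eval_free_smult[OF h] B.eval_free_smult[OF h'] fD(5) a)
  next
    case one
    then show ?case by (simp add: A.eval_free_one[OF h] B.eval_free_one[OF h'] fD(4))
  next
    case (var g x)
    then show ?case
      by (simp add: A.eval_free_mult[OF h] B.eval_free_mult[OF h'] A.eval_free_var[OF h] B.eval_free_var[OF h'] fD(2) a h)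
  qed
qed

text \<open>Makes \<open>hom_presented\<close> possible: every homomorphism out of a presented
  algebra is evaluation at the images of the generators.\<close>

lemma eval_free_presented: "eval_free (presented R) (generator R) r = cls R r"
proof -
  have "cls R (eval_free free_algebra var r) = eval_free (presented R) (generator R) r"
    by (rule eval_free_hom_image[OF unital_algebra_free unital_algebra_presented cls_hom]) simp
  moreover have "eval_free free_algebra var r = r"
  proof (induction r rule: var_induct)
    case (smult c x)
    then show ?case using free.eval_free_smult[of var c x] by (simp add: free_algebra_simps)
  next
    case one
    then show ?case using free.eval_free_one[of var] by simp
  qed (simp_all add: free.eval_free_add free.eval_free_mult free.eval_free_var)
  ultimately show ?thesis by simp
qed

lemma generator_closed: "generator R g \<in> carrier (presented R)"
  by (simp add: presented_simps)

lemma hom_presented: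
  assumes "unital_algebra B" "f \<in> alg_hom (presented R) B"
  shows "f (cls R r) = eval_free B (\<lambda>g. f (generator R g)) r"
  using eval_free_hom_image[OF unital_algebra_presented assms, of "generator R" r]
  by (simp add: eval_free_presented generator_closed)

lemma alg_hom_comp: "f \<in> alg_hom A B \<Longrightarrow> f' \<in> alg_hom B C \<Longrightarrow> (\<lambda>x. f' (f x)) \<in> alg_hom A C"
  unfolding alg_hom_def
  by (auto intro!: ring_hom_memI simp: ring_hom_mult ring_hom_add ring_hom_one ring_hom_closed)

lemma alg_hom_zero:
  assumes "unital_algebra A" "unital_algebra B" "f \<in> alg_hom A B"
  shows "f \<zero>\<^bsub>A\<^esub> = \<zero>\<^bsub>B\<^esub>"
proof -
  interpret A: unital_algebra A by fact
  interpret B: unital_algebra B by fact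
  show ?thesis using alg_homD(5)[OF assms(3), of "\<zero>\<^bsub>A\<^esub>" 0] A.smult_zero_right alg_homD(1)[OF assms(3)]
    by (simp add: B.smult_zero_left)
qed

context unital_algebra
begin

text \<open>Bundles the two hypotheses behind every use of \<open>extend_hom\<close>, so that
  families of generators can be transported along homomorphisms and combined in tensor
  products.\<close>

definition satisfies :: "('g \<Rightarrow> 'a) \<Rightarrow> 'g free_alg set \<Rightarrow> bool" where
  "satisfies h R \<longleftrightarrow> (\<forall>g. h g \<in> carrier B) \<and> (\<forall>r\<in>R. eval_free B h r = \<zero>)"

lemma satisfiesD:
  assumes "satisfies h R"
  shows "h g \<in> carrier B" "r \<in> R \<Longrightarrow> eval_free B h r = \<zero>"
    "extend_hom B h (cls R p) = eval_free B h p" "extend_hom B h \<in> alg_hom (presented R) B"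
    "extend_hom B h (generator R g) = h g"
proof -
  have *: "h g \<in> carrier B" "r \<in> R \<Longrightarrow> eval_free B h r = \<zero>" for g r
    using assms by (auto simp: satisfies_def)
  then show "h g \<in> carrier B" "r \<in> R \<Longrightarrow> eval_free B h r = \<zero>" by auto
  show "extend_hom B h (cls R p) = eval_free B h p" "extend_hom B h \<in> alg_hom (presented R) B"
    "extend_hom B h (generator R g) = h g"
    using extend_hom_cls[OF *] extend_hom_hom[OF *] extend_hom_generator[OF *] by auto
qed

lemma satisfies_hom:
  assumes f: "f \<in> alg_hom (presented R) B"
  shows "satisfies (\<lambda>g. f (generator R g)) R"
  unfolding satisfies_def
proof (intro conjI allI ballI)
  show "f (generator R g) \<in> carrier B" for g
    by (rule alg_homD(1)[OF f generator_closed])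
  fix r assume "r \<in> R"
  then have "cls R r = cls R 0" unfolding cls_eq_iff by (simp add: rel_ideal_superset)
  have "eval_free B (\<lambda>g. f (generator R g)) r = f (cls R r)"
    by (rule hom_presented[OF unital_algebra_axioms f, symmetric])
  also have "\<dots> = f \<zero>\<^bsub>presented R\<^esub>"
    unfolding \<open>cls R r = cls R 0\<close> presented_simps(3) ..
  also have "\<dots> = \<zero>"
    by (rule alg_hom_zero[OF unital_algebra_presented unital_algebra_axioms f])
  finally show "eval_free B (\<lambda>g. f (generator R g)) r = \<zero>" .
qed

lemma satisfies_image:
  assumes "unital_algebra A" "unital_algebra.satisfies A h R" "f \<in> alg_hom A B"
  shows "satisfies (\<lambda>g. f (h g)) R"
proof -
  interpret A: unital_algebra A by fact
  note h = A.satisfiesD[OF assms(2)]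
  show ?thesis unfolding satisfies_def
  proof (intro conjI allI ballI)
    show "f (h g) \<in> carrier B" for g by (rule alg_homD(1)[OF assms(3) h(1)])
    fix r assume r: "r \<in> R"
    have "eval_free B (\<lambda>g. f (h g)) r = f (eval_free A h r)"
      by (rule eval_free_hom_image[OF assms(1) unital_algebra_axioms assms(3) h(1), symmetric])
    then show "eval_free B (\<lambda>g. f (h g)) r = \<zero>"
      by (simp only: h(2)[OF r] alg_hom_zero[OF assms(1) unital_algebra_axioms assms(3)])
  qed
qed

definition commuting :: "('g \<Rightarrow> 'a) \<Rightarrow> ('h \<Rightarrow> 'a) \<Rightarrow> bool" where
  "commuting h h' \<longleftrightarrow> (\<forall>g g'. h g \<otimes> h' g' = h' g' \<otimes> h g)"

text \<open>The universal property of the tensor product. Each embedded relation sees only one of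
  the two families, and the mixed relations are \<open>commuting\<close>.\<close>

lemma satisfies_tensor:
  assumes h: "satisfies h R" and h': "satisfies h' S" and c: "commuting h h'"
  shows "satisfies (case_sum h h') (tensor_rels R S)"
proof -
  note hD = satisfiesD[OF h] and hD' = satisfiesD[OF h']
  have cl: "case_sum h h' z \<in> carrier B" for z using hD(1) hD'(1) by (cases z) auto
  have hom: "eval_free B (case_sum h h') \<in> alg_hom free_algebra B" by (rule eval_free_hom[OF cl])
  have "eval_free B (case_sum h h') (eval_free free_algebra (\<lambda>g. var (Inl g)) r) = eval_free B h r" for r
    using eval_free_hom_image[OF unital_algebra_free unital_algebra_axioms hom, of "\<lambda>g. var (Inl g)" r]
    by (simp add: eval_free_var[OF cl])
  moreover have "eval_free B (case_sum h h') (eval_free free_algebra (\<lambda>g. var (Inr g)) r) = eval_free B h' r" for r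
    using eval_free_hom_image[OF unital_algebra_free unital_algebra_axioms hom, of "\<lambda>g. var (Inr g)" r]
    by (simp add: eval_free_var[OF cl])
  moreover have "eval_free B (case_sum h h') (var (Inl g) * var (Inr g') - var (Inr g') * var (Inl g)) = \<zero>" for g g'
    using c hD(1) hD'(1)
    by (simp add: eval_free_diff[OF cl] eval_free_mult[OF cl] eval_free_var[OF cl] commuting_def a_minus_def r_neg)
  ultimately show ?thesis
    using hD(2) hD'(2) cl unfolding satisfies_def tensor_rels_def by auto
qed

lemma commute_eval:
  assumes m: "m \<in> carrier B" and h: "\<And>g. h g \<in> carrier B" and c: "\<And>g. m \<otimes> h g = h g \<otimes> m"
  shows "m \<otimes> eval_free B h r = eval_free B h r \<otimes> m"
proof (induction r rule: var_induct)
  case (add x y)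
  then show ?case by (simp add: eval_free_add[OF h] eval_free_closed[OF h] l_distr r_distr m)
next
  case (smult c x)
  then show ?case by (simp add: eval_free_smult[OF h] eval_free_closed[OF h] smult_mult_left smult_mult_right m)
next
  case one
  then show ?case by (simp add: eval_free_one[OF h] m)
next
  case (var g x)
  note cl = eval_free_closed[of h x, OF h]
  have "m \<otimes> (h g \<otimes> eval_free B h x) = (m \<otimes> h g) \<otimes> eval_free B h x" using m h cl by (simp add: m_assoc)
  also have "\<dots> = h g \<otimes> (m \<otimes> eval_free B h x)" using m h cl c by (simp add: m_assoc)
  also have "\<dots> = (h g \<otimes> eval_free B h x) \<otimes> m" using m h cl var by (simp add: m_assoc)
  finally show ?case by (simp add: eval_free_mult[OF h] eval_free_var[OF h])
qed

end

lemma tensor_incl: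
  shows "unital_algebra.satisfies (presented (tensor_rels R S)) (\<lambda>g. generator (tensor_rels R S) (Inl g)) R" (is ?a)
    and "unital_algebra.satisfies (presented (tensor_rels R S)) (\<lambda>g. generator (tensor_rels R S) (Inr g)) S" (is ?b)
    and "unital_algebra.commuting (presented (tensor_rels R S))
      (\<lambda>g. generator (tensor_rels R S) (Inl g)) (\<lambda>g. generator (tensor_rels R S) (Inr g))" (is ?c)
proof -
  let ?T = "tensor_rels R S"
  interpret B: unital_algebra "presented ?T" by (rule unital_algebra_presented)
  have e: "eval_free (presented ?T) (\<lambda>g. generator ?T (i g)) r = cls ?T (eval_free free_algebra (\<lambda>g. var (i g)) r)"
    for i :: "'c \<Rightarrow> 'a + 'b" and r
    using eval_free_hom_image[OF unital_algebra_free unital_algebra_presented cls_hom, of "\<lambda>g. var (i g)" ?T r] by simp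
  have z: "cls ?T r = \<zero>\<^bsub>presented ?T\<^esub>" if "r \<in> ?T" for r
    using that by (simp add: presented_simps cls_eq_iff rel_ideal_superset)
  show ?a ?b
    unfolding B.satisfies_def by (auto simp: generator_closed e intro!: z) (auto simp: tensor_rels_def)
  have "var (Inl g) * var (Inr g') - var (Inr g') * var (Inl g) \<in> rel_ideal ?T" for g g'
    by (rule rel_ideal_superset) (auto simp: tensor_rels_def)
  then show ?c unfolding B.commuting_def by (simp add: presented_simps cls_eq_iff)
qed

text \<open>The embeddings of the two tensor factors as homomorphisms in their own right, so that
  \<open>pure_tensor\<close> becomes a product and calculations proceed by composing
  homomorphisms.\<close>

definition incl1 where
  "incl1 R S = extend_hom (presented (tensor_rels R S)) (\<lambda>g. generator (tensor_rels R S) (Inl g))"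
definition incl2 where
  "incl2 R S = extend_hom (presented (tensor_rels R S)) (\<lambda>g. generator (tensor_rels R S) (Inr g))"

lemma incl:
  "incl1 R S \<in> alg_hom (presented R) (presented (tensor_rels R S))"
  "incl2 R S \<in> alg_hom (presented S) (presented (tensor_rels R S))"
  "incl1 R S (generator R g) = generator (tensor_rels R S) (Inl g)"
  "incl2 R S (generator S g') = generator (tensor_rels R S) (Inr g')"
  "pure_tensor R S X Y = incl1 R S X \<otimes>\<^bsub>presented (tensor_rels R S)\<^esub> incl2 R S Y"
proof -
  interpret B: unital_algebra "presented (tensor_rels R S)" by (rule unital_algebra_presented)
  note D = B.satisfiesD[OF tensor_incl(1)] B.satisfiesD[OF tensor_incl(2)]
  show "incl1 R S \<in> alg_hom (presented R) (presented (tensor_rels R S))"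
    "incl2 R S \<in> alg_hom (presented S) (presented (tensor_rels R S))"
    "incl1 R S (generator R g) = generator (tensor_rels R S) (Inl g)"
    "incl2 R S (generator S g') = generator (tensor_rels R S) (Inr g')"
    unfolding incl1_def incl2_def by (rule D)+
  show "pure_tensor R S X Y = incl1 R S X \<otimes>\<^bsub>presented (tensor_rels R S)\<^esub> incl2 R S Y"
    by (simp add: pure_tensor_def incl1_def incl2_def Let_def)
qed

lemma pure_tensor_one:
  assumes "X \<in> carrier (presented R)"
  shows "pure_tensor R S X \<one>\<^bsub>presented S\<^esub> = incl1 R S X"
proof -
  interpret B: unital_algebra "presented (tensor_rels R S)" by (rule unital_algebra_presented)
  show ?thesis by (simp add: incl(5) alg_homD(1)[OF incl(1) assms] alg_homD(4)[OF incl(2)])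
qed

lemma one_pure_tensor:
  assumes "Y \<in> carrier (presented S)"
  shows "pure_tensor R S \<one>\<^bsub>presented R\<^esub> Y = incl2 R S Y"
proof -
  interpret B: unital_algebra "presented (tensor_rels R S)" by (rule unital_algebra_presented)
  show ?thesis by (simp add: incl(5) alg_homD(1)[OF incl(2) assms] alg_homD(4)[OF incl(1)])
qed

section \<open>Algebras with a quantum sl2 triple\<close>

context unital_algebra
begin

lemma minus_smult: "x \<in> carrier B \<Longrightarrow> \<ominus> x = (- 1) \<odot> x"
  using smult_add_left[of x "- 1" 1] smult_closed[of x] by (intro minus_equality) (simp_all add: smult_one smult_zero_left)

lemma minus_zero_iff: "x \<in> carrier B \<Longrightarrow> y \<in> carrier B \<Longrightarrow> x \<ominus> y = \<zero> \<longleftrightarrow> x = y"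
  by (metis a_minus_def add.inv_closed add.inv_inv minus_equality r_neg)

definition qc :: "complex \<Rightarrow> complex" where "qc q = 1 / (q - inverse q)"

text \<open>The relations of the quantum algebra oriented as rewrite rules that move F to the left
  and q^H to the right, with the difference of squares written as a sum with the scalar
  \<open>- qc q\<close>.\<close>

definition triple :: "complex \<Rightarrow> (uq_gen \<Rightarrow> 'a) \<Rightarrow> bool" where
  "triple q h \<longleftrightarrow> (\<forall>g. h g \<in> carrier B)
     \<and> h UQ \<otimes> h UQi = \<one> \<and> h UQi \<otimes> h UQ = \<one>
     \<and> h UQ \<otimes> h UE = q \<odot> (h UE \<otimes> h UQ)
     \<and> h UQ \<otimes> h UF = inverse q \<odot> (h UF \<otimes> h UQ)
     \<and> h UE \<otimes> h UF = h UF \<otimes> h UE \<oplus> qc q \<odot> (h UQ \<otimes> h UQ)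
         \<oplus> (- qc q) \<odot> (h UQi \<otimes> h UQi)"

lemma satisfies_Uq: "satisfies h (Uq_rels q) \<longleftrightarrow> triple q h"
proof (cases "\<forall>g. h g \<in> carrier B")
  case True
  then have h: "h g \<in> carrier B" for g by simp
  let ?c = "qc q"
  have cl: "h g \<otimes> h g' \<in> carrier B" "c \<odot> (h g \<otimes> h g') \<in> carrier B" for g g' c
    using h smult_closed by auto
  note ev = eval_free_diff[OF h] eval_free_mult[OF h] eval_free_var[OF h] eval_free_one[OF h]
    eval_free_smult[OF h] eval_free_scalar[OF h]
  have pw: "(var g)\<^sup>2 = var g * (var g :: uq_gen free_alg)" for g by (simp add: power2_eq_square)
  have "satisfies h (Uq_rels q) \<longleftrightarrow>
     h UQ \<otimes> h UQi = \<one> \<and> h UQi \<otimes> h UQ = \<one>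
     \<and> h UQ \<otimes> h UE = q \<odot> (h UE \<otimes> h UQ)
     \<and> h UQ \<otimes> h UF = inverse q \<odot> (h UF \<otimes> h UQ)
     \<and> (h UE \<otimes> h UF \<ominus> h UF \<otimes> h UE) = ?c \<odot> (h UQ \<otimes> h UQ \<ominus> h UQi \<otimes> h UQi)"
    unfolding satisfies_def Uq_rels_def using h cl
    by (simp add: ev pw minus_zero_iff smult_closed mult.assoc smult_mult_left qc_def[symmetric])
  moreover have "(h UE \<otimes> h UF \<ominus> h UF \<otimes> h UE) = ?c \<odot> (h UQ \<otimes> h UQ \<ominus> h UQi \<otimes> h UQi)
      \<longleftrightarrow> h UE \<otimes> h UF = h UF \<otimes> h UE \<oplus> ?c \<odot> (h UQ \<otimes> h UQ)
         \<oplus> (- qc q) \<odot> (h UQi \<otimes> h UQi)" (is "?l \<longleftrightarrow> ?r")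
  proof -
    have e: "?c \<odot> (h UQ \<otimes> h UQ \<ominus> h UQi \<otimes> h UQi)
        = ?c \<odot> (h UQ \<otimes> h UQ) \<oplus> (- qc q) \<odot> (h UQi \<otimes> h UQi)"
      using cl by (simp add: a_minus_def minus_smult smult_add_right smult_assoc[symmetric])
    have "x \<ominus> y = z \<longleftrightarrow> x = y \<oplus> z" if "x \<in> carrier B" "y \<in> carrier B" "z \<in> carrier B" for x y z
      using that by (metis a_comm add.inv_solve_right a_minus_def)
    then show ?thesis unfolding e using cl by (simp add: a_assoc)
  qed
  ultimately show ?thesis using True by (simp add: triple_def)
qed (auto simp: satisfies_def triple_def)

text \<open>The rules for the inverse of q^H come from conjugating those for q^H.\<close>

lemma triple_rules:
  assumes "triple q h" "q \<noteq> 0"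
  shows "h g \<in> carrier B"
    "h UQ \<otimes> h UQi = \<one>" "h UQi \<otimes> h UQ = \<one>"
    "h UQ \<otimes> h UE = q \<odot> (h UE \<otimes> h UQ)" "h UQ \<otimes> h UF = inverse q \<odot> (h UF \<otimes> h UQ)"
    "h UQi \<otimes> h UE = inverse q \<odot> (h UE \<otimes> h UQi)" "h UQi \<otimes> h UF = q \<odot> (h UF \<otimes> h UQi)"
    "h UE \<otimes> h UF = h UF \<otimes> h UE \<oplus> qc q \<odot> (h UQ \<otimes> h UQ)
         \<oplus> (- qc q) \<odot> (h UQi \<otimes> h UQi)"
proof -
  have h: "h g \<in> carrier B" for g using assms by (simp add: triple_def)
  show 1: "h UQ \<otimes> h UQi = \<one>" "h UQi \<otimes> h UQ = \<one>"
    "h UQ \<otimes> h UE = q \<odot> (h UE \<otimes> h UQ)" "h UQ \<otimes> h UF = inverse q \<odot> (h UF \<otimes> h UQ)"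
    "h UE \<otimes> h UF = h UF \<otimes> h UE \<oplus> qc q \<odot> (h UQ \<otimes> h UQ)
         \<oplus> (- qc q) \<odot> (h UQi \<otimes> h UQi)"
    using assms by (simp_all add: triple_def)
  show "h g \<in> carrier B" by (rule h)
  have *: "h UQi \<otimes> x = inverse c \<odot> (x \<otimes> h UQi)" if x: "x \<in> carrier B" and e: "h UQ \<otimes> x = c \<odot> (x \<otimes> h UQ)" "c \<noteq> 0" for x c
  proof -
    have "inverse c \<odot> (x \<otimes> h UQi) = inverse c \<odot> ((h UQi \<otimes> h UQ) \<otimes> (x \<otimes> h UQi))"
      using x h 1 by simp
    also have "(h UQi \<otimes> h UQ) \<otimes> (x \<otimes> h UQi) = h UQi \<otimes> ((h UQ \<otimes> x) \<otimes> h UQi)"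
      using x h by (simp add: m_assoc)
    also have "\<dots> = c \<odot> (h UQi \<otimes> (x \<otimes> (h UQ \<otimes> h UQi)))"
      unfolding e using x h by (simp add: m_assoc smult_mult_left smult_mult_right)
    also have "inverse c \<odot> \<dots> = h UQi \<otimes> x"
      using x h 1 e(2) by (simp add: smult_assoc[symmetric] smult_one)
    finally show ?thesis ..
  qed
  show "h UQi \<otimes> h UE = inverse q \<odot> (h UE \<otimes> h UQi)" using *[OF h 1(3)] assms(2) by simp
  show "h UQi \<otimes> h UF = q \<odot> (h UF \<otimes> h UQi)" using *[OF h 1(4)] assms(2) by simp
qed

definition delta :: "(uq_gen \<Rightarrow> 'a) \<Rightarrow> (uq_gen \<Rightarrow> 'a) \<Rightarrow> uq_gen \<Rightarrow> 'a" where
  "delta h h' g = (case g of UE \<Rightarrow> h UE \<otimes> h' UQi \<oplus> h UQ \<otimes> h' UE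
     | UF \<Rightarrow> h UF \<otimes> h' UQi \<oplus> h UQ \<otimes> h' UF
     | UQ \<Rightarrow> h UQ \<otimes> h' UQ | UQi \<Rightarrow> h UQi \<otimes> h' UQi)"

lemma smult_simps:
  "x \<in> carrier B \<Longrightarrow> c \<odot> x \<in> carrier B"
  "x \<in> carrier B \<Longrightarrow> c \<odot> (d \<odot> x) = (c * d) \<odot> x"
  "x \<in> carrier B \<Longrightarrow> y \<in> carrier B \<Longrightarrow> c \<odot> (x \<oplus> y) = c \<odot> x \<oplus> c \<odot> y"
  "x \<in> carrier B \<Longrightarrow> y \<in> carrier B \<Longrightarrow> (c \<odot> x) \<otimes> y = c \<odot> (x \<otimes> y)"
  "x \<in> carrier B \<Longrightarrow> y \<in> carrier B \<Longrightarrow> x \<otimes> (c \<odot> y) = c \<odot> (x \<otimes> y)"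
  by (simp_all add: smult_closed smult_add_right smult_assoc smult_mult_left smult_mult_right)

lemma left_rule:
  assumes "x \<otimes> y = w" "x \<in> carrier B" "y \<in> carrier B" "z \<in> carrier B"
  shows "x \<otimes> (y \<otimes> z) = w \<otimes> z"
  using assms by (simp add: m_assoc[symmetric])

text \<open>That the comultiplication respects the relations, proved for two commuting triples in
  any algebra. One proof then serves the double and triple tensor products of the quantum algebra as
  well as the matrices acting on the module.\<close>

lemma triple_delta:
  assumes h: "triple q h" and h': "triple q h'" and c: "commuting h h'" and q: "q \<noteq> 0"
  shows "triple q (delta h h')"
proof -
  note r = triple_rules[OF h q] and r' = triple_rules[OF h' q]
  have cl: "h g \<in> carrier B" "h' g \<in> carrier B" for g using r(1) r'(1) by auto
  have com: "h' g' \<otimes> h g = h g \<otimes> h' g'" for g g' using c by (simp add: commuting_def)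
  note L = left_rule[OF _ cl(1) cl(1)] left_rule[OF _ cl(2) cl(2)] 
  note rl = r(2-8) r'(2-8) com r(2-8)[THEN left_rule[OF _ cl(1) cl(1)]] r'(2-8)[THEN left_rule[OF _ cl(2) cl(2)]]
    com[THEN left_rule[OF _ cl(2) cl(1)]]
  note nf = cl m_closed a_closed smult_simps l_distr r_distr m_assoc rl one_closed
  let ?c = "qc q" and ?d = "- qc q"
  have "delta h h' g \<in> carrier B" for g by (cases g) (simp_all add: delta_def nf)
  moreover have "delta h h' UQ \<otimes> delta h h' UQi = \<one>" "delta h h' UQi \<otimes> delta h h' UQ = \<one>"
    by (simp_all add: delta_def nf)
  moreover have "delta h h' UQ \<otimes> delta h h' UE = q \<odot> (delta h h' UE \<otimes> delta h h' UQ)"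
    by (simp add: delta_def nf)
  moreover have "delta h h' UQ \<otimes> delta h h' UF = inverse q \<odot> (delta h h' UF \<otimes> delta h h' UQ)"
    by (simp add: delta_def nf)
  moreover have "delta h h' UE \<otimes> delta h h' UF = delta h h' UF \<otimes> delta h h' UE
     \<oplus> ?c \<odot> (delta h h' UQ \<otimes> delta h h' UQ) \<oplus> ?d \<odot> (delta h h' UQi \<otimes> delta h h' UQi)"
  proof -
    \<comment> \<open>In the commutator of the images of E and F, the product of q^(2H) in the first
      factor with q^(-2H) in the second arises twice, with opposite signs.\<close>
    have canc: "?c \<odot> x \<oplus> (?d \<odot> x \<oplus> y) = y" "?d \<odot> x \<oplus> (?c \<odot> x \<oplus> y) = y" if "x \<in> carrier B" "y \<in> carrier B" for x y
      using that smult_add_left[of x ?c ?d] smult_add_left[of x ?d ?c]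
      by (simp_all add: a_assoc[symmetric] smult_closed smult_zero_left)
    show ?thesis
      by (simp add: delta_def nf a_ac canc)
  qed
  ultimately show ?thesis by (simp add: triple_def)
qed

definition cas :: "complex \<Rightarrow> (uq_gen \<Rightarrow> 'a) \<Rightarrow> 'a" where
  "cas q h = ((q - inverse q)\<^sup>2) \<odot> (h UF \<otimes> h UE) \<oplus> q \<odot> (h UQ \<otimes> h UQ) \<oplus> inverse q \<odot> (h UQi \<otimes> h UQi)"

lemma cas_commute_if:
  assumes m: "m \<in> carrier B" and h: "\<And>g. h g \<in> carrier B" and c: "\<And>g. m \<otimes> h g = h g \<otimes> m"
  shows "m \<otimes> cas q h = cas q h \<otimes> m"
proof -
  have c': "m \<otimes> (h g \<otimes> h g') = (h g \<otimes> h g') \<otimes> m" for g g'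
    using m h c by (metis m_assoc)
  show ?thesis unfolding cas_def using m h
    by (simp add: l_distr r_distr smult_simps c')
qed

text \<open>For E and F, normal ordering produces extra terms in q^(2H) and q^(-2H); the
  coefficients match because (q - 1/q)^2 times \<open>qc q\<close> is q - 1/q.\<close>

lemma cas_central:
  assumes h: "triple q h" and q: "q \<noteq> 0" "q - inverse q \<noteq> 0"
  shows "cas q h \<otimes> h g = h g \<otimes> cas q h"
proof -
  note r = triple_rules[OF h q(1)]
  note cl = r(1)
  note rl = r(2-8) r(2-8)[THEN left_rule[OF _ cl cl]]
  note nf = cl m_closed a_closed smult_simps l_distr r_distr m_assoc rl one_closed
  define D where "D = (q - inverse q)\<^sup>2"
  have D: "D * qc q = q - inverse q" using q(2) by (simp add: D_def qc_def power2_eq_square)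
  note cas = cas_def D_def[symmetric]
  have comb: "x \<oplus> a \<odot> y \<oplus> b \<odot> z \<oplus> c \<odot> y \<oplus> d \<odot> z = x \<oplus> (a + c) \<odot> y \<oplus> (b + d) \<odot> z"
    if "x \<in> carrier B" "y \<in> carrier B" "z \<in> carrier B" for a b c d x y z
    using that by (simp add: smult_add_left smult_simps a_ac)
  consider "g = UQ" | "g = UQi" | "g = UE" | "g = UF" by (cases g) auto
  then show ?thesis
  proof cases
    case 1
    then show ?thesis using q(1) by (simp add: cas nf smult_one)
  next
    case 2
    then show ?thesis using q(1) by (simp add: cas nf smult_one)
  next
    case 3
    let ?X = "D \<odot> (h UF \<otimes> (h UE \<otimes> h UE))" and ?Y = "h UE \<otimes> (h UQ \<otimes> h UQ)" and ?Z = "h UE \<otimes> (h UQi \<otimes> h UQi)"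
    have "h UE \<otimes> cas q h = ?X \<oplus> (D * (qc q * (q * q))) \<odot> ?Y \<oplus> (D * (- qc q * (inverse q * inverse q))) \<odot> ?Z
        \<oplus> q \<odot> ?Y \<oplus> inverse q \<odot> ?Z"
      by (simp add: cas nf a_ac)
    also have "\<dots> = ?X \<oplus> (D * (qc q * (q * q)) + q) \<odot> ?Y \<oplus> (D * (- qc q * (inverse q * inverse q)) + inverse q) \<odot> ?Z"
      by (rule comb) (simp_all add: nf)
    also have "D * (qc q * (q * q)) + q = q * (q * q)"
      using q(1) by (simp only: mult.assoc[symmetric] D) (simp add: algebra_simps)
    also have "D * (- qc q * (inverse q * inverse q)) + inverse q = inverse q * (inverse q * inverse q)"
      using q(1) by (simp only: mult_minus_left mult_minus_right mult.assoc[symmetric] D) (simp add: algebra_simps)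
    also have "?X \<oplus> (q * (q * q)) \<odot> ?Y \<oplus> (inverse q * (inverse q * inverse q)) \<odot> ?Z = cas q h \<otimes> h UE"
      by (simp add: cas nf)
    finally show ?thesis unfolding 3 ..
  next
    case 4
    let ?X = "D \<odot> (h UF \<otimes> (h UF \<otimes> h UE))" and ?Y = "h UF \<otimes> (h UQ \<otimes> h UQ)" and ?Z = "h UF \<otimes> (h UQi \<otimes> h UQi)"
    have "cas q h \<otimes> h UF = ?X \<oplus> (D * qc q) \<odot> ?Y \<oplus> (D * (- qc q)) \<odot> ?Z
        \<oplus> (q * (inverse q * inverse q)) \<odot> ?Y \<oplus> (inverse q * (q * q)) \<odot> ?Z"
      by (simp add: cas nf a_ac)
    also have "\<dots> = ?X \<oplus> (D * qc q + q * (inverse q * inverse q)) \<odot> ?Y \<oplus> (D * (- qc q) + inverse q * (q * q)) \<odot> ?Z"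
      by (rule comb) (simp_all add: nf)
    also have "D * qc q + q * (inverse q * inverse q) = q" using q(1) by (simp add: D)
    also have "D * (- qc q) + inverse q * (q * q) = inverse q" using q(1) by (simp add: D)
    also have "?X \<oplus> q \<odot> ?Y \<oplus> inverse q \<odot> ?Z = h UF \<otimes> cas q h"
      by (simp add: cas nf)
    finally show ?thesis unfolding 4 .
  qed
qed

lemma commuting_sym: "commuting h h' \<Longrightarrow> commuting h' h"
  by (simp add: commuting_def)

lemma delta_closed:
  assumes "\<And>g. h g \<in> carrier B" "\<And>g. h' g \<in> carrier B"
  shows "delta h h' g \<in> carrier B"
  using assms by (cases g) (simp_all add: delta_def)

lemma commuting_delta:
  assumes cl: "\<And>g. a g \<in> carrier B" "\<And>g. b g \<in> carrier B" "\<And>g. c g \<in> carrier B"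
    and "commuting a c" "commuting b c"
  shows "commuting (delta a b) c"
proof -
  have ac: "a g \<otimes> c g' = c g' \<otimes> a g" "b g \<otimes> c g' = c g' \<otimes> b g" for g g'
    using assms by (simp_all add: commuting_def)
  have "(a g \<otimes> b g') \<otimes> c z = c z \<otimes> (a g \<otimes> b g')" for g g' z
    using cl ac by (metis m_assoc)
  then have "delta a b g \<otimes> c z = c z \<otimes> delta a b g" for g z
    using cl by (cases g) (simp_all add: delta_def l_distr r_distr)
  then show ?thesis by (simp add: commuting_def)
qed

lemma delta_assoc:
  assumes "\<And>g. a g \<in> carrier B" "\<And>g. b g \<in> carrier B" "\<And>g. c g \<in> carrier B"
  shows "delta (delta a b) c g = delta a (delta b c) g"
  using assms by (cases g) (simp_all add: delta_def l_distr r_distr m_assoc a_assoc)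

lemma cas_closed: "(\<And>g. h g \<in> carrier B) \<Longrightarrow> cas q h \<in> carrier B"
  by (simp add: cas_def smult_closed)

lemma commute_delta:
  assumes m: "m \<in> carrier B" and cl: "\<And>g. a g \<in> carrier B" "\<And>g. b g \<in> carrier B"
    and "\<And>g. m \<otimes> a g = a g \<otimes> m" "\<And>g. m \<otimes> b g = b g \<otimes> m"
  shows "m \<otimes> delta a b g = delta a b g \<otimes> m"
proof -
  have "m \<otimes> (a g \<otimes> b g') = (a g \<otimes> b g') \<otimes> m" for g g'
    using assms by (metis m_assoc)
  then show ?thesis using m cl by (cases g) (simp_all add: delta_def l_distr r_distr)
qed

text \<open>The Casimir of two neighbouring factors commutes with their joint action and with the
  remaining factor separately. For the last two factors the total action is first regrouped by
  \<open>delta_assoc\<close>, which is coassociativity.\<close>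

lemma cas_commute3:
  assumes abc: "triple q a" "triple q b" "triple q c" and q: "q \<noteq> 0" "q - inverse q \<noteq> 0"
    and com: "commuting a b" "commuting a c" "commuting b c"
  defines "z \<equiv> delta (delta a b) c"
  shows "cas q (delta a b) \<otimes> z g = z g \<otimes> cas q (delta a b)"
    "cas q (delta b c) \<otimes> z g = z g \<otimes> cas q (delta b c)"
    "cas q z \<otimes> z g = z g \<otimes> cas q z"
proof -
  have cl: "a g \<in> carrier B" "b g \<in> carrier B" "c g \<in> carrier B" for g
    using abc by (auto simp: triple_def)
  note ab = triple_delta[OF abc(1,2) com(1) q(1)] and bc = triple_delta[OF abc(2,3) com(3) q(1)]
  note cab = commuting_delta[OF cl com(2,3)]
  have cbc: "commuting (delta b c) a"
    by (rule commuting_delta[OF cl(2,3,1) commuting_sym[OF com(1)] commuting_sym[OF com(2)]])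
  have cl': "delta a b g \<in> carrier B" "delta b c g \<in> carrier B" for g
    using cl by (auto intro: delta_closed)
  show "cas q (delta a b) \<otimes> z g = z g \<otimes> cas q (delta a b)"
    unfolding z_def
  proof (rule commute_delta)
    show "cas q (delta a b) \<otimes> delta a b g = delta a b g \<otimes> cas q (delta a b)" for g
      by (rule cas_central[OF ab q])
    show "cas q (delta a b) \<otimes> c g = c g \<otimes> cas q (delta a b)" for g
      by (rule cas_commute_if[symmetric]) (use cl cl' cab in \<open>auto simp: commuting_def\<close>)
  qed (use cl cl' in \<open>auto intro: cas_closed\<close>)
  have z: "z = delta a (delta b c)" unfolding z_def by (rule ext) (rule delta_assoc[OF cl])
  show "cas q (delta b c) \<otimes> z g = z g \<otimes> cas q (delta b c)"
    unfolding z
  proof (rule commute_delta)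
    show "cas q (delta b c) \<otimes> delta b c g = delta b c g \<otimes> cas q (delta b c)" for g
      by (rule cas_central[OF bc q])
    show "cas q (delta b c) \<otimes> a g = a g \<otimes> cas q (delta b c)" for g
      by (rule cas_commute_if[symmetric]) (use cl cl' cbc in \<open>auto simp: commuting_def\<close>)
  qed (use cl cl' in \<open>auto intro: cas_closed\<close>)
  show "cas q z \<otimes> z g = z g \<otimes> cas q z"
    unfolding z_def by (rule cas_central[OF triple_delta[OF ab abc(3) cab q(1)] q])
qed

lemma hom_casimir:
  assumes f: "f \<in> alg_hom (Uq q) B"
  shows "f (casimir q) = cas q (\<lambda>g. f (generator (Uq_rels q) g))"
proof -
  define h' where "h' = (\<lambda>g. f (generator (Uq_rels q) g))"
  have h: "h' g \<in> carrier B" for g unfolding h'_def by (rule alg_homD(1)[OF f generator_closed])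
  have "f (casimir q) = eval_free B h' (scalar ((q - inverse q)\<^sup>2) * (var UF * var UE)
       + scalar q * (var UQ * var UQ) + scalar (inverse q) * (var UQi * var UQi))"
    unfolding casimir_def h'_def by (subst hom_presented[OF unital_algebra_axioms f]) (simp add: power2_eq_square mult.assoc)
  also have "\<dots> = cas q h'"
    unfolding eval_free_add[OF h] eval_free_smult[OF h] unfolding eval_free_mult[OF h] eval_free_var[OF h] cas_def ..
  finally show ?thesis unfolding h'_def .
qed

end

lemma hom_delta:
  assumes A: "unital_algebra A" and B: "unital_algebra B" and f: "f \<in> alg_hom A B"
    and h: "\<And>g. h g \<in> carrier A" "\<And>g. h' g \<in> carrier A"
  shows "f (unital_algebra.delta A h h' g) = unital_algebra.delta B (\<lambda>g. f (h g)) (\<lambda>g. f (h' g)) g"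
proof -
  interpret A: unital_algebra A by (rule A)
  interpret B: unital_algebra B by (rule B)
  show ?thesis using h by (cases g) (simp_all add: A.delta_def B.delta_def alg_homD[OF f])
qed

lemma hom_eqI:
  assumes B: "unital_algebra B" and f: "f \<in> alg_hom (presented R) B" and f': "f' \<in> alg_hom (presented R) B"
    and eq: "\<And>g. f (generator R g) = f' (generator R g)" and X: "X \<in> carrier (presented R)"
  shows "f X = f' X"
proof -
  obtain r where r: "X = cls R r" using X by (auto simp: presented_simps)
  have "f X = eval_free B (\<lambda>g. f (generator R g)) r" unfolding r by (rule hom_presented[OF B f])
  also have "\<dots> = eval_free B (\<lambda>g. f' (generator R g)) r" unfolding eq ..
  also have "\<dots> = f' X" unfolding r by (rule hom_presented[OF B f', symmetric])
  finally show ?thesis .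
qed

lemma triple_generator: "unital_algebra.triple (Uq q) q (generator (Uq_rels q))"
proof -
  interpret A: unital_algebra "Uq q" by (rule unital_algebra_presented)
  have "A.satisfies (generator (Uq_rels q)) (Uq_rels q)"
    unfolding A.satisfies_def
  proof (intro conjI allI ballI)
    show "generator (Uq_rels q) g \<in> carrier (Uq q)" for g by (rule generator_closed)
    show "eval_free (Uq q) (generator (Uq_rels q)) r = \<zero>\<^bsub>Uq q\<^esub>" if "r \<in> Uq_rels q" for r
      unfolding eval_free_presented presented_simps(3) cls_eq_iff diff_zero
      by (rule rel_ideal_superset[OF that])
  qed
  then show ?thesis by (simp only: A.satisfies_Uq)
qed

section \<open>The comultiplication and its iterate on the presented algebras\<close>

context
  fixes q :: complex
  assumes q: "q \<noteq> 0"
begin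

interpretation U2: unital_algebra "presented (Uq2_rels q)" by (rule unital_algebra_presented)
interpretation U3: unital_algebra "presented (Uq3_rels q)" by (rule unital_algebra_presented)

private definition "e1 = (\<lambda>g. generator (Uq2_rels q) (Inl g))"
private definition "e2 = (\<lambda>g. generator (Uq2_rels q) (Inr g))"

lemma e12: "U2.triple q e1" "U2.triple q e2" "U2.commuting e1 e2" "U2.triple q (U2.delta e1 e2)"
proof -
  show 1: "U2.triple q e1" "U2.triple q e2" "U2.commuting e1 e2"
    unfolding e1_def e2_def U2.satisfies_Uq[symmetric] by (rule tensor_incl)+
  show "U2.triple q (U2.delta e1 e2)" by (rule U2.triple_delta[OF 1 q])
qed

lemma comult_eq: "comult q = extend_hom (presented (Uq2_rels q)) (U2.delta e1 e2)"
proof -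
  have "pure_tensor (Uq_rels q) (Uq_rels q) (generator (Uq_rels q) a) (generator (Uq_rels q) b)
      = e1 a \<otimes>\<^bsub>presented (Uq2_rels q)\<^esub> e2 b" for a b
    unfolding incl(5) incl(3,4) e1_def e2_def ..
  then show ?thesis unfolding comult_def Let_def
    by (intro arg_cong[of _ _ "extend_hom (presented (Uq2_rels q))"] ext) (simp add: U2.delta_def split: uq_gen.split)
qed

lemma comult_hom: "comult q \<in> alg_hom (Uq q) (presented (Uq2_rels q))"
  and comult_generator_aux: "comult q (generator (Uq_rels q) g) = U2.delta e1 e2 g"
proof -
  have "U2.satisfies (U2.delta e1 e2) (Uq_rels q)" using e12 by (simp only: U2.satisfies_Uq)
  from U2.satisfiesD(4,5)[OF this]
  show "comult q \<in> alg_hom (Uq q) (presented (Uq2_rels q))"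
    "comult q (generator (Uq_rels q) g) = U2.delta e1 e2 g" unfolding comult_eq by blast+
qed

lemma comult_generator:
  "comult q (generator (Uq_rels q) g)
     = U2.delta (\<lambda>g. generator (Uq2_rels q) (Inl g)) (\<lambda>g. generator (Uq2_rels q) (Inr g)) g"
  unfolding comult_generator_aux e1_def e2_def ..

text \<open>Generators of the two factors commute by definition; \<open>commute_eval\<close> extends
  this first to one side, then to the other.\<close>

lemma incl_commute:
  fixes R :: "'g free_alg set" and S :: "'h free_alg set"
  assumes "X \<in> carrier (presented R)" "Y \<in> carrier (presented S)"
  shows "incl1 R S X \<otimes>\<^bsub>presented (tensor_rels R S)\<^esub> incl2 R S Y
      = incl2 R S Y \<otimes>\<^bsub>presented (tensor_rels R S)\<^esub> incl1 R S X"
proof -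
  interpret T: unital_algebra "presented (tensor_rels R S)" by (rule unital_algebra_presented)
  obtain r r' where r: "X = cls R r" "Y = cls S r'" using assms by (auto simp: presented_simps)
  have 1: "incl1 R S X = eval_free (presented (tensor_rels R S)) (\<lambda>g. generator (tensor_rels R S) (Inl g)) r"
    using hom_presented[OF unital_algebra_presented incl(1), of R S r] unfolding incl(3) r(1) .
  have 2: "incl2 R S Y = eval_free (presented (tensor_rels R S)) (\<lambda>g. generator (tensor_rels R S) (Inr g)) r'"
    using hom_presented[OF unital_algebra_presented incl(2), of R S r'] unfolding incl(4) r(2) .
  note c = tensor_incl(3)[of R S, unfolded T.commuting_def, rule_format]
  have c': "generator (tensor_rels R S) (Inr g) \<otimes>\<^bsub>presented (tensor_rels R S)\<^esub> incl1 R S X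
      = incl1 R S X \<otimes>\<^bsub>presented (tensor_rels R S)\<^esub> generator (tensor_rels R S) (Inr g)" for g
    unfolding 1 by (rule T.commute_eval) (simp_all only: generator_closed c)
  have "incl1 R S X \<in> carrier (presented (tensor_rels R S))" by (rule alg_homD(1)[OF incl(1) assms(1)])
  then show ?thesis unfolding 2
    by (rule T.commute_eval) (simp_all only: generator_closed c')
qed

text \<open>\<open>F3\<close> is the comultiplication tensored with the identity; \<open>d1\<close>
  and \<open>d2\<close> will be its values on the generators of the first and the second
  factor.\<close>

private definition "F3 = tensor_map (Uq_rels q) (Uq_rels q) (Uq2_rels q) (Uq_rels q) (comult q) (\<lambda>Y. Y)"
private definition "d1 = (\<lambda>g. incl1 (Uq2_rels q) (Uq_rels q) (comult q (generator (Uq_rels q) g)))"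
private definition "d2 = (\<lambda>g. generator (Uq3_rels q) (Inr g))"

lemma F3: "F3 \<in> alg_hom (presented (Uq2_rels q)) (presented (Uq3_rels q))" "F3 (e1 g) = d1 g" "F3 (e2 g) = d2 g"
proof -
  have F: "F3 = extend_hom (presented (Uq3_rels q)) (case_sum d1 d2)"
    unfolding F3_def tensor_map_def
    by (intro arg_cong[of _ _ "extend_hom (presented (Uq3_rels q))"] ext)
      (simp add: d1_def d2_def pure_tensor_one one_pure_tensor alg_homD(1)[OF comult_hom generator_closed]
         generator_closed incl(4) split: sum.split)
  have "U3.satisfies (case_sum d1 d2) (Uq2_rels q)"
  proof (rule U3.satisfies_tensor)
    show "U3.satisfies d1 (Uq_rels q)" unfolding d1_def
      by (rule U3.satisfies_hom[OF alg_hom_comp[OF comult_hom incl(1)]])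
    show "U3.satisfies d2 (Uq_rels q)" unfolding d2_def by (rule tensor_incl(2))
    show "U3.commuting d1 d2"
      unfolding U3.commuting_def d1_def d2_def incl(4)[symmetric]
      by (intro allI incl_commute alg_homD(1)[OF comult_hom] generator_closed)
  qed
  note D = U3.satisfiesD(4,5)[OF this, folded F]
  show "F3 \<in> alg_hom (presented (Uq2_rels q)) (presented (Uq3_rels q))" by (rule D)
  show "F3 (e1 g) = d1 g" "F3 (e2 g) = d2 g"
    using D(2)[of "Inl g"] D(2)[of "Inr g"] by (simp_all only: e1_def e2_def sum.case)
qed

lemma comult2_hom: "comult2 q \<in> alg_hom (Uq q) (presented (Uq3_rels q))"
proof -
  have "comult2 q = (\<lambda>X. F3 (comult q X))" by (rule ext) (simp add: comult2_def F3_def)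
  then show ?thesis using alg_hom_comp[OF comult_hom F3(1)] by simp
qed

lemma comult2_generator:
  "comult2 q (generator (Uq_rels q) g) = U3.delta
     (\<lambda>g. incl1 (Uq2_rels q) (Uq_rels q) (comult q (generator (Uq_rels q) g))) (\<lambda>g. generator (Uq3_rels q) (Inr g)) g"
proof -
  have "comult2 q (generator (Uq_rels q) g) = F3 (U2.delta e1 e2 g)"
    by (simp only: comult2_def F3_def comult_generator_aux)
  also have "\<dots> = U3.delta (\<lambda>g. F3 (e1 g)) (\<lambda>g. F3 (e2 g)) g"
    by (rule hom_delta[OF unital_algebra_presented unital_algebra_presented F3(1)])
      (simp_all only: e1_def e2_def generator_closed)
  finally show ?thesis unfolding F3 d1_def d2_def .
qed

text \<open>The nested case distinction satisfies the relations because the three families of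
  generators commute pairwise in the triple product.\<close>

lemma tensor_assoc_hom:
  "tensor_assoc (Uq_rels q) (Uq_rels q) (Uq_rels q)
     \<in> alg_hom (presented (tensor_rels (Uq_rels q) (Uq2_rels q))) (presented (Uq3_rels q))" (is ?h)
  "tensor_assoc (Uq_rels q) (Uq_rels q) (Uq_rels q) (generator (tensor_rels (Uq_rels q) (Uq2_rels q)) (Inr z))
     = (case z of Inl g \<Rightarrow> generator (Uq3_rels q) (Inl (Inr g)) | Inr g \<Rightarrow> generator (Uq3_rels q) (Inr g))" (is ?g)
proof -
  let ?g1 = "\<lambda>g. generator (Uq3_rels q) (Inl (Inl g))" and ?g2 = "\<lambda>g. generator (Uq3_rels q) (Inl (Inr g))"
    and ?g3 = "\<lambda>g. generator (Uq3_rels q) (Inr g)"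
  have i: "?g1 g = incl1 (Uq2_rels q) (Uq_rels q) (e1 g)" "?g2 g = incl1 (Uq2_rels q) (Uq_rels q) (e2 g)"
    "?g3 g = incl2 (Uq2_rels q) (Uq_rels q) (generator (Uq_rels q) g)" for g
    by (simp_all only: e1_def e2_def incl(3,4))
  have e: "e1 g \<in> carrier (presented (Uq2_rels q))" "e2 g \<in> carrier (presented (Uq2_rels q))" for g
    by (simp_all only: e1_def e2_def generator_closed)
  have s: "U3.satisfies ?g1 (Uq_rels q)" "U3.satisfies ?g2 (Uq_rels q)" "U3.satisfies ?g3 (Uq_rels q)"
    unfolding i(1,2) e1_def e2_def
    by (rule U3.satisfies_image[OF unital_algebra_presented tensor_incl(1) incl(1)],
        rule U3.satisfies_image[OF unital_algebra_presented tensor_incl(2) incl(1)], rule tensor_incl(2))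
  have "e1 g \<otimes>\<^bsub>presented (Uq2_rels q)\<^esub> e2 g' = e2 g' \<otimes>\<^bsub>presented (Uq2_rels q)\<^esub> e1 g" for g g'
    using e12(3) by (simp add: U2.commuting_def)
  then have c12: "U3.commuting ?g1 ?g2"
    unfolding i U3.commuting_def by (simp only: alg_homD(2)[OF incl(1), symmetric] e simp_thms)
  have c13: "U3.commuting ?g1 ?g3" "U3.commuting ?g2 ?g3"
    unfolding i U3.commuting_def by (intro allI incl_commute e generator_closed)+
  have c1: "U3.commuting ?g1 (case_sum ?g2 ?g3)"
    using c12 c13(1) unfolding U3.commuting_def by (auto split: sum.split)
  have "U3.satisfies (case_sum ?g1 (case_sum ?g2 ?g3)) (tensor_rels (Uq_rels q) (Uq2_rels q))"
    by (intro U3.satisfies_tensor s c1 c13)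
  note D = U3.satisfiesD(4,5)[OF this]
  show ?h unfolding tensor_assoc_def Let_def by (rule D)
  show ?g unfolding tensor_assoc_def Let_def D by (cases z) simp_all
qed

end

section \<open>Kronecker products and the tensor product representations\<close>

text \<open>The Kronecker product flattens a pair of indices by div and mod; this undoes the
  flattening inside sums.\<close>

lemma sum_prod_nat:
  fixes f :: "nat \<Rightarrow> nat \<Rightarrow> 'a :: comm_monoid_add"
  shows "(\<Sum>t<m * r. f (t div r) (t mod r)) = (\<Sum>i<m. \<Sum>j<r. f i j)"
proof (cases "r = 0")
  case False
  have "(\<Sum>i<m. \<Sum>j<r. f i j) = (\<Sum>(i, j)\<in>{..<m} \<times> {..<r}. f i j)"
    by (simp add: sum.cartesian_product)
  also have "\<dots> = (\<Sum>t<m * r. f (t div r) (t mod r))"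
  proof (rule sum.reindex_bij_witness[where i = "\<lambda>t. (t div r, t mod r)" and j = "\<lambda>(i, j). i * r + j"])
    fix z assume "z \<in> {..<m} \<times> {..<r}"
    then obtain i j where z: "z = (i, j)" "i < m" "j < r" by auto
    have "i * r + j < m * r"
    proof -
      have "i * r + j < Suc i * r" using z(3) by simp
      also have "\<dots> \<le> m * r" using z(2) by (intro mult_le_mono1) simp
      finally show ?thesis .
    qed
    then show "(case z of (i, j) \<Rightarrow> i * r + j) \<in> {..<m * r}" by (simp add: z)
  qed (use False in \<open>auto simp: less_mult_imp_div_less\<close>)
  finally show ?thesis ..
qed simp

lemma index_lt: "i < m \<Longrightarrow> j < r \<Longrightarrow> i * r + j < m * (r :: nat)"
proof -
  assume "i < m" "j < r"
  then have "i * r + j < Suc i * r" by simp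
  also have "\<dots> \<le> m * r" using \<open>i < m\<close> by (intro mult_le_mono1) simp
  finally show ?thesis .
qed

lemma kron_carrier: "A \<in> carrier_mat m k \<Longrightarrow> B \<in> carrier_mat r t \<Longrightarrow> kron A B \<in> carrier_mat (m * r) (k * t)"
  by (auto simp: kron_def)

lemma kron_mult:
  assumes "A \<in> carrier_mat m k" "C \<in> carrier_mat k l" "B \<in> carrier_mat r t" "D \<in> carrier_mat t u"
  shows "kron A B * kron C D = kron (A * C) (B * D)"
proof (rule eq_matI)
  fix i j assume "i < dim_row (kron (A * C) (B * D))" "j < dim_col (kron (A * C) (B * D))"
  then have ij: "i < m * r" "j < l * u" using assms by (auto simp: kron_def)
  then have r: "r > 0" "u > 0" by (auto intro: gr0I)
  then have d: "i div r < m" "i mod r < r" "j div u < l" "j mod u < u"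
    using ij by (auto simp: less_mult_imp_div_less)
  have "(kron A B * kron C D) $$ (i, j)
      = (\<Sum>v<k * t. (A $$ (i div r, v div t) * B $$ (i mod r, v mod t)) * (C $$ (v div t, j div u) * D $$ (v mod t, j mod u)))"
    using ij assms by (auto simp: kron_def scalar_prod_def atLeast0LessThan)
  also have "\<dots> = (\<Sum>a<k. \<Sum>b<t. (A $$ (i div r, a) * B $$ (i mod r, b)) * (C $$ (a, j div u) * D $$ (b, j mod u)))"
    by (rule sum_prod_nat)
  also have "\<dots> = (\<Sum>a<k. A $$ (i div r, a) * C $$ (a, j div u)) * (\<Sum>b<t. B $$ (i mod r, b) * D $$ (b, j mod u))"
    by (simp add: sum_product mult_ac)
  also have "\<dots> = kron (A * C) (B * D) $$ (i, j)"
    using ij assms d by (auto simp: kron_def scalar_prod_def atLeast0LessThan)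
  finally show "(kron A B * kron C D) $$ (i, j) = kron (A * C) (B * D) $$ (i, j)" .
qed (use assms in \<open>auto simp: kron_def\<close>)

lemma kron_one: "kron (1\<^sub>m m) (1\<^sub>m r) = 1\<^sub>m (m * r)"
proof (rule eq_matI)
  fix i j assume "i < dim_row (1\<^sub>m (m * r))" "j < dim_col (1\<^sub>m (m * r))"
  then have ij: "i < m * r" "j < m * r" by auto
  then have r: "r > 0" by (auto intro: gr0I)
  have "i div r < m" "i mod r < r" "j div r < m" "j mod r < r"
    using ij r by (auto simp: less_mult_imp_div_less)
  moreover have "i = j \<longleftrightarrow> i div r = j div r \<and> i mod r = j mod r" by (metis div_mult_mod_eq)
  ultimately show "kron (1\<^sub>m m) (1\<^sub>m r) $$ (i, j) = 1\<^sub>m (m * r) $$ (i, j)"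
    using ij by (auto simp: kron_def)
qed (auto simp: kron_def)

lemma kron_hom1: "(\<lambda>X. kron X (1\<^sub>m r)) \<in> alg_hom (mat_alg m) (mat_alg (m * r))"
proof -
  have d: "i div r < m \<and> i mod r < r" if "i < m * r" for i
    using that by (metis less_mult_imp_div_less mod_less_divisor mult_0_right not_less0 neq0_conv)
  show ?thesis unfolding alg_hom_def
  proof (intro CollectI conjI ring_hom_memI ballI allI)
    fix X Y c assume "X \<in> carrier (mat_alg m)" "Y \<in> carrier (mat_alg m)"
    then have X: "X \<in> carrier_mat m m" "Y \<in> carrier_mat m m" by (simp_all add: module_mat_simps)
    show "kron (X \<otimes>\<^bsub>mat_alg m\<^esub> Y) (1\<^sub>m r) = kron X (1\<^sub>m r) \<otimes>\<^bsub>mat_alg (m * r)\<^esub> kron Y (1\<^sub>m r)"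
      using kron_mult[OF X one_carrier_mat one_carrier_mat, of r] by (simp add: module_mat_simps)
    show "kron (X \<oplus>\<^bsub>mat_alg m\<^esub> Y) (1\<^sub>m r) = kron X (1\<^sub>m r) \<oplus>\<^bsub>mat_alg (m * r)\<^esub> kron Y (1\<^sub>m r)"
      using X d by (intro eq_matI) (auto simp: module_mat_simps kron_def)
    show "kron (c \<odot>\<^bsub>mat_alg m\<^esub> X) (1\<^sub>m r) = c \<odot>\<^bsub>mat_alg (m * r)\<^esub> kron X (1\<^sub>m r)"
      using X d by (intro eq_matI) (auto simp: module_mat_simps kron_def)
    show "kron X (1\<^sub>m r) \<in> carrier (mat_alg (m * r))"
      using kron_carrier[OF X(1) one_carrier_mat[of r]] by (simp add: module_mat_simps)
  qed (simp add: module_mat_simps kron_one)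
qed

lemma kron_hom2: "(\<lambda>X. kron (1\<^sub>m r) X) \<in> alg_hom (mat_alg m) (mat_alg (r * m))"
proof -
  have d: "i div m < r \<and> i mod m < m" if "i < r * m" for i
    using that by (metis less_mult_imp_div_less mod_less_divisor mult_0_right not_less0 neq0_conv)
  show ?thesis unfolding alg_hom_def
  proof (intro CollectI conjI ring_hom_memI ballI allI)
    fix X Y c assume "X \<in> carrier (mat_alg m)" "Y \<in> carrier (mat_alg m)"
    then have X: "X \<in> carrier_mat m m" "Y \<in> carrier_mat m m" by (simp_all add: module_mat_simps)
    show "kron (1\<^sub>m r) (X \<otimes>\<^bsub>mat_alg m\<^esub> Y) = kron (1\<^sub>m r) X \<otimes>\<^bsub>mat_alg (r * m)\<^esub> kron (1\<^sub>m r) Y"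
      using kron_mult[OF one_carrier_mat one_carrier_mat X, of r] by (simp add: module_mat_simps)
    show "kron (1\<^sub>m r) (X \<oplus>\<^bsub>mat_alg m\<^esub> Y) = kron (1\<^sub>m r) X \<oplus>\<^bsub>mat_alg (r * m)\<^esub> kron (1\<^sub>m r) Y"
      using X d by (intro eq_matI) (auto simp: module_mat_simps kron_def)
    show "kron (1\<^sub>m r) (c \<odot>\<^bsub>mat_alg m\<^esub> X) = c \<odot>\<^bsub>mat_alg (r * m)\<^esub> kron (1\<^sub>m r) X"
      using X d by (intro eq_matI) (auto simp: module_mat_simps kron_def)
    show "kron (1\<^sub>m r) X \<in> carrier (mat_alg (r * m))"
      using kron_carrier[OF one_carrier_mat[of r] X(1)] by (simp add: module_mat_simps)
  qed (simp add: module_mat_simps kron_one)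
qed

lemma kron_commute:
  assumes "X \<in> carrier (mat_alg m)" "Y \<in> carrier (mat_alg r)"
  shows "kron X (1\<^sub>m r) \<otimes>\<^bsub>mat_alg (m * r)\<^esub> kron (1\<^sub>m m) Y = kron (1\<^sub>m m) Y \<otimes>\<^bsub>mat_alg (m * r)\<^esub> kron X (1\<^sub>m r)"
proof -
  have X: "X \<in> carrier_mat m m" "Y \<in> carrier_mat r r" using assms by (simp_all add: module_mat_simps)
  then show ?thesis
    using kron_mult[OF X(1) one_carrier_mat one_carrier_mat X(2)] kron_mult[OF one_carrier_mat X(1) X(2) one_carrier_mat]
    by (simp add: module_mat_simps)
qed

text \<open>The values on the two embedded factors are found by comparing homomorphisms on
  generators, so they are available for arbitrary elements such as the image of the Casimir.\<close>

lemma tensor_rep: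
  assumes f: "f \<in> alg_hom (presented R) (mat_alg d)" and f': "f' \<in> alg_hom (presented S) (mat_alg d')"
  shows "tensor_rep R S d d' f f' \<in> alg_hom (presented (tensor_rels R S)) (mat_alg (d * d'))" (is ?h)
    and "X \<in> carrier (presented R) \<Longrightarrow> tensor_rep R S d d' f f' (incl1 R S X) = kron (f X) (1\<^sub>m d')"
    and "Y \<in> carrier (presented S) \<Longrightarrow> tensor_rep R S d d' f f' (incl2 R S Y) = kron (1\<^sub>m d) (f' Y)"
proof -
  interpret M: unital_algebra "mat_alg (d * d')" by (rule unital_algebra_mat)
  note h1 = alg_hom_comp[OF f kron_hom1[of d' d]] and h2 = alg_hom_comp[OF f' kron_hom2[of d d']]
  have "M.satisfies (case_sum (\<lambda>g. kron (f (generator R g)) (1\<^sub>m d')) (\<lambda>h. kron (1\<^sub>m d) (f' (generator S h)))) (tensor_rels R S)"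
  proof (rule M.satisfies_tensor)
    show "M.satisfies (\<lambda>g. kron (f (generator R g)) (1\<^sub>m d')) R" by (rule M.satisfies_hom[OF h1])
    show "M.satisfies (\<lambda>g. kron (1\<^sub>m d) (f' (generator S g))) S" by (rule M.satisfies_hom[OF h2])
    show "M.commuting (\<lambda>g. kron (f (generator R g)) (1\<^sub>m d')) (\<lambda>g. kron (1\<^sub>m d) (f' (generator S g)))"
      unfolding M.commuting_def by (intro allI kron_commute alg_homD(1)[OF f] alg_homD(1)[OF f'] generator_closed)
  qed
  note D = M.satisfiesD(4,5)[OF this, folded tensor_rep_def]
  show h: ?h by (rule D)
  show "tensor_rep R S d d' f f' (incl1 R S X) = kron (f X) (1\<^sub>m d')" if "X \<in> carrier (presented R)"
    by (rule hom_eqI[OF unital_algebra_mat alg_hom_comp[OF incl(1) h] h1 _ that]) (simp only: incl(3) D(2) sum.case)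
  show "tensor_rep R S d d' f f' (incl2 R S Y) = kron (1\<^sub>m d) (f' Y)" if "Y \<in> carrier (presented S)"
    by (rule hom_eqI[OF unital_algebra_mat alg_hom_comp[OF incl(2) h] h2 _ that]) (simp only: incl(4) D(2) sum.case)
qed

section \<open>The three Casimir elements as matrices on the tensor product of spin modules\<close>

context
  fixes q s :: complex and n :: nat
  assumes q: "q \<noteq> 0" "q - inverse q \<noteq> 0" and s: "s\<^sup>2 = q"
begin

text \<open>The actions of the quantum algebra in the three tensor factors. With them
  \<open>delta\<close> computes coproduct actions directly as matrices.\<close>

definition "slot1 g = kron (kron (spin_mat q s n g) (1\<^sub>m 2)) (1\<^sub>m 2)"
definition "slot2 g = kron (kron (1\<^sub>m (n + 1)) (spin_mat q s 1 g)) (1\<^sub>m 2)"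
definition "slot3 g = kron (1\<^sub>m ((n + 1) * 2)) (spin_mat q s 1 g)"

interpretation M: unital_algebra "mat_alg ((n + 1) * 2 * 2)" by (rule unital_algebra_mat)

lemma spin_triple: "unital_algebra.triple (mat_alg (k + 1)) q (spin_mat q s k)"
proof -
  interpret N: unital_algebra "mat_alg (k + 1)" by (rule unital_algebra_mat)
  have "N.satisfies (\<lambda>g. spin_rep q s k (generator (Uq_rels q) g)) (Uq_rels q)"
    by (rule N.satisfies_hom[OF spin_rep_hom[OF q s]])
  then show ?thesis unfolding spin_rep_generator[OF q s] N.satisfies_Uq .
qed

lemma triple_image:
  assumes "unital_algebra A" "unital_algebra B" "unital_algebra.triple A q h" "f \<in> alg_hom A B"
  shows "unital_algebra.triple B q (\<lambda>g. f (h g))"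
  using unital_algebra.satisfies_image[OF assms(2,1) _ assms(4), of h "Uq_rels q"] assms(3)
  by (simp only: unital_algebra.satisfies_Uq[OF assms(1)] unital_algebra.satisfies_Uq[OF assms(2)])

lemma slots:
  "M.triple q slot1" "M.triple q slot2" "M.triple q slot3"
  "M.commuting slot1 slot2" "M.commuting slot1 slot3" "M.commuting slot2 slot3"
proof -
  have t1: "unital_algebra.triple (mat_alg 2) q (spin_mat q s 1)" using spin_triple[of 1] by (simp add: numeral_2_eq_2)
  have c1: "spin_mat q s 1 g \<in> carrier (mat_alg 2)" for g
    using spin_mat_closed[of q s 1 g] by (simp add: module_mat_simps numeral_2_eq_2)
  have cn: "spin_mat q s n g \<in> carrier (mat_alg (n + 1))" for g
    using spin_mat_closed[of q s n g] by (simp add: module_mat_simps)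
  note m = unital_algebra_mat
  note k1 = kron_hom1[of 2 "n + 1"] and k2 = kron_hom2[of "n + 1" 2] and k3 = kron_hom1[of 2 "(n + 1) * 2"]
  show "M.triple q slot1" unfolding slot1_def
    by (rule triple_image[OF m m triple_image[OF m m spin_triple k1] k3])
  show "M.triple q slot2" unfolding slot2_def
    by (rule triple_image[OF m m triple_image[OF m m t1 k2] k3])
  show "M.triple q slot3" unfolding slot3_def
    by (rule triple_image[OF m m t1 kron_hom2])
  have c: "kron (spin_mat q s n g) (1\<^sub>m 2) \<in> carrier (mat_alg ((n + 1) * 2))"
    "kron (1\<^sub>m (n + 1)) (spin_mat q s 1 g) \<in> carrier (mat_alg ((n + 1) * 2))" for g
    by (rule alg_homD(1)[OF k1 cn], rule alg_homD(1)[OF k2 c1])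
  show "M.commuting slot1 slot2" unfolding M.commuting_def slot1_def slot2_def
    by (simp only: alg_homD(2)[OF k3, symmetric] c kron_commute[OF cn c1] simp_thms)
  show "M.commuting slot1 slot3" "M.commuting slot2 slot3"
    unfolding M.commuting_def slot1_def slot2_def slot3_def by (intro allI kron_commute c c1)+
qed

abbreviation "delta12 \<equiv> M.delta slot1 slot2"
abbreviation "delta23 \<equiv> M.delta slot2 slot3"
abbreviation "delta123 \<equiv> M.delta (M.delta slot1 slot2) slot3"

abbreviation "rep2 \<equiv> tensor_rep (Uq_rels q) (Uq_rels q) (n + 1) 2 (spin_rep q s n) (spin_rep q s 1)"

lemma spin_rep1: "spin_rep q s 1 \<in> alg_hom (Uq q) (mat_alg 2)"
  using spin_rep_hom[OF q s, of 1] by (simp add: numeral_2_eq_2)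

lemma rep2:
  "rep2 \<in> alg_hom (presented (Uq2_rels q)) (mat_alg ((n + 1) * 2))"
  "rep2 (generator (Uq2_rels q) (Inl g)) = kron (spin_mat q s n g) (1\<^sub>m 2)"
  "rep2 (generator (Uq2_rels q) (Inr g)) = kron (1\<^sub>m (n + 1)) (spin_mat q s 1 g)"
proof -
  note T = tensor_rep[OF spin_rep_hom[OF q s, of n] spin_rep1]
  show "rep2 \<in> alg_hom (presented (Uq2_rels q)) (mat_alg ((n + 1) * 2))" by (rule T)
  show "rep2 (generator (Uq2_rels q) (Inl g)) = kron (spin_mat q s n g) (1\<^sub>m 2)"
    using T(2)[OF generator_closed, of g] unfolding incl spin_rep_generator[OF q s] .
  show "rep2 (generator (Uq2_rels q) (Inr g)) = kron (1\<^sub>m (n + 1)) (spin_mat q s 1 g)"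
    using T(3)[OF generator_closed, of g] unfolding incl spin_rep_generator[OF q s] .
qed

abbreviation "rep3 \<equiv> spin_rep3 q s n 1 1"

lemma rep3:
  "rep3 \<in> alg_hom (presented (Uq3_rels q)) (mat_alg ((n + 1) * 2 * 2))"
  "X \<in> carrier (presented (Uq2_rels q)) \<Longrightarrow> rep3 (incl1 (Uq2_rels q) (Uq_rels q) X) = kron (rep2 X) (1\<^sub>m 2)"
  "rep3 (generator (Uq3_rels q) (Inl (Inl g))) = slot1 g"
  "rep3 (generator (Uq3_rels q) (Inl (Inr g))) = slot2 g"
  "rep3 (generator (Uq3_rels q) (Inr g)) = slot3 g"
proof -
  have r: "rep3 = tensor_rep (Uq2_rels q) (Uq_rels q) ((n + 1) * 2) 2 rep2 (spin_rep q s 1)"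
    by (simp add: spin_rep3_def numeral_2_eq_2)
  note T = tensor_rep[OF rep2(1) spin_rep1, folded r]
  show "rep3 \<in> alg_hom (presented (Uq3_rels q)) (mat_alg ((n + 1) * 2 * 2))" by (rule T)
  show "rep3 (incl1 (Uq2_rels q) (Uq_rels q) X) = kron (rep2 X) (1\<^sub>m 2)" if "X \<in> carrier (presented (Uq2_rels q))"
    by (rule T(2)[OF that])
  show "rep3 (generator (Uq3_rels q) (Inl (Inl g))) = slot1 g"
    using T(2)[OF generator_closed, of "Inl g"] unfolding incl rep2 slot1_def .
  show "rep3 (generator (Uq3_rels q) (Inl (Inr g))) = slot2 g"
    using T(2)[OF generator_closed, of "Inr g"] unfolding incl rep2 slot2_def .
  show "rep3 (generator (Uq3_rels q) (Inr g)) = slot3 g"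
    using T(3)[OF generator_closed, of g] unfolding incl spin_rep_generator[OF q s] slot3_def .
qed

lemma slot_closed: "slot1 g \<in> carrier (mat_alg ((n + 1) * 2 * 2))" "slot2 g \<in> carrier (mat_alg ((n + 1) * 2 * 2))"
  "slot3 g \<in> carrier (mat_alg ((n + 1) * 2 * 2))"
  using slots(1-3) unfolding M.triple_def by blast+

text \<open>\<open>C12\<close> is the value at \<open>casimir q\<close> of a composite homomorphism
  from the quantum algebra, and such a value depends only on the images of the generators.\<close>

lemma C12_eq: "C12 q s n 1 1 = M.cas q delta12"
proof -
  let ?f = "\<lambda>X. rep3 (incl1 (Uq2_rels q) (Uq_rels q) (comult q X))"
  have f: "?f \<in> alg_hom (Uq q) (mat_alg ((n + 1) * 2 * 2))"
    by (rule alg_hom_comp[OF comult_hom[OF q(1)] alg_hom_comp[OF incl(1) rep3(1)]])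
  have G: "casimir q \<in> carrier (Uq q)" by (simp add: casimir_def presented_simps)
  have "C12 q s n 1 1 = ?f (casimir q)"
    unfolding C12_def pure_tensor_one[OF alg_homD(1)[OF comult_hom[OF q(1)] G]] ..
  also have "\<dots> = M.cas q (\<lambda>g. ?f (generator (Uq_rels q) g))" by (rule M.hom_casimir[OF f])
  also have "(\<lambda>g. ?f (generator (Uq_rels q) g)) = delta12"
    unfolding comult_generator[OF q(1)]
    by (rule ext, subst hom_delta[OF unital_algebra_presented unital_algebra_mat alg_hom_comp[OF incl(1) rep3(1)]])
      (simp_all only: generator_closed incl(3) rep3(3,4))
  finally show ?thesis .
qed

lemma C23_eq: "C23 q s n 1 1 = M.cas q delta23"
proof -
  let ?a = "tensor_assoc (Uq_rels q) (Uq_rels q) (Uq_rels q)"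
  let ?f = "\<lambda>X. rep3 (?a (incl2 (Uq_rels q) (Uq2_rels q) (comult q X)))"
  note a = tensor_assoc_hom[OF q(1)]
  have f: "?f \<in> alg_hom (Uq q) (mat_alg ((n + 1) * 2 * 2))"
    by (rule alg_hom_comp[OF comult_hom[OF q(1)] alg_hom_comp[OF incl(2) alg_hom_comp[OF a(1) rep3(1)]]])
  have G: "casimir q \<in> carrier (Uq q)" by (simp add: casimir_def presented_simps)
  have "C23 q s n 1 1 = ?f (casimir q)"
    unfolding C23_def one_pure_tensor[OF alg_homD(1)[OF comult_hom[OF q(1)] G]] ..
  also have "\<dots> = M.cas q (\<lambda>g. ?f (generator (Uq_rels q) g))" by (rule M.hom_casimir[OF f])
  also have "(\<lambda>g. ?f (generator (Uq_rels q) g)) = delta23"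
    unfolding comult_generator[OF q(1)]
    by (rule ext, subst hom_delta[OF unital_algebra_presented unital_algebra_mat alg_hom_comp[OF incl(2) alg_hom_comp[OF a(1) rep3(1)]]])
      (simp_all only: generator_closed incl(4) a(2) sum.case rep3(4,5))
  finally show ?thesis .
qed

lemma rep3_comult2:
  "(\<lambda>X. rep3 (comult2 q X)) \<in> alg_hom (Uq q) (mat_alg ((n + 1) * 2 * 2))"
  "rep3 (comult2 q (generator (Uq_rels q) g)) = delta123 g"
proof -
  show "(\<lambda>X. rep3 (comult2 q X)) \<in> alg_hom (Uq q) (mat_alg ((n + 1) * 2 * 2))"
    by (rule alg_hom_comp[OF comult2_hom[OF q(1)] rep3(1)])
  have 1: "rep3 (incl1 (Uq2_rels q) (Uq_rels q) (comult q (generator (Uq_rels q) g))) = delta12 g" for g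
    unfolding comult_generator[OF q(1)]
    by (subst hom_delta[OF unital_algebra_presented unital_algebra_mat alg_hom_comp[OF incl(1) rep3(1)]])
      (simp_all only: generator_closed incl(3) rep3(3,4))
  show "rep3 (comult2 q (generator (Uq_rels q) g)) = delta123 g"
    unfolding comult2_generator[OF q(1)]
    by (subst hom_delta[OF unital_algebra_presented unital_algebra_mat rep3(1)])
      (simp_all only: generator_closed alg_homD(1)[OF incl(1)] alg_homD(1)[OF comult_hom[OF q(1)]] 1 rep3(5))
qed

lemma C123_eq: "C123 q s n 1 1 = M.cas q delta123"
  unfolding C123_def M.hom_casimir[OF rep3_comult2(1)] rep3_comult2(2) ..

text \<open>Commuting with the generators is enough because the image of the iterated coproduct
  consists of evaluations at them.\<close>

lemma centralizer_carrier:
  "m \<in> carrier (centralizer q s n 1 1) \<longleftrightarrow>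
     m \<in> carrier_mat ((n + 1) * 2 * 2) ((n + 1) * 2 * 2) \<and> (\<forall>g. delta123 g * m = m * delta123 g)"
proof -
  let ?N = "(n + 1) * 2 * 2"
  let ?r = "\<lambda>X. rep3 (comult2 q X)"
  have N: "(n + 1) * (1 + 1) * (1 + 1) = ?N" by simp
  have cl: "?r X \<in> carrier_mat ?N ?N" if "X \<in> carrier (Uq q)" for X
    using alg_homD(1)[OF rep3_comult2(1) that] by (simp add: module_mat_simps)
  have eq: "A * m - m * A = 0\<^sub>m ?N ?N \<longleftrightarrow> A * m = m * A"
    if "A \<in> carrier_mat ?N ?N" "m \<in> carrier_mat ?N ?N" for A :: "complex mat"
  proof
    assume 0: "A * m - m * A = 0\<^sub>m ?N ?N"
    show "A * m = m * A"
    proof (rule eq_matI)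
      fix i j assume "i < dim_row (m * A)" "j < dim_col (m * A)"
      then show "(A * m) $$ (i, j) = (m * A) $$ (i, j)"
        using arg_cong[OF 0, of "\<lambda>Z. Z $$ (i, j)"] that by (simp del: index_mult_mat(1) add: index_mult_mat(2,3))
    qed (use that in auto)
  next
    assume "A * m = m * A"
    then show "A * m - m * A = 0\<^sub>m ?N ?N" using that minus_r_inv_mat[of "m * A" ?N ?N] by simp
  qed
  have "m \<in> carrier (centralizer q s n 1 1) \<longleftrightarrow> m \<in> carrier_mat ?N ?N \<and> (\<forall>X\<in>carrier (Uq q). ?r X * m - m * ?r X = 0\<^sub>m ?N ?N)"
    unfolding centralizer_def Let_def N by (simp add: module_mat_simps)
  also have "\<dots> \<longleftrightarrow> m \<in> carrier_mat ?N ?N \<and> (\<forall>X\<in>carrier (Uq q). ?r X * m = m * ?r X)"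
    using eq cl by blast
  also have "\<dots> \<longleftrightarrow> m \<in> carrier_mat ?N ?N \<and> (\<forall>g. delta123 g * m = m * delta123 g)"
  proof (intro conj_cong refl iffI allI ballI)
    show "delta123 g * m = m * delta123 g" if "\<forall>X\<in>carrier (Uq q). ?r X * m = m * ?r X" for g
      using bspec[OF that generator_closed, of g] unfolding rep3_comult2(2) .
    fix X assume m: "m \<in> carrier_mat ?N ?N" and g: "\<forall>g. delta123 g * m = m * delta123 g" and X: "X \<in> carrier (Uq q)"
    obtain r where r: "X = cls (Uq_rels q) r" using X by (auto simp: presented_simps)
    have d: "delta123 g \<in> carrier (mat_alg ?N)" for g
      by (intro M.delta_closed slot_closed)
    have "?r X = eval_free (mat_alg ?N) delta123 r"
      unfolding r using hom_presented[OF unital_algebra_mat rep3_comult2(1), of r] unfolding rep3_comult2(2) .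
    then show "?r X * m = m * ?r X"
      using M.commute_eval[of m delta123 r, OF _ d] m g by (simp add: module_mat_simps)
  qed
  finally show ?thesis .
qed

lemma cas_in_centralizer:
  "C12 q s n 1 1 \<in> carrier (centralizer q s n 1 1)" "C23 q s n 1 1 \<in> carrier (centralizer q s n 1 1)"
  "C123 q s n 1 1 \<in> carrier (centralizer q s n 1 1)"
proof -
  note c = M.cas_commute3[OF slots(1-3) q slots(4-6)]
  have d: "delta12 g \<in> carrier (mat_alg ((n + 1) * 2 * 2))" "delta23 g \<in> carrier (mat_alg ((n + 1) * 2 * 2))"
    "delta123 g \<in> carrier (mat_alg ((n + 1) * 2 * 2))" for g
    by (intro M.delta_closed slot_closed)+
  have k: "M.cas q delta12 \<in> carrier (mat_alg ((n + 1) * 2 * 2))" "M.cas q delta23 \<in> carrier (mat_alg ((n + 1) * 2 * 2))"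
    "M.cas q delta123 \<in> carrier (mat_alg ((n + 1) * 2 * 2))"
    by (intro M.cas_closed d)+
  show "C12 q s n 1 1 \<in> carrier (centralizer q s n 1 1)" "C23 q s n 1 1 \<in> carrier (centralizer q s n 1 1)"
    "C123 q s n 1 1 \<in> carrier (centralizer q s n 1 1)"
    unfolding centralizer_carrier C12_eq C23_eq C123_eq using c k by (simp_all add: module_mat_simps)
qed

end

section \<open>Coordinates in the triple tensor product\<close>

lemma kron_mult_vec:
  fixes u :: "complex vec"
  assumes A: "A \<in> carrier_mat m m" and B: "B \<in> carrier_mat r r" and u: "u \<in> carrier_vec (m * r)"
    and ij: "i < m" "j < r"
  shows "(kron A B *\<^sub>v u) $ (i * r + j) = (\<Sum>i'<m. \<Sum>j'<r. A $$ (i, i') * B $$ (j, j') * u $ (i' * r + j'))"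
proof -
  have lt: "i * r + j < m * r" by (rule index_lt[OF ij])
  have "(kron A B *\<^sub>v u) $ (i * r + j)
      = (\<Sum>t<m * r. A $$ (i, t div r) * B $$ (j, t mod r) * u $ (t div r * r + t mod r))"
    using A B u ij lt by (auto simp: kron_def scalar_prod_def atLeast0LessThan intro!: sum.cong)
  also have "\<dots> = (\<Sum>i'<m. \<Sum>j'<r. A $$ (i, i') * B $$ (j, j') * u $ (i' * r + j'))"
    by (rule sum_prod_nat)
  finally show ?thesis .
qed

lemma kron_one_right_vec:
  fixes u :: "complex vec"
  assumes A: "A \<in> carrier_mat m m" and u: "u \<in> carrier_vec (m * r)" and ij: "i < m" "j < r"
  shows "(kron A (1\<^sub>m r) *\<^sub>v u) $ (i * r + j) = (A *\<^sub>v vec m (\<lambda>i'. u $ (i' * r + j))) $ i"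
proof -
  have "(\<Sum>j'<r. A $$ (i, i') * 1\<^sub>m r $$ (j, j') * u $ (i' * r + j')) = A $$ (i, i') * u $ (i' * r + j)" for i'
  proof -
    have "(\<Sum>j'<r. A $$ (i, i') * 1\<^sub>m r $$ (j, j') * u $ (i' * r + j'))
        = (\<Sum>j'<r. if j' = j then A $$ (i, i') * u $ (i' * r + j) else 0)"
      using ij by (intro sum.cong) auto
    then show ?thesis using ij by simp
  qed
  then show ?thesis
    using A ij by (simp add: kron_mult_vec[OF A one_carrier_mat u ij] scalar_prod_def atLeast0LessThan)
qed

lemma kron_one_left_vec:
  fixes u :: "complex vec"
  assumes B: "B \<in> carrier_mat r r" and u: "u \<in> carrier_vec (m * r)" and ij: "i < m" "j < r"
  shows "(kron (1\<^sub>m m) B *\<^sub>v u) $ (i * r + j) = (B *\<^sub>v vec r (\<lambda>j'. u $ (i * r + j'))) $ j"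
proof -
  have "(\<Sum>i'<m. \<Sum>j'<r. 1\<^sub>m m $$ (i, i') * B $$ (j, j') * u $ (i' * r + j'))
      = (\<Sum>i'<m. if i' = i then (\<Sum>j'<r. B $$ (j, j') * u $ (i * r + j')) else 0)"
    using ij by (intro sum.cong) auto
  then show ?thesis
    using B ij by (simp add: kron_mult_vec[OF one_carrier_mat B u ij] scalar_prod_def atLeast0LessThan)
qed

locale spin_module = spin_pair +
  fixes s :: complex
  assumes s2: "s\<^sup>2 = q"
begin

lemma qd: "q - inverse q \<noteq> 0"
  using w_nonzero by (simp add: p_def)

lemma s0: "s \<noteq> 0"
  using s2 q0 by auto

definition N where "N = (n + 1) * 2 * 2"
abbreviation "sa \<equiv> slot1 q s n"
abbreviation "sb \<equiv> slot2 q s n"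
abbreviation "sc \<equiv> slot3 q s n"

text \<open>Coordinates in the tensor basis: i counts applications of F to the highest weight vector
  of spin n/2, while j and k are 0 for spin up and 1 for spin down.\<close>

definition co :: "complex vec \<Rightarrow> nat \<Rightarrow> nat \<Rightarrow> nat \<Rightarrow> complex" where
  "co u i j k = u $ ((i * 2 + j) * 2 + k)"

definition V :: "(nat \<Rightarrow> nat \<Rightarrow> nat \<Rightarrow> complex) \<Rightarrow> complex vec" where
  "V U = vec N (\<lambda>t. U (t div 2 div 2) (t div 2 mod 2) (t mod 2))"

lemma ix_lt: "i < n + 1 \<Longrightarrow> j < 2 \<Longrightarrow> k < 2 \<Longrightarrow> (i * 2 + j) * 2 + k < N"
  unfolding N_def by (intro index_lt)

lemma V_carrier [simp]: "V U \<in> carrier_vec N"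
  by (simp add: V_def)

lemma co_V [simp]: "i < n + 1 \<Longrightarrow> j < 2 \<Longrightarrow> k < 2 \<Longrightarrow> co (V U) i j k = U i j k"
proof -
  assume ijk: "i < n + 1" "j < 2" "k < 2"
  have "(a * 2 + k) div 2 = a" "(a * 2 + k) mod 2 = k" if "k < 2" for a k :: nat using that by presburger+
  note e = this[OF ijk(2)] this[OF ijk(3)]
  show ?thesis unfolding co_def V_def by (simp only: index_vec[OF ix_lt[OF ijk]] e)
qed

lemma vec_eqI_co:
  assumes "u \<in> carrier_vec N" "w \<in> carrier_vec N"
    and "\<And>i j k. i < n + 1 \<Longrightarrow> j < 2 \<Longrightarrow> k < 2 \<Longrightarrow> co u i j k = co w i j k"
  shows "u = w"
proof (rule eq_vecI)
  fix t assume "t < dim_vec w"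
  then have t: "t < N" using assms(2) by simp
  then have "t div 2 div 2 < n + 1" "t div 2 mod 2 < 2" "t mod 2 < 2"
    unfolding N_def by (auto simp: less_mult_imp_div_less)
  from assms(3)[OF this] show "u $ t = w $ t"
    unfolding co_def by (simp only: div_mult_mod_eq)
qed (use assms in simp)

lemma co_add:
  assumes "u \<in> carrier_vec N" "w \<in> carrier_vec N" "i < n + 1" "j < 2" "k < 2"
  shows "co (u + w) i j k = co u i j k + co w i j k" "co (u - w) i j k = co u i j k - co w i j k"
  using assms ix_lt[of i j k] by (simp_all add: co_def)

lemma co_smult:
  assumes "u \<in> carrier_vec N" "i < n + 1" "j < 2" "k < 2"
  shows "co (c \<cdot>\<^sub>v u) i j k = c * co u i j k"
  using assms ix_lt[of i j k] by (simp add: co_def)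

lemma co_zero:
  assumes "i < n + 1" "j < 2" "k < 2"
  shows "co (0\<^sub>v N) i j k = 0"
  using assms ix_lt[of i j k] by (simp add: co_def)

lemmas co_lin = co_add co_smult co_zero

lemma slot_mat:
  "sa g \<in> carrier_mat N N" "sb g \<in> carrier_mat N N" "sc g \<in> carrier_mat N N"
  using slot_closed[OF q0 qd s2, of n g] by (simp_all only: module_mat_simps N_def)

lemma co_slot:
  assumes u: "u \<in> carrier_vec N" and ijk: "i < n + 1" "j < 2" "k < 2"
  shows "co (sa g *\<^sub>v u) i j k = (spin_mat q s n g *\<^sub>v vec (n + 1) (\<lambda>i'. co u i' j k)) $ i"
    "co (sb g *\<^sub>v u) i j k = (spin_mat q s 1 g *\<^sub>v vec (1 + 1) (\<lambda>j'. co u i j' k)) $ j"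
    "co (sc g *\<^sub>v u) i j k = (spin_mat q s 1 g *\<^sub>v vec (1 + 1) (\<lambda>k'. co u i j k')) $ k"
proof -
  note d = q0 qd s2
  note u = u[unfolded N_def]
  have m: "spin_mat q s n g \<in> carrier_mat (n + 1) (n + 1)" "spin_mat q s 1 g \<in> carrier_mat 2 2"
    using spin_mat_closed[of q s n g] spin_mat_closed[of q s 1 g] by (simp_all add: numeral_2_eq_2)
  have ij: "i * 2 + j < (n + 1) * 2" by (rule index_lt[OF ijk(1,2)])
  let ?v = "vec ((n + 1) * 2) (\<lambda>t. u $ (t * 2 + k))"
  have v: "?v \<in> carrier_vec ((n + 1) * 2)" by simp
  have vv: "?v $ (i' * 2 + j') = co u i' j' k" if "i' < n + 1" "j' < 2" for i' j'
    using index_lt[OF that] by (simp add: co_def)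
  have "co (sa g *\<^sub>v u) i j k = (kron (spin_mat q s n g) (1\<^sub>m 2) *\<^sub>v ?v) $ (i * 2 + j)"
    unfolding co_def slot1_def[OF d]
    by (rule kron_one_right_vec[OF kron_carrier[OF m(1) one_carrier_mat] u ij ijk(3)])
  also have "\<dots> = (spin_mat q s n g *\<^sub>v vec (n + 1) (\<lambda>i'. ?v $ (i' * 2 + j))) $ i"
    by (rule kron_one_right_vec[OF m(1) v ijk(1,2)])
  also have "vec (n + 1) (\<lambda>i'. ?v $ (i' * 2 + j)) = vec (n + 1) (\<lambda>i'. co u i' j k)"
  proof (rule eq_vecI)
    fix t assume "t < dim_vec (vec (n + 1) (\<lambda>i'. co u i' j k))"
    then have t: "t < n + 1" by simp
    show "vec (n + 1) (\<lambda>i'. ?v $ (i' * 2 + j)) $ t = vec (n + 1) (\<lambda>i'. co u i' j k) $ t"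
      unfolding index_vec[OF t] by (rule vv[OF t ijk(2)])
  qed simp
  finally show "co (sa g *\<^sub>v u) i j k = (spin_mat q s n g *\<^sub>v vec (n + 1) (\<lambda>i'. co u i' j k)) $ i" .
  have "co (sb g *\<^sub>v u) i j k = (kron (1\<^sub>m (n + 1)) (spin_mat q s 1 g) *\<^sub>v ?v) $ (i * 2 + j)"
    unfolding co_def slot2_def[OF d]
    by (rule kron_one_right_vec[OF kron_carrier[OF one_carrier_mat m(2)] u ij ijk(3)])
  also have "\<dots> = (spin_mat q s 1 g *\<^sub>v vec 2 (\<lambda>j'. ?v $ (i * 2 + j'))) $ j"
    by (rule kron_one_left_vec[OF m(2) v ijk(1,2)])
  also have "vec 2 (\<lambda>j'. ?v $ (i * 2 + j')) = vec (1 + 1) (\<lambda>j'. co u i j' k)"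
  proof (rule eq_vecI)
    fix t assume "t < dim_vec (vec (1 + 1) (\<lambda>j'. co u i j' k))"
    then have t: "t < 2" "t < 1 + 1" by simp_all
    show "vec 2 (\<lambda>j'. ?v $ (i * 2 + j')) $ t = vec (1 + 1) (\<lambda>j'. co u i j' k) $ t"
      unfolding index_vec[OF t(1)] index_vec[OF t(2)] by (rule vv[OF ijk(1) t(1)])
  qed simp
  finally show "co (sb g *\<^sub>v u) i j k = (spin_mat q s 1 g *\<^sub>v vec (1 + 1) (\<lambda>j'. co u i j' k)) $ j" .
  have "co (sc g *\<^sub>v u) i j k = (spin_mat q s 1 g *\<^sub>v vec 2 (\<lambda>k'. u $ ((i * 2 + j) * 2 + k'))) $ k"
    unfolding co_def slot3_def[OF d]
    by (rule kron_one_left_vec[OF m(2) u ij ijk(3)])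
  then show "co (sc g *\<^sub>v u) i j k = (spin_mat q s 1 g *\<^sub>v vec (1 + 1) (\<lambda>k'. co u i j k')) $ k"
    by (simp add: co_def numeral_2_eq_2)
qed

text \<open>The eigenvalues of q^H on the basis vectors of spin n/2; \<open>sg\<close> plays the
  same part for spin 1/2.\<close>

definition ka :: "nat \<Rightarrow> complex" where "ka i = s powi (int n - 2 * int i)"
definition sg :: "nat \<Rightarrow> complex" where "sg j = (if j = 0 then s else inverse s)"

lemma ka_nonzero [simp]: "ka i \<noteq> 0" and sg_nonzero [simp]: "sg j \<noteq> 0"
  using s0 by (simp_all add: ka_def sg_def)

lemma qnum_1: "qnum q 1 = 1"
  using qd by (simp add: qnum_def)

lemma spin1_vec:
  assumes "j < 2"
  shows "(spin_mat q s 1 UE *\<^sub>v vec (1 + 1) f) $ j = (if j = 0 then f 1 else 0)"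
    "(spin_mat q s 1 UF *\<^sub>v vec (1 + 1) f) $ j = (if j = 1 then f 0 else 0)"
    "(spin_mat q s 1 UQ *\<^sub>v vec (1 + 1) f) $ j = sg j * f j"
    "(spin_mat q s 1 UQi *\<^sub>v vec (1 + 1) f) $ j = inverse (sg j) * f j"
proof -
  have w: "vec (1 + 1) f \<in> carrier_vec (1 + 1)" "j < 1 + 1" using assms by auto
  consider "j = 0" | "j = 1" using assms by linarith
  then show "(spin_mat q s 1 UE *\<^sub>v vec (1 + 1) f) $ j = (if j = 0 then f 1 else 0)"
    "(spin_mat q s 1 UF *\<^sub>v vec (1 + 1) f) $ j = (if j = 1 then f 0 else 0)"
    "(spin_mat q s 1 UQ *\<^sub>v vec (1 + 1) f) $ j = sg j * f j"
    "(spin_mat q s 1 UQi *\<^sub>v vec (1 + 1) f) $ j = inverse (sg j) * f j"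
    unfolding spin_mat_vec[OF w] using qnum_1
    by (cases; simp add: sg_def power_int_minus)+
qed

lemma co_slots:
  assumes u: "u \<in> carrier_vec N" and ijk: "i < n + 1" "j < 2" "k < 2"
  shows
    "co (sa UE *\<^sub>v u) i j k = (if i < n then qnum q (i + 1) * qnum q (n - i) * co u (i + 1) j k else 0)"
    "co (sa UF *\<^sub>v u) i j k = (if i > 0 then co u (i - 1) j k else 0)"
    "co (sa UQ *\<^sub>v u) i j k = ka i * co u i j k"
    "co (sa UQi *\<^sub>v u) i j k = inverse (ka i) * co u i j k"
    "co (sb UE *\<^sub>v u) i j k = (if j = 0 then co u i 1 k else 0)"
    "co (sb UF *\<^sub>v u) i j k = (if j = 1 then co u i 0 k else 0)"
    "co (sb UQ *\<^sub>v u) i j k = sg j * co u i j k"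
    "co (sb UQi *\<^sub>v u) i j k = inverse (sg j) * co u i j k"
    "co (sc UE *\<^sub>v u) i j k = (if k = 0 then co u i j 1 else 0)"
    "co (sc UF *\<^sub>v u) i j k = (if k = 1 then co u i j 0 else 0)"
    "co (sc UQ *\<^sub>v u) i j k = sg k * co u i j k"
    "co (sc UQi *\<^sub>v u) i j k = inverse (sg k) * co u i j k"
  unfolding co_slot[OF u ijk] spin1_vec[OF ijk(2)] spin1_vec[OF ijk(3)]
proof -
  have w: "vec (n + 1) (\<lambda>i'. co u i' j k) \<in> carrier_vec (n + 1)" by simp
  have e: "s powi (2 * int i - int n) = inverse (s powi (int n - 2 * int i))"
    by (simp add: power_int_minus[symmetric])
  show "(spin_mat q s n UE *\<^sub>v vec (n + 1) (\<lambda>i'. co u i' j k)) $ i = (if i < n then qnum q (i + 1) * qnum q (n - i) * co u (i + 1) j k else 0)"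
    "(spin_mat q s n UF *\<^sub>v vec (n + 1) (\<lambda>i'. co u i' j k)) $ i = (if i > 0 then co u (i - 1) j k else 0)"
    "(spin_mat q s n UQ *\<^sub>v vec (n + 1) (\<lambda>i'. co u i' j k)) $ i = ka i * co u i j k"
    "(spin_mat q s n UQi *\<^sub>v vec (n + 1) (\<lambda>i'. co u i' j k)) $ i = inverse (ka i) * co u i j k"
    unfolding spin_mat_vec[OF w ijk(1)] e ka_def using ijk by auto
qed (rule refl)+

definition "d12 = delta12 q s n"
definition "d23 = delta23 q s n"
definition "d123 = delta123 q s n"

lemmas delta_mat = unital_algebra.delta_def[OF unital_algebra_mat] module_mat_simps uq_gen.case

lemma d_eqs:
  "d12 UE = sa UE * sb UQi + sa UQ * sb UE" "d12 UF = sa UF * sb UQi + sa UQ * sb UF"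
  "d12 UQ = sa UQ * sb UQ" "d12 UQi = sa UQi * sb UQi"
  "d23 UE = sb UE * sc UQi + sb UQ * sc UE" "d23 UF = sb UF * sc UQi + sb UQ * sc UF"
  "d23 UQ = sb UQ * sc UQ" "d23 UQi = sb UQi * sc UQi"
  "d123 UE = d12 UE * sc UQi + d12 UQ * sc UE" "d123 UF = d12 UF * sc UQi + d12 UQ * sc UF"
  "d123 UQ = d12 UQ * sc UQ" "d123 UQi = d12 UQi * sc UQi"
  unfolding d12_def d23_def d123_def delta_mat by (rule refl)+

lemma d_carrier:
  "d12 g \<in> carrier_mat N N" "d23 g \<in> carrier_mat N N" "d123 g \<in> carrier_mat N N"
proof -
  interpret M: unital_algebra "mat_alg ((n + 1) * 2 * 2)" by (rule unital_algebra_mat)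
  note c = slot_closed[OF q0 qd s2]
  have "d12 g \<in> carrier (mat_alg ((n + 1) * 2 * 2))" "d23 g \<in> carrier (mat_alg ((n + 1) * 2 * 2))"
    "d123 g \<in> carrier (mat_alg ((n + 1) * 2 * 2))"
    unfolding d12_def d23_def d123_def by (intro M.delta_closed c)+
  then show "d12 g \<in> carrier_mat N N" "d23 g \<in> carrier_mat N N" "d123 g \<in> carrier_mat N N"
    by (simp_all only: module_mat_simps N_def)
qed

lemma add_mult_vec: "A \<in> carrier_mat N N \<Longrightarrow> B \<in> carrier_mat N N \<Longrightarrow> u \<in> carrier_vec N \<Longrightarrow> (A + B) *\<^sub>v u = A *\<^sub>v u + B *\<^sub>v (u :: complex vec)"
  by (rule add_mult_distrib_mat_vec)

lemma mult_mult_vec: "A \<in> carrier_mat N N \<Longrightarrow> B \<in> carrier_mat N N \<Longrightarrow> u \<in> carrier_vec N \<Longrightarrow> (A * B) *\<^sub>v u = A *\<^sub>v (B *\<^sub>v (u :: complex vec))"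
  by (rule assoc_mult_mat_vec)

lemma smult_mult_vec: "A \<in> carrier_mat N N \<Longrightarrow> u \<in> carrier_vec N \<Longrightarrow> (c \<cdot>\<^sub>m A) *\<^sub>v u = c \<cdot>\<^sub>v (A *\<^sub>v (u :: complex vec))"
  by (intro eq_vecI) (auto simp: scalar_prod_def sum_distrib_left mult_ac)

lemma NN_closed:
  "A \<in> carrier_mat N N \<Longrightarrow> B \<in> carrier_mat N N \<Longrightarrow> A * B \<in> carrier_mat N N"
  "A \<in> carrier_mat N N \<Longrightarrow> B \<in> carrier_mat N N \<Longrightarrow> A + B \<in> carrier_mat N N"
  "A \<in> carrier_mat N N \<Longrightarrow> c \<cdot>\<^sub>m A \<in> carrier_mat N N"
  "A \<in> carrier_mat N N \<Longrightarrow> u \<in> carrier_vec N \<Longrightarrow> A *\<^sub>v u \<in> carrier_vec N"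
  for A B :: "complex mat"
  by (rule mult_carrier_mat add_carrier_mat smult_carrier_mat mult_mat_vec_carrier; assumption)+

lemmas slot_calc = add_mult_vec mult_mult_vec smult_mult_vec NN_closed slot_mat d_carrier

lemma co_delta12:
  assumes u: "u \<in> carrier_vec N" and ijk: "i < n + 1" "j < 2" "k < 2"
  shows "co (d12 UE *\<^sub>v u) i j k = (if i < n then qnum q (i + 1) * qnum q (n - i) * (inverse (sg j) * co u (i + 1) j k) else 0)
      + ka i * (if j = 0 then co u i 1 k else 0)"
    "co (d12 UF *\<^sub>v u) i j k = (if i > 0 then inverse (sg j) * co u (i - 1) j k else 0)
      + ka i * (if j = 1 then co u i 0 k else 0)"
    "co (d12 UQ *\<^sub>v u) i j k = ka i * (sg j * co u i j k)"
    "co (d12 UQi *\<^sub>v u) i j k = inverse (ka i) * (inverse (sg j) * co u i j k)"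
  using u ijk by (simp_all add: d_eqs(1-8) slot_calc co_lin co_slots del: One_nat_def)

lemma co_delta23:
  assumes u: "u \<in> carrier_vec N" and ijk: "i < n + 1" "j < 2" "k < 2"
  shows "co (d23 UE *\<^sub>v u) i j k = (if j = 0 then inverse (sg k) * co u i 1 k else 0)
      + sg j * (if k = 0 then co u i j 1 else 0)"
    "co (d23 UF *\<^sub>v u) i j k = (if j = 1 then inverse (sg k) * co u i 0 k else 0)
      + sg j * (if k = 1 then co u i j 0 else 0)"
    "co (d23 UQ *\<^sub>v u) i j k = sg j * (sg k * co u i j k)"
    "co (d23 UQi *\<^sub>v u) i j k = inverse (sg j) * (inverse (sg k) * co u i j k)"
  using u ijk by (simp_all add: d_eqs(1-8) slot_calc co_lin co_slots del: One_nat_def)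

lemma co_delta123:
  assumes u: "u \<in> carrier_vec N" and ijk: "i < n + 1" "j < 2" "k < 2"
  shows "co (d123 UE *\<^sub>v u) i j k = (if i < n then qnum q (i + 1) * qnum q (n - i) * (inverse (sg j) * (inverse (sg k) * co u (i + 1) j k)) else 0)
      + ka i * (if j = 0 then inverse (sg k) * co u i 1 k else 0) + ka i * (sg j * (if k = 0 then co u i j 1 else 0))"
    "co (d123 UF *\<^sub>v u) i j k = (if i > 0 then inverse (sg j) * (inverse (sg k) * co u (i - 1) j k) else 0)
      + ka i * (if j = 1 then inverse (sg k) * co u i 0 k else 0) + ka i * (sg j * (if k = 1 then co u i j 0 else 0))"
    "co (d123 UQ *\<^sub>v u) i j k = ka i * (sg j * (sg k * co u i j k))"
    "co (d123 UQi *\<^sub>v u) i j k = inverse (ka i) * (inverse (sg j) * (inverse (sg k) * co u i j k))"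
  using u ijk by (simp_all add: d_eqs(9-12) slot_calc co_lin co_slots co_delta12 distrib_left del: One_nat_def)

lemma co_cas:
  assumes u: "u \<in> carrier_vec N" and ijk: "i < n + 1" "j < 2" "k < 2"
    and h: "\<And>g. h g \<in> carrier_mat N N"
  shows "co (unital_algebra.cas (mat_alg N) q h *\<^sub>v u) i j k
    = (q - p)\<^sup>2 * co (h UF *\<^sub>v (h UE *\<^sub>v u)) i j k + q * co (h UQ *\<^sub>v (h UQ *\<^sub>v u)) i j k
      + p * co (h UQi *\<^sub>v (h UQi *\<^sub>v u)) i j k"
  using u ijk by (simp add: unital_algebra.cas_def[OF unital_algebra_mat] module_mat_simps slot_calc h co_lin p_def)

section \<open>Highest weight vectors\<close>

lemma qnum_nz: "k > 0 \<Longrightarrow> qnum q k \<noteq> 0"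
  using qnum_nonzero(2)[OF q0 q1] by blast

text \<open>No weight is prescribed, so this space is the sum of the highest weight spaces for the
  three total spins.\<close>

definition hw :: "complex vec \<Rightarrow> bool" where
  "hw u \<longleftrightarrow> u \<in> carrier_vec N \<and> d123 UE *\<^sub>v u = 0\<^sub>v N"

lemma vec_diff_zero:
  assumes "u \<in> carrier_vec N" "w \<in> carrier_vec N" "u - w = 0\<^sub>v N"
  shows "u = (w :: complex vec)"
proof (rule eq_vecI)
  fix t assume "t < dim_vec w"
  then show "u $ t = w $ t" using arg_cong[OF assms(3), of "\<lambda>v. v $ t"] assms(1,2) by simp
qed (use assms in simp)

lemma vec_smult_zero:
  assumes "u \<in> carrier_vec N" "c \<cdot>\<^sub>v u = 0\<^sub>v N" "c \<noteq> (0 :: complex)"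
  shows "u = 0\<^sub>v N"
proof (rule eq_vecI)
  fix t assume "t < dim_vec (0\<^sub>v N :: complex vec)"
  then show "u $ t = 0\<^sub>v N $ t" using arg_cong[OF assms(2), of "\<lambda>v. v $ t"] assms(1,3) by simp
qed (use assms in simp)

text \<open>In the (i, j, k) coordinate of E u = 0 the entry at level i + 1 appears with the nonzero
  coefficient [i+1][n-i], and all other entries are at level i. So level 0 determines u.\<close>

lemma hw_zero:
  assumes u: "hw u" and 0: "\<And>j k. j < 2 \<Longrightarrow> k < 2 \<Longrightarrow> co u 0 j k = 0"
  shows "u = 0\<^sub>v N"
proof -
  have uc: "u \<in> carrier_vec N" using u by (simp add: hw_def)
  have "\<forall>j<2. \<forall>k<2. co u i j k = 0" if "i < n + 1" for i
    using that
  proof (induction i)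
    case (Suc i)
    show ?case
    proof (intro allI impI)
      fix j k :: nat assume jk: "j < 2" "k < 2"
      have i: "i < n + 1" "i < n" using Suc.prems by auto
      have "co (d123 UE *\<^sub>v u) i j k = 0"
        using u i jk by (simp add: hw_def co_zero)
      moreover have "co u i 1 k = 0" "co u i j 1 = 0" using Suc.IH[OF i(1)] jk by auto
      ultimately have "qnum q (i + 1) * qnum q (n - i) * (inverse (sg j) * (inverse (sg k) * co u (i + 1) j k)) = 0"
        using i(2) unfolding co_delta123[OF uc i(1) jk] by (simp split: if_splits del: One_nat_def)
      then show "co u (Suc i) j k = 0" using qnum_nz[of "i + 1"] qnum_nz[of "n - i"] i(2) by simp
    qed
  qed (use 0 in blast)
  then show ?thesis
    by (intro vec_eqI_co[OF uc]) (simp_all add: co_zero)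
qed

lemma hw_lin: "hw u \<Longrightarrow> hw w \<Longrightarrow> hw (u + w)" "hw u \<Longrightarrow> hw (c \<cdot>\<^sub>v u)" "hw u \<Longrightarrow> hw w \<Longrightarrow> hw (u - w)"
proof -
  have E: "d123 UE \<in> carrier_mat N N" by (rule d_carrier)
  show "hw u \<Longrightarrow> hw w \<Longrightarrow> hw (u + w)"
    unfolding hw_def using mult_add_distrib_mat_vec[OF E, of u w] by auto
  show "hw u \<Longrightarrow> hw (c \<cdot>\<^sub>v u)"
    unfolding hw_def using mult_mat_vec[OF E, of u c] by auto
  show "hw u \<Longrightarrow> hw w \<Longrightarrow> hw (u - w)"
    unfolding hw_def using mult_minus_distrib_mat_vec[OF E, of u w] by auto
qed

text \<open>The recursion read off from E u = 0, solved with an arbitrary start at level 0.\<close>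

primrec hwf :: "(nat \<Rightarrow> nat \<Rightarrow> complex) \<Rightarrow> nat \<Rightarrow> nat \<Rightarrow> nat \<Rightarrow> complex" where
  "hwf f 0 = f"
| "hwf f (Suc i) = (\<lambda>j k. - (ka i * (sg j * sg k)) / (qnum q (i + 1) * qnum q (n - i))
     * ((if j = 0 then inverse (sg k) * hwf f i 1 k else 0) + sg j * (if k = 0 then hwf f i j 1 else 0)))"

text \<open>Each step of the recursion takes its entries from positions with one more spin down, and
  at most two are available. After two steps only the position (0, 0) can be nonzero.\<close>

lemma hwf_vanish:
  "j < 2 \<Longrightarrow> k < 2 \<Longrightarrow> (j, k) \<noteq> (0, 0) \<Longrightarrow> hwf f (Suc (Suc i)) j k = 0"
proof -
  have 1: "hwf f (Suc i) 1 1 = 0" for i by simp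
  assume "j < 2" "k < 2" "(j, k) \<noteq> (0, 0)"
  then consider "j = 0" "k = 1" | "j = 1" "k = 0" | "j = 1" "k = 1" by fastforce
  then show ?thesis by cases (simp_all only: hwf.simps(2)[of f "Suc i"] 1, simp_all)
qed

definition hv :: "(nat \<Rightarrow> nat \<Rightarrow> complex) \<Rightarrow> complex vec" where
  "hv f = V (hwf f)"

lemma hv_carrier [simp]: "hv f \<in> carrier_vec N"
  by (simp add: hv_def)

lemma co_hv: "i < n + 1 \<Longrightarrow> j < 2 \<Longrightarrow> k < 2 \<Longrightarrow> co (hv f) i j k = hwf f i j k"
  by (simp add: hv_def)

text \<open>For i below n the recursion was made to cancel. At i = n there is no further entry to
  solve for, and the equation holds because n is at least 2, where \<open>hwf_vanish\<close> has
  taken effect.\<close>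

lemma hw_hv: "hw (hv f)"
proof -
  have "d123 UE *\<^sub>v hv f = 0\<^sub>v N"
  proof (rule vec_eqI_co)
    fix i j k assume ijk: "i < n + 1" "j < (2::nat)" "k < (2::nat)"
    have two: "(1::nat) < 2" by simp
    have z: "co (0\<^sub>v N) i j k = 0" by (rule co_zero[OF ijk])
    note c = co_delta123(1)[OF hv_carrier[of f] ijk] co_hv[OF ijk(1) two ijk(3)] co_hv[OF ijk(1,2) two]
    show "co (d123 UE *\<^sub>v hv f) i j k = co (0\<^sub>v N) i j k"
    proof (cases "i < n")
      case True
      let ?Q = "qnum q (i + 1) * qnum q (n - i)"
      define W where "W = (if j = 0 then inverse (sg k) * hwf f i 1 k else 0) + sg j * (if k = 0 then hwf f i j 1 else 0)"
      have Q: "?Q \<noteq> 0" using qnum_nz True by simp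
      have i1: "i + 1 < n + 1" using True by simp
      have h1: "co (hv f) (i + 1) j k = - (ka i * (sg j * sg k)) / ?Q * W"
      proof -
        have "co (hv f) (i + 1) j k = hwf f (Suc i) j k" using co_hv[OF i1 ijk(2,3)] by simp
        then show ?thesis by (simp only: hwf.simps(2) W_def)
      qed
      have "co (d123 UE *\<^sub>v hv f) i j k = ?Q * (inverse (sg j) * (inverse (sg k) * co (hv f) (i + 1) j k)) + ka i * W"
        unfolding c W_def by (simp only: True if_True distrib_left add.assoc)
      also have "?Q * (inverse (sg j) * (inverse (sg k) * co (hv f) (i + 1) j k)) = - (ka i * W)"
        unfolding h1 using Q by (simp add: field_simps)
      finally show ?thesis unfolding z by simp
    next
      case False
      then have "i = n" using ijk(1) by simp
      then obtain m where i: "i = Suc (Suc m)" using n2 by (metis Suc_le_D numeral_2_eq_2 Suc_le_mono)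
      have "hwf f i 1 k = 0" "hwf f i j 1 = 0"
        unfolding i using hwf_vanish[of 1 k f m] hwf_vanish[of j 1 f m] ijk by auto
      then show ?thesis unfolding c z using False by auto
    qed
  qed (auto intro!: NN_closed d_carrier)
  then show ?thesis by (simp add: hw_def)
qed

definition ee :: "nat \<Rightarrow> nat \<Rightarrow> nat \<Rightarrow> nat \<Rightarrow> complex" where
  "ee c d j k = (if j = c \<and> k = d then 1 else 0)"

abbreviation "w00 \<equiv> hv (ee 0 0)"
abbreviation "w01 \<equiv> hv (ee 0 1)"
abbreviation "w10 \<equiv> hv (ee 1 0)"
abbreviation "w11 \<equiv> hv (ee 1 1)"

lemma co_w: "j < 2 \<Longrightarrow> k < 2 \<Longrightarrow> co (hv (ee c d)) 0 j k = (if j = c \<and> k = d then 1 else 0)"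
  by (simp add: co_hv ee_def)

lemma two_cases: "(i :: nat) < 2 \<Longrightarrow> i = 0 \<or> i = 1"
  by linarith

text \<open>Both sides are highest weight vectors with the same level 0 coordinates, so
  \<open>hw_zero\<close> applies to the difference.\<close>

lemma hw_expand:
  assumes "hw u"
  shows "u = co u 0 0 0 \<cdot>\<^sub>v w00 + co u 0 0 1 \<cdot>\<^sub>v w01 + co u 0 1 0 \<cdot>\<^sub>v w10 + co u 0 1 1 \<cdot>\<^sub>v w11" (is "u = ?r")
proof -
  have u: "u \<in> carrier_vec N" using assms by (simp add: hw_def)
  have r: "?r \<in> carrier_vec N" by simp
  have "u - ?r = 0\<^sub>v N"
  proof (rule hw_zero)
    show "hw (u - ?r)" by (intro hw_lin assms hw_hv)
    fix j k assume jk: "j < (2::nat)" "k < (2::nat)"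
    have z: "0 < n + 1" by simp
    show "co (u - ?r) 0 j k = 0"
      using two_cases[OF jk(1)] two_cases[OF jk(2)] u
      by (elim disjE) (simp_all add: co_lin co_w del: One_nat_def)
  qed
  then show ?thesis by (rule vec_diff_zero[OF u r])
qed

section \<open>The action of the centralizer on highest weight vectors\<close>

definition cen :: "complex mat \<Rightarrow> bool" where
  "cen m \<longleftrightarrow> m \<in> carrier_mat N N \<and> (\<forall>g. d123 g * m = m * d123 g)"

lemma cenD: "cen m \<Longrightarrow> m \<in> carrier_mat N N" "cen m \<Longrightarrow> d123 g * m = m * d123 g"
  "cen m \<Longrightarrow> u \<in> carrier_vec N \<Longrightarrow> d123 g *\<^sub>v (m *\<^sub>v u) = m *\<^sub>v (d123 g *\<^sub>v u)"
proof -
  show 1: "cen m \<Longrightarrow> m \<in> carrier_mat N N" "cen m \<Longrightarrow> d123 g * m = m * d123 g" by (auto simp: cen_def)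
  assume m: "cen m" "u \<in> carrier_vec N"
  note c = 1(1)[OF m(1)]
  have "d123 g *\<^sub>v (m *\<^sub>v u) = (d123 g * m) *\<^sub>v u" by (rule mult_mult_vec[symmetric, OF d_carrier(3) c m(2)])
  also have "\<dots> = m *\<^sub>v (d123 g *\<^sub>v u)" unfolding 1(2)[OF m(1)] by (rule mult_mult_vec[OF c d_carrier(3) m(2)])
  finally show "d123 g *\<^sub>v (m *\<^sub>v u) = m *\<^sub>v (d123 g *\<^sub>v u)" .
qed

lemma hw_cen:
  assumes m: "cen m" and u: "hw u"
  shows "hw (m *\<^sub>v u)"
proof -
  have uc: "u \<in> carrier_vec N" using u by (simp add: hw_def)
  have "m *\<^sub>v 0\<^sub>v N = 0\<^sub>v N" using cenD(1)[OF m] by (intro eq_vecI) (auto simp: scalar_prod_def)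
  then show ?thesis
    using u cenD(3)[OF m uc, of UE] NN_closed(4)[OF cenD(1)[OF m] uc] by (simp add: hw_def)
qed

lemma hw_Q: "hw u \<Longrightarrow> hw (d123 UQ *\<^sub>v u)"
proof -
  assume u: "hw u"
  then have uc: "u \<in> carrier_vec N" by (simp add: hw_def)
  interpret M: unital_algebra "mat_alg ((n + 1) * 2 * 2)" by (rule unital_algebra_mat)
  have "M.triple q d123"
    using triple_image[OF q0 qd s2 unital_algebra_presented unital_algebra_mat triple_generator rep3_comult2(1)[OF q0 qd s2]]
    unfolding rep3_comult2(2)[OF q0 qd s2] d123_def .
  then have QE: "d123 UQ * d123 UE = q \<cdot>\<^sub>m (d123 UE * d123 UQ)"
    unfolding M.triple_def module_mat_simps by blast
  have "q \<cdot>\<^sub>v (d123 UE *\<^sub>v (d123 UQ *\<^sub>v u)) = d123 UQ *\<^sub>v (d123 UE *\<^sub>v u)"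
    using arg_cong[OF QE, of "\<lambda>Z. Z *\<^sub>v u"] uc by (simp add: slot_calc)
  also have "\<dots> = 0\<^sub>v N"
    using u d_carrier(3)[of UQ] by (intro eq_vecI) (auto simp: scalar_prod_def hw_def)
  finally have 0: "q \<cdot>\<^sub>v (d123 UE *\<^sub>v (d123 UQ *\<^sub>v u)) = 0\<^sub>v N" .
  have "d123 UE *\<^sub>v (d123 UQ *\<^sub>v u) = 0\<^sub>v N"
    by (rule vec_smult_zero[OF _ 0 q0]) (intro NN_closed d_carrier uc)
  then show ?thesis using uc by (simp add: hw_def slot_calc)
qed

text \<open>Matrix entries of m on the highest weight space: by \<open>hw_expand\<close> the level 0
  coordinates are the coefficients in the basis \<open>w00\<close>, \<open>w01\<close>,
  \<open>w10\<close>, \<open>w11\<close>.\<close>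

definition r :: "complex mat \<Rightarrow> nat \<Rightarrow> nat \<Rightarrow> nat \<Rightarrow> nat \<Rightarrow> complex" where
  "r m j k c d = co (m *\<^sub>v hv (ee c d)) 0 j k"

lemma Q_w: "d123 UQ *\<^sub>v hv (ee c d) = (ka 0 * (sg c * sg d)) \<cdot>\<^sub>v hv (ee c d)"
proof -
  let ?u = "d123 UQ *\<^sub>v hv (ee c d) - (ka 0 * (sg c * sg d)) \<cdot>\<^sub>v hv (ee c d)"
  have c: "d123 UQ *\<^sub>v hv (ee c d) \<in> carrier_vec N" by (simp add: slot_calc)
  have "?u = 0\<^sub>v N"
  proof (rule hw_zero)
    show "hw ?u" by (intro hw_lin hw_Q hw_hv)
    fix j k assume jk: "j < (2::nat)" "k < (2::nat)"
    have z: "0 < n + 1" by simp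
    show "co ?u 0 j k = 0"
      using c jk by (simp add: co_lin co_delta123(3) co_w)
  qed
  then show ?thesis by (rule vec_diff_zero[OF c, rotated]) simp
qed

text \<open>m commutes with the total q^H and hence preserves the weight, to which j and k
  contribute \<open>sg j * sg k\<close>.\<close>

lemma r_weight:
  assumes m: "cen m" and jk: "j < 2" "k < 2" and ne: "sg j * sg k \<noteq> sg c * sg d"
  shows "r m j k c d = 0"
proof -
  have z: "0 < n + 1" by simp
  note mc = cenD(1)[OF m]
  have mw: "m *\<^sub>v hv (ee c d) \<in> carrier_vec N" by (rule NN_closed(4)[OF mc hv_carrier])
  have "ka 0 * (sg j * (sg k * r m j k c d)) = co (d123 UQ *\<^sub>v (m *\<^sub>v hv (ee c d))) 0 j k"
    unfolding r_def co_delta123(3)[OF mw z jk] ..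
  also have "\<dots> = co ((ka 0 * (sg c * sg d)) \<cdot>\<^sub>v (m *\<^sub>v hv (ee c d))) 0 j k"
    unfolding cenD(3)[OF m hv_carrier] Q_w mult_mat_vec[OF mc hv_carrier] ..
  also have "\<dots> = ka 0 * (sg c * sg d) * r m j k c d"
    unfolding r_def by (rule co_smult[OF mw z jk])
  finally have "ka 0 * ((sg j * sg k - sg c * sg d) * r m j k c d) = 0"
    by (simp add: algebra_simps)
  then show ?thesis using ne by simp
qed

lemma sg_vals: "sg 0 = s" "sg 1 = inverse s" "s * s = q" "inverse s * inverse s = p"
  using s2 by (simp_all add: sg_def p_def power2_eq_square flip: inverse_mult_distrib)

lemma sg_ne: "s * s \<noteq> s * inverse s" "s * s \<noteq> inverse s * inverse s" "s * inverse s \<noteq> inverse s * inverse s"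
proof -
  have "q \<noteq> 1" using q1[of 1] by simp
  moreover have "p \<noteq> 1" using \<open>q \<noteq> 1\<close> unfolding p_def by (metis inverse_1 inverse_inverse_eq)
  moreover have "s * inverse s = 1" using s0 by simp
  ultimately show "s * s \<noteq> s * inverse s" "s * s \<noteq> inverse s * inverse s" "s * inverse s \<noteq> inverse s * inverse s"
    using w_nonzero(2) unfolding sg_vals(3,4) by auto
qed

text \<open>Up to the common factor \<open>ka 0\<close> the four basis vectors have weights q, 1, 1
  and p, which leaves one block of size two and two of size one.\<close>

lemma r_zero:
  assumes m: "cen m"
  shows "r m 0 1 0 0 = 0" "r m 1 0 0 0 = 0" "r m 1 1 0 0 = 0"
    "r m 0 0 0 1 = 0" "r m 1 1 0 1 = 0" "r m 0 0 1 0 = 0" "r m 1 1 1 0 = 0"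
    "r m 0 0 1 1 = 0" "r m 0 1 1 1 = 0" "r m 1 0 1 1 = 0"
  by (rule r_weight[OF m]; use sg_ne sg_ne[symmetric] in \<open>simp add: sg_vals mult.commute[of "inverse s" s] del: One_nat_def\<close>)+

lemma cen_expand:
  assumes m: "cen m"
  shows "m *\<^sub>v w00 = r m 0 0 0 0 \<cdot>\<^sub>v w00"
    "m *\<^sub>v w01 = r m 0 1 0 1 \<cdot>\<^sub>v w01 + r m 1 0 0 1 \<cdot>\<^sub>v w10"
    "m *\<^sub>v w10 = r m 0 1 1 0 \<cdot>\<^sub>v w01 + r m 1 0 1 0 \<cdot>\<^sub>v w10"
    "m *\<^sub>v w11 = r m 1 1 1 1 \<cdot>\<^sub>v w11"
proof -
  have e: "m *\<^sub>v hv (ee c d) = r m 0 0 c d \<cdot>\<^sub>v w00 + r m 0 1 c d \<cdot>\<^sub>v w01 + r m 1 0 c d \<cdot>\<^sub>v w10 + r m 1 1 c d \<cdot>\<^sub>v w11" for c d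
    unfolding r_def by (rule hw_expand[OF hw_cen[OF m hw_hv]])
  have z: "0 \<cdot>\<^sub>v hv f = 0\<^sub>v N" for f by (intro eq_vecI) (auto simp: hv_def V_def)
  show "m *\<^sub>v w00 = r m 0 0 0 0 \<cdot>\<^sub>v w00"
    "m *\<^sub>v w01 = r m 0 1 0 1 \<cdot>\<^sub>v w01 + r m 1 0 0 1 \<cdot>\<^sub>v w10"
    "m *\<^sub>v w10 = r m 0 1 1 0 \<cdot>\<^sub>v w01 + r m 1 0 1 0 \<cdot>\<^sub>v w10"
    "m *\<^sub>v w11 = r m 1 1 1 1 \<cdot>\<^sub>v w11"
    by (subst e, simp add: r_zero[OF m] z del: One_nat_def)+
qed

definition rho_hi :: "complex mat \<Rightarrow> m2" where "rho_hi m = sc2 (r m 0 0 0 0)"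
definition rho_lo :: "complex mat \<Rightarrow> m2" where "rho_lo m = sc2 (r m 1 1 1 1)"
text \<open>Arranged so that the columns are the images of \<open>w01\<close> and
  \<open>w10\<close>; composition in the centralizer then becomes matrix multiplication.\<close>

definition rho_mid :: "complex mat \<Rightarrow> m2" where
  "rho_mid m = M2 (r m 0 1 0 1) (r m 0 1 1 0) (r m 1 0 0 1) (r m 1 0 1 0)"

lemma r_lin:
  assumes "m \<in> carrier_mat N N" "m' \<in> carrier_mat N N" "j < 2" "k < 2"
  shows "r (m + m') j k c d = r m j k c d + r m' j k c d" "r (a \<cdot>\<^sub>m m) j k c d = a * r m j k c d"
  using assms unfolding r_def by (simp_all add: slot_calc co_lin)

lemma r_mult:
  assumes m: "cen m" and m': "cen m'" and jk: "j < 2" "k < 2"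
  shows "r (m * m') j k 0 0 = r m j k 0 0 * r m' 0 0 0 0"
    "r (m * m') j k 0 1 = r m j k 0 1 * r m' 0 1 0 1 + r m j k 1 0 * r m' 1 0 0 1"
    "r (m * m') j k 1 0 = r m j k 0 1 * r m' 0 1 1 0 + r m j k 1 0 * r m' 1 0 1 0"
    "r (m * m') j k 1 1 = r m j k 1 1 * r m' 1 1 1 1"
proof -
  note mc = cenD(1)[OF m]
  have z: "0 < n + 1" by simp
  have e: "(m * m') *\<^sub>v hv f = m *\<^sub>v (m' *\<^sub>v hv f)" for f
    by (rule mult_mult_vec[OF mc cenD(1)[OF m'] hv_carrier])
  have l: "m *\<^sub>v (a \<cdot>\<^sub>v hv f) = a \<cdot>\<^sub>v (m *\<^sub>v hv f)" for a f by (rule mult_mat_vec[OF mc hv_carrier])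
  have l2: "m *\<^sub>v (a \<cdot>\<^sub>v hv f + b \<cdot>\<^sub>v hv f') = a \<cdot>\<^sub>v (m *\<^sub>v hv f) + b \<cdot>\<^sub>v (m *\<^sub>v hv f')" for a f b f'
    unfolding l[symmetric] by (rule mult_add_distrib_mat_vec[OF mc]) simp_all
  have c: "m *\<^sub>v hv f \<in> carrier_vec N" for f by (rule NN_closed(4)[OF mc hv_carrier])
  show "r (m * m') j k 0 0 = r m j k 0 0 * r m' 0 0 0 0"
    "r (m * m') j k 0 1 = r m j k 0 1 * r m' 0 1 0 1 + r m j k 1 0 * r m' 1 0 0 1"
    "r (m * m') j k 1 0 = r m j k 0 1 * r m' 0 1 1 0 + r m j k 1 0 * r m' 1 0 1 0"
    "r (m * m') j k 1 1 = r m j k 1 1 * r m' 1 1 1 1"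
    unfolding r_def[of "m * m'"] e cen_expand[OF m'] l l2 using c jk
    by (simp_all add: co_lin r_def del: One_nat_def)
qed

lemma r_one: "j < 2 \<Longrightarrow> k < 2 \<Longrightarrow> r (1\<^sub>m N) j k c d = (if j = c \<and> k = d then 1 else 0)"
  by (simp add: r_def co_w)

lemma cen_closed:
  "cen (1\<^sub>m N)" "cen m \<Longrightarrow> cen m' \<Longrightarrow> cen (m + m')" "cen m \<Longrightarrow> cen m' \<Longrightarrow> cen (m * m')" "cen m \<Longrightarrow> cen (a \<cdot>\<^sub>m m)"
proof -
  note d = d_carrier(3)
  show "cen (1\<^sub>m N)" unfolding cen_def right_mult_one_mat[OF d] left_mult_one_mat[OF d] by simp
  show "cen (m + m')" if m: "cen m" "cen m'"
  proof -
    note c = cenD(1)[OF m(1)] cenD(1)[OF m(2)]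
    show ?thesis unfolding cen_def mult_add_distrib_mat[OF d c] add_mult_distrib_mat[OF c d]
      using NN_closed(2)[OF c] cenD(2)[OF m(1)] cenD(2)[OF m(2)] by simp
  qed
  show "cen (a \<cdot>\<^sub>m m)" if m: "cen m"
  proof -
    note c = cenD(1)[OF m]
    show ?thesis unfolding cen_def mult_smult_distrib[OF d c] mult_smult_assoc_mat[OF c d]
      using NN_closed(3)[OF c] cenD(2)[OF m] by simp
  qed
  assume m: "cen m" "cen m'"
  note c = cenD(1)[OF m(1)] cenD(1)[OF m(2)]
  have "d123 g * (m * m') = (m * m') * d123 g" for g
  proof -
    have "d123 g * (m * m') = (d123 g * m) * m'" by (rule assoc_mult_mat[symmetric, OF d c])
    also have "\<dots> = m * (d123 g * m')" unfolding cenD(2)[OF m(1)] by (rule assoc_mult_mat[OF c(1) d c(2)])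
    also have "\<dots> = (m * m') * d123 g" unfolding cenD(2)[OF m(2)] by (rule assoc_mult_mat[symmetric, OF c d])
    finally show ?thesis .
  qed
  then show "cen (m * m')" using NN_closed(1)[OF c] by (simp add: cen_def)
qed

lemma rho_hom:
  assumes "cen m" "cen m'"
  shows "rho_hi (m + m') = rho_hi m + rho_hi m'" "rho_lo (m + m') = rho_lo m + rho_lo m'" "rho_mid (m + m') = rho_mid m + rho_mid m'"
    "rho_hi (m * m') = rho_hi m * rho_hi m'" "rho_lo (m * m') = rho_lo m * rho_lo m'" "rho_mid (m * m') = rho_mid m * rho_mid m'"
    "rho_hi (a \<cdot>\<^sub>m m) = sc2 a * rho_hi m" "rho_lo (a \<cdot>\<^sub>m m) = sc2 a * rho_lo m" "rho_mid (a \<cdot>\<^sub>m m) = sc2 a * rho_mid m"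
    "rho_hi (1\<^sub>m N) = 1" "rho_lo (1\<^sub>m N) = 1" "rho_mid (1\<^sub>m N) = 1"
  using cenD(1)[OF assms(1)] cenD(1)[OF assms(2)]
  by (simp_all add: rho_hi_def rho_lo_def rho_mid_def r_lin r_mult[OF assms] r_one sc2_simps sc2_def one_m2_def del: One_nat_def)

lemma C_eqs:
  "C12 q s n 1 1 = unital_algebra.cas (mat_alg N) q d12" "C23 q s n 1 1 = unital_algebra.cas (mat_alg N) q d23"
  "C123 q s n 1 1 = unital_algebra.cas (mat_alg N) q d123"
  unfolding d12_def d23_def d123_def N_def
  by (rule C12_eq[OF q0 qd s2] C23_eq[OF q0 qd s2] C123_eq[OF q0 qd s2])+

lemma centralizer_cen: "m \<in> carrier (centralizer q s n 1 1) \<longleftrightarrow> cen m"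
  unfolding centralizer_carrier[OF q0 qd s2] cen_def N_def d123_def ..

lemma cen_C: "cen (C12 q s n 1 1)" "cen (C23 q s n 1 1)" "cen (C123 q s n 1 1)"
  using cas_in_centralizer[OF q0 qd s2, of n] unfolding centralizer_cen by blast+

text \<open>In squares the root s disappears, and they become monomials in p, q, x and y.\<close>

lemma ka_sq: "ka 0 * ka 0 = p * x" "inverse (ka 0) * inverse (ka 0) = q * y" "ka 1 * ka 1 = p ^ 3 * x"
proof -
  have px: "p * x = q ^ n" using pq unfolding x_def by (simp add: mult.assoc[symmetric] mult.commute)
  have k0: "ka 0 = s ^ n" by (simp add: ka_def)
  have k: "s ^ n * s ^ n = q ^ n" using s2 by (simp add: power_mult_distrib[symmetric] power2_eq_square)
  show 1: "ka 0 * ka 0 = p * x" unfolding k0 k px ..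
  have "(p * x) * (q * y) = 1" by (simp add: mult_ac inverse_pair_simps[OF pq] inverse_pair_simps[OF xy])
  then show "inverse (ka 0) * inverse (ka 0) = q * y"
    unfolding inverse_mult_distrib[symmetric] 1 by (rule inverse_unique)
  have "ka 1 * (s * s) = ka 0"
    unfolding ka_def power_int_add[symmetric] using s0 power_int_add[of s "int n - 2" 2]
    by (simp add: power2_eq_square)
  then have "ka 1 * q = ka 0" unfolding sg_vals .
  then have "ka 1 = p * ka 0" using pq by (metis mult.assoc mult.commute mult_1)
  then have "ka 1 * ka 1 = p * p * (ka 0 * ka 0)" by (simp add: mult_ac)
  then show "ka 1 * ka 1 = p ^ 3 * x" unfolding 1 by (simp add: power3_eq_cube mult_ac)
qed

text \<open>At level 0 the operator F of the first two factors can only turn the second spin down,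
  and the E before it reads a level 1 entry supplied by \<open>hwf\<close>. The contribution of
  \<open>ee c d 1 k\<close> cancels, leaving a single off-diagonal term.\<close>

lemma r_C12:
  assumes jk: "j < 2" "k < 2"
  shows "r (C12 q s n 1 1) j k c d = (x * (sg j * sg j) + y * (inverse (sg j) * inverse (sg j))) * ee c d j k
    - (if j = 1 \<and> k = 0 then h0 * x * ee c d 0 1 else 0)"
proof -
  have z: "0 < n + 1" "(0::nat) < 2" "(1::nat) < 2" by simp_all
  have n: "0 < n" using n2 by simp
  note w = hv_carrier[of "ee c d"]
  have cl: "d12 g *\<^sub>v hv (ee c d) \<in> carrier_vec N" for g by (rule NN_closed(4)[OF d_carrier(1) w])
  have w1: "co (hv (ee c d)) (0 + 1) 0 k = - (ka 0 * (sg 0 * sg k)) / (qnum q (0 + 1) * qnum q (n - 0))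
      * (inverse (sg k) * ee c d 1 k + sg 0 * (if k = 0 then ee c d 0 1 else 0))"
    using co_hv[of 1 0 k "ee c d"] n jk by simp
  have Q: "qnum q (0 + 1) * qnum q (n - 0) \<noteq> 0" using qnum_nz n by simp
  have "co (d12 UE *\<^sub>v hv (ee c d)) 0 0 k = - (if k = 0 then ka 0 * q * ee c d 0 1 else 0)"
    unfolding co_delta12(1)[OF w z(1,2) jk(2)] w1 using n Q sg_vals(3) s0
    by (simp add: co_hv jk field_simps sg_def del: One_nat_def)
  then have F: "co (d12 UF *\<^sub>v (d12 UE *\<^sub>v hv (ee c d))) 0 j k = - (if j = 1 \<and> k = 0 then x * ee c d 0 1 else 0)"
    unfolding co_delta12(2)[OF cl z(1) jk] using ka_sq(1) pq
    by (auto simp: mult.assoc[symmetric] simp del: One_nat_def) (simp add: mult_ac inverse_pair_simps[OF pq])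
  have e: "co (hv (ee c d)) 0 j k = ee c d j k" using co_hv[OF z(1) jk] by simp
  have "r (C12 q s n 1 1) j k c d = (q - p)\<^sup>2 * co (d12 UF *\<^sub>v (d12 UE *\<^sub>v hv (ee c d))) 0 j k
      + q * (ka 0 * (sg j * (ka 0 * (sg j * ee c d j k))))
      + p * (inverse (ka 0) * (inverse (sg j) * (inverse (ka 0) * (inverse (sg j) * ee c d j k))))"
    unfolding r_def C_eqs co_cas[OF w z(1) jk d_carrier(1)] co_delta12(3,4)[OF cl z(1) jk]
      co_delta12(3,4)[OF w z(1) jk] e ..
  also have "q * (ka 0 * (sg j * (ka 0 * (sg j * ee c d j k)))) = q * (ka 0 * ka 0) * (sg j * sg j) * ee c d j k"
    by (simp only: mult_ac)
  also have "q * (ka 0 * ka 0) = x" unfolding ka_sq using inverse_pair_simps(3)[OF pq] .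
  also have "p * (inverse (ka 0) * (inverse (sg j) * (inverse (ka 0) * (inverse (sg j) * ee c d j k))))
      = p * (inverse (ka 0) * inverse (ka 0)) * (inverse (sg j) * inverse (sg j)) * ee c d j k"
    by (simp only: mult_ac)
  also have "p * (inverse (ka 0) * inverse (ka 0)) = y" unfolding ka_sq using inverse_pair_simps(4)[OF pq] .
  finally have e: "r (C12 q s n 1 1) j k c d = (q - p)\<^sup>2 * - (if j = 1 \<and> k = 0 then x * ee c d 0 1 else 0)
      + x * (sg j * sg j) * ee c d j k + y * (inverse (sg j) * inverse (sg j)) * ee c d j k"
    unfolding F .
  show ?thesis unfolding e h0_def by (auto simp: algebra_simps simp del: One_nat_def)
qed

text \<open>Nothing moves the first index, so level 0 suffices and the result does not depend on
  n.\<close>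

lemma r_C23:
  assumes jk: "j < 2" "k < 2"
  defines "Z \<equiv> \<lambda>c d j k. (if j = 0 then inverse (sg k) * ee c d 1 k else 0) + sg j * (if k = 0 then ee c d j 1 else 0)"
  shows "r (C23 q s n 1 1) j k c d = h0 * ((if j = 1 then inverse (sg k) * Z c d 0 k else 0) + sg j * (if k = 1 then Z c d j 0 else 0))
    + (q * (sg j * (sg k * (sg j * sg k))) + p * (inverse (sg j) * (inverse (sg k) * (inverse (sg j) * inverse (sg k))))) * ee c d j k"
proof -
  have z: "0 < n + 1" "(0::nat) < 2" "(1::nat) < 2" by simp_all
  note w = hv_carrier[of "ee c d"]
  have cl: "d23 g *\<^sub>v hv (ee c d) \<in> carrier_vec N" for g by (rule NN_closed(4)[OF d_carrier(2) w])
  have e: "co (hv (ee c d)) 0 j k = ee c d j k" if "j < 2" "k < 2" for j k using co_hv[OF z(1) that] by simp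
  have Zeq: "co (d23 UE *\<^sub>v hv (ee c d)) 0 j k = Z c d j k" if "j < 2" "k < 2" for j k
    unfolding co_delta23(1)[OF w z(1) that] Z_def e[OF z(3) that(2)] e[OF that(1) z(3)] ..
  show ?thesis
    unfolding r_def C_eqs co_cas[OF w z(1) jk d_carrier(2)] co_delta23(2-4)[OF cl z(1) jk]
      co_delta23(3,4)[OF w z(1) jk] e[OF jk] Zeq[OF z(2) jk(2)] Zeq[OF jk(1) z(2)] h0_def
    by (simp add: algebra_simps)
qed

text \<open>E kills the vector, so the Casimir reduces to its two diagonal terms, determined by the
  weight.\<close>

lemma r_C123:
  assumes jk: "j < 2" "k < 2"
  shows "r (C123 q s n 1 1) j k c d = (x * (sg j * (sg k * (sg j * sg k)))
    + y * (inverse (sg j) * (inverse (sg k) * (inverse (sg j) * inverse (sg k))))) * ee c d j k"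
proof -
  have z: "0 < n + 1" by simp
  note w = hv_carrier[of "ee c d"]
  have cl: "d123 g *\<^sub>v hv (ee c d) \<in> carrier_vec N" for g by (rule NN_closed(4)[OF d_carrier(3) w])
  have e: "co (hv (ee c d)) 0 j k = ee c d j k" using co_hv[OF z(1) jk] by simp
  have E: "d123 UE *\<^sub>v hv (ee c d) = 0\<^sub>v N" using hw_hv by (simp add: hw_def)
  have "d123 UF *\<^sub>v 0\<^sub>v N = 0\<^sub>v N" using d_carrier(3)[of UF] by (intro eq_vecI) (auto simp: scalar_prod_def)
  then have F: "co (d123 UF *\<^sub>v (d123 UE *\<^sub>v hv (ee c d))) 0 j k = 0" unfolding E using co_zero[OF z jk] by simp
  have "r (C123 q s n 1 1) j k c d = q * (ka 0 * ka 0) * (sg j * (sg k * (sg j * sg k))) * ee c d j k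
    + p * (inverse (ka 0) * inverse (ka 0)) * (inverse (sg j) * (inverse (sg k) * (inverse (sg j) * inverse (sg k)))) * ee c d j k"
    unfolding r_def C_eqs co_cas[OF w z(1) jk d_carrier(3)] co_delta123(3,4)[OF cl z(1) jk]
      co_delta123(3,4)[OF w z(1) jk] e F by (simp add: mult_ac)
  also have "q * (ka 0 * ka 0) = x" unfolding ka_sq using inverse_pair_simps(3)[OF pq] .
  also have "p * (inverse (ka 0) * inverse (ka 0)) = y" unfolding ka_sq using inverse_pair_simps(4)[OF pq] .
  finally show ?thesis by (simp add: algebra_simps)
qed

lemma s_simps: "s * (s * z) = q * z" "inverse s * (inverse s * z) = p * z" "s * (inverse s * z) = z" "inverse s * (s * z) = z"
  "s * inverse s = 1" "inverse s * s = 1"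
  using s0 sg_vals(3,4) by (simp_all add: mult.assoc[symmetric])

lemma rho_C:
  "rho_hi (C12 q s n 1 1) = hi GA" "rho_mid (C12 q s n 1 1) = mid GA" "rho_lo (C12 q s n 1 1) = lo GA"
  "rho_hi (C23 q s n 1 1) = hi GB" "rho_mid (C23 q s n 1 1) = mid GB" "rho_lo (C23 q s n 1 1) = lo GB"
  "rho_hi (C123 q s n 1 1) = hi GK" "rho_mid (C123 q s n 1 1) = mid GK" "rho_lo (C123 q s n 1 1) = lo GK"
proof -
  note d = rho_hi_def rho_mid_def rho_lo_def hi_def mid_def lo_def sg_vals s_simps ee_def sc2_def
  show "rho_hi (C12 q s n 1 1) = hi GA" "rho_mid (C12 q s n 1 1) = mid GA" "rho_lo (C12 q s n 1 1) = lo GA"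
    by (simp_all add: d r_C12 mult.commute del: One_nat_def)
  have q3: "q * (q * q) = q ^ 3" "p * (p * p) = p ^ 3" by (simp_all add: power3_eq_cube)
  show "rho_hi (C23 q s n 1 1) = hi GB" "rho_mid (C23 q s n 1 1) = mid GB"
    by (simp_all add: d r_C23 q3 del: One_nat_def)
  \<comment> \<open>Two spins down couple to spin 1, so the value has to be
    \<open>chi q 2\<close>.\<close>
  have "h0 * (q + p) + (q * (p * p) + p * (q * q)) = q ^ 3 + p ^ 3"
    unfolding h0_def
    by (simp add: ring_distribs power2_eq_square power3_eq_cube mult_ac inverse_pair_simps[OF pq])
  then show "rho_lo (C23 q s n 1 1) = lo GB"
    by (simp add: d r_C23 add.commute del: One_nat_def)
  show "rho_hi (C123 q s n 1 1) = hi GK" "rho_mid (C123 q s n 1 1) = mid GK" "rho_lo (C123 q s n 1 1) = lo GK"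
    by (simp_all add: d r_C123 power2_eq_square mult.commute del: One_nat_def)
qed

section \<open>Faithfulness on highest weight vectors\<close>

definition ub :: "nat \<Rightarrow> nat \<Rightarrow> nat \<Rightarrow> complex vec" where
  "ub i j k = V (\<lambda>i' j' k'. if i' = i \<and> j' = j \<and> k' = k then 1 else 0)"

lemma ub_carrier [simp]: "ub i j k \<in> carrier_vec N"
  by (simp add: ub_def)

lemma co_ub: "i' < n + 1 \<Longrightarrow> j' < 2 \<Longrightarrow> k' < 2 \<Longrightarrow> co (ub i j k) i' j' k' = (if i' = i \<and> j' = j \<and> k' = k then 1 else 0)"
  by (simp add: ub_def)

lemma F_ub:
  assumes "j < 2" "k < 2"
  shows "d123 UF *\<^sub>v ub i j k = (inverse (sg j) * inverse (sg k)) \<cdot>\<^sub>v ub (i + 1) j k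
    + (if j = 0 then ka i * inverse (sg k) else 0) \<cdot>\<^sub>v ub i 1 k + (if k = 0 then ka i * sg j else 0) \<cdot>\<^sub>v ub i j 1"
proof (rule vec_eqI_co)
  fix i' j' k' assume ijk: "i' < n + 1" "j' < (2::nat)" "k' < (2::nat)"
  have z: "(0::nat) < 2" "i' - 1 < n + 1" using ijk by simp_all
  note c = co_delta123(2)[OF ub_carrier ijk] co_ub[OF z(2) ijk(2,3)] co_ub[OF ijk(1) z(1) ijk(3)] co_ub[OF ijk(1,2) z(1)]
  have r: "co ((inverse (sg j) * inverse (sg k)) \<cdot>\<^sub>v ub (i + 1) j k
    + (if j = 0 then ka i * inverse (sg k) else 0) \<cdot>\<^sub>v ub i 1 k + (if k = 0 then ka i * sg j else 0) \<cdot>\<^sub>v ub i j 1) i' j' k'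
    = inverse (sg j) * inverse (sg k) * (if i' = i + 1 \<and> j' = j \<and> k' = k then 1 else 0)
      + (if j = 0 then ka i * inverse (sg k) else 0) * (if i' = i \<and> j' = 1 \<and> k' = k then 1 else 0)
      + (if k = 0 then ka i * sg j else 0) * (if i' = i \<and> j' = j \<and> k' = 1 then 1 else 0)"
    using ijk by (simp only: co_lin co_ub add_carrier_vec smult_carrier_vec ub_carrier)
  have T1: "(if i' > 0 then inverse (sg j') * (inverse (sg k') * (if i' - 1 = i \<and> j' = j \<and> k' = k then 1 else 0)) else 0)
      = inverse (sg j) * inverse (sg k) * (if i' = i + 1 \<and> j' = j \<and> k' = k then 1 else 0)"
    by (cases i') (simp_all split: if_split)
  have T2: "ka i' * (if j' = 1 then inverse (sg k') * (if i' = i \<and> 0 = j \<and> k' = k then 1 else 0) else 0)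
      = (if j = 0 then ka i * inverse (sg k) else 0) * (if i' = i \<and> j' = 1 \<and> k' = k then 1 else 0)"
    by (simp split: if_split)
  have T3: "ka i' * (sg j' * (if k' = 1 then (if i' = i \<and> j' = j \<and> 0 = k then 1 else 0) else 0))
      = (if k = 0 then ka i * sg j else 0) * (if i' = i \<and> j' = j \<and> k' = 1 then 1 else 0)"
    by (simp split: if_split)
  show "co (d123 UF *\<^sub>v ub i j k) i' j' k' = co ((inverse (sg j) * inverse (sg k)) \<cdot>\<^sub>v ub (i + 1) j k
    + (if j = 0 then ka i * inverse (sg k) else 0) \<cdot>\<^sub>v ub i 1 k + (if k = 0 then ka i * sg j else 0) \<cdot>\<^sub>v ub i j 1) i' j' k'"
    unfolding r T1[symmetric] T2[symmetric] T3[symmetric] by (simp only: c)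
next
  show "d123 UF *\<^sub>v ub i j k \<in> carrier_vec N" by (rule NN_closed(4)[OF d_carrier(3) ub_carrier])
qed simp

lemma hwf_vanish3: "j < 2 \<Longrightarrow> k < 2 \<Longrightarrow> hwf f (Suc (Suc (Suc m))) j k = 0"
  using hwf_vanish[of 1 k f m] hwf_vanish[of j 1 f m] by (simp only: hwf.simps(2)[of f "Suc (Suc m)"]) auto

lemma hv_expand:
  "hv f = f 0 0 \<cdot>\<^sub>v ub 0 0 0 + f 0 1 \<cdot>\<^sub>v ub 0 0 1 + f 1 0 \<cdot>\<^sub>v ub 0 1 0 + f 1 1 \<cdot>\<^sub>v ub 0 1 1
    + hwf f 1 0 0 \<cdot>\<^sub>v ub 1 0 0 + hwf f 1 0 1 \<cdot>\<^sub>v ub 1 0 1 + hwf f 1 1 0 \<cdot>\<^sub>v ub 1 1 0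
    + hwf f 2 0 0 \<cdot>\<^sub>v ub 2 0 0" (is "_ = ?r")
proof (rule vec_eqI_co)
  fix i j k assume ijk: "i < n + 1" "j < (2::nat)" "k < (2::nat)"
  have r: "co ?r i j k = f 0 0 * (if i = 0 \<and> j = 0 \<and> k = 0 then 1 else 0) + f 0 1 * (if i = 0 \<and> j = 0 \<and> k = 1 then 1 else 0)
    + f 1 0 * (if i = 0 \<and> j = 1 \<and> k = 0 then 1 else 0) + f 1 1 * (if i = 0 \<and> j = 1 \<and> k = 1 then 1 else 0)
    + hwf f 1 0 0 * (if i = 1 \<and> j = 0 \<and> k = 0 then 1 else 0) + hwf f 1 0 1 * (if i = 1 \<and> j = 0 \<and> k = 1 then 1 else 0)
    + hwf f 1 1 0 * (if i = 1 \<and> j = 1 \<and> k = 0 then 1 else 0) + hwf f 2 0 0 * (if i = 2 \<and> j = 0 \<and> k = 0 then 1 else 0)"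
    using ijk by (simp only: co_lin co_ub add_carrier_vec smult_carrier_vec ub_carrier)
  have 11: "hwf f 1 1 1 = 0" using hwf.simps(2)[of f 0] by simp
  consider "i = 0" | "i = 1" | "i = 2" | m where "i = Suc (Suc (Suc m))"
    by (metis One_nat_def Suc_1 not0_implies_Suc)
  then show "co (hv f) i j k = co ?r i j k"
  proof cases
    case 1
    then show ?thesis unfolding r co_hv[OF ijk] using two_cases[OF ijk(2)] two_cases[OF ijk(3)]
      by (elim disjE) (simp_all del: One_nat_def)
  next
    case 2
    then show ?thesis unfolding r co_hv[OF ijk] using two_cases[OF ijk(2)] two_cases[OF ijk(3)] 11
      by (elim disjE) (simp_all del: One_nat_def hwf.simps)
  next
    case 3
    then show ?thesis unfolding r co_hv[OF ijk] using two_cases[OF ijk(2)] two_cases[OF ijk(3)] hwf_vanish[OF ijk(2,3), of f 0]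
      by (elim disjE) (simp_all del: One_nat_def hwf.simps add: numeral_2_eq_2)
  next
    case 4
    then show ?thesis unfolding r co_hv[OF ijk] using hwf_vanish3[OF ijk(2,3)] by (simp del: hwf.simps)
  qed
qed (auto intro!: add_carrier_vec)

lemma qnum_xy: "(q - p) * qnum q n = p * x - q * y" "(q - p) * qnum q (n - 1) = p\<^sup>2 * x - q\<^sup>2 * y" "qnum q 2 = q + p"
proof -
  have n: "n = Suc (n - 1)" using n2 by simp
  have xn: "x = q * q ^ n" by (simp add: x_def)
  then have yn: "y = p * p ^ n" by (simp add: y_def p_def power_inverse)
  have a: "q ^ n = q * q ^ (n - 1)" "p ^ n = p * p ^ (n - 1)" using n by (metis power_Suc)+
  have m: "(q - p) * qnum q k = q ^ k - p ^ k" for k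
    using w_nonzero(2) unfolding qnum_def p_def by simp
  show "(q - p) * qnum q n = p * x - q * y"
    unfolding m xn yn by (simp add: inverse_pair_simps[OF pq])
  show "(q - p) * qnum q (n - 1) = p\<^sup>2 * x - q\<^sup>2 * y"
    unfolding m xn yn a by (simp add: power2_eq_square mult.assoc inverse_pair_simps[OF pq])
  have "(q - p) * qnum q 2 = (q - p) * (q + p)" unfolding m by (simp add: power2_eq_square algebra_simps)
  then show "qnum q 2 = q + p" using w_nonzero(2) by simp
qed

lemma x_sq: "q ^ k * x\<^sup>2 \<noteq> 1" "x\<^sup>2 \<noteq> q\<^sup>2"
proof -
  have x2: "x\<^sup>2 = q ^ (2 * n + 2)" unfolding x_def power_mult[symmetric] by (simp add: mult.commute)
  show "q ^ k * x\<^sup>2 \<noteq> 1" unfolding x2 power_add[symmetric] using q1[of "k + (2 * n + 2)"] by simp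
  show "x\<^sup>2 \<noteq> q\<^sup>2" unfolding x2 q_power_eq_iff using n2 by simp
qed

text \<open>Subtracting suitable multiples of \<open>w01\<close> and \<open>w10\<close> from F w00
  leaves this multiple of \<open>ub 1 0 0\<close>, so it vanishes only if F w00 lies in their span.
  Cleared of denominators it is q^2 x - y.\<close>

lemma level_one_nonzero: "p + x * (q + p) / qnum q n \<noteq> 0"
proof
  assume 0: "p + x * (q + p) / qnum q n = 0"
  have nz: "qnum q n \<noteq> 0" using qnum_nz n2 by simp
  have "p * qnum q n + x * (q + p) = (p + x * (q + p) / qnum q n) * qnum q n" using nz by (simp add: distrib_right)
  then have "p * qnum q n + x * (q + p) = 0" unfolding 0 by simp
  then have "p * ((q - p) * qnum q n) + (q - p) * (x * (q + p)) = 0"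
    by (metis (no_types, lifting) distrib_left mult.left_commute mult_zero_right)
  then have "q\<^sup>2 * x - y = 0"
    unfolding qnum_xy by (simp add: ring_distribs power2_eq_square mult_ac inverse_pair_simps[OF pq])
  then have "q\<^sup>2 * x * x = y * x" by simp
  then have "q\<^sup>2 * x\<^sup>2 = 1" by (simp add: power2_eq_square mult_ac inverse_pair_simps[OF xy])
  then show False using x_sq(1) by blast
qed

text \<open>Modulo F applied to vectors already generated, \<open>w11\<close> is this multiple of
  \<open>ub 0 1 1\<close>. Cleared of denominators it factors as q^3 (p^2 x^2 - 1)(1 - y^2).\<close>

lemma level_two_nonzero: "1 + p * x * (q + p) / qnum q n + p\<^sup>2 * x\<^sup>2 * (q + p) / (qnum q (n - 1) * qnum q n) \<noteq> 0" (is "?c \<noteq> 0")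
proof
  assume 0: "?c = 0"
  have nz: "qnum q n \<noteq> 0" "qnum q (n - 1) \<noteq> 0" using qnum_nz n2 by simp_all
  let ?a = "qnum q n" and ?b = "qnum q (n - 1)" and ?d = "q - p"
  have "?c * ((?d * ?a) * (?d * ?b))
      = (?d * ?a) * (?d * ?b) + p * x * (q + p) * ?d * (?d * ?b) + p\<^sup>2 * x\<^sup>2 * (q + p) * (?d * ?d)"
    using nz by (simp add: field_simps)
  also have "\<dots> = (p * x - q * y) * (p\<^sup>2 * x - q\<^sup>2 * y) + p * x * (q + p) * ?d * (p\<^sup>2 * x - q\<^sup>2 * y) + p\<^sup>2 * x\<^sup>2 * (q + p) * (?d * ?d)"
    unfolding qnum_xy ..
  also have "\<dots> = q ^ 3 * ((p\<^sup>2 * x\<^sup>2 - 1) * (1 - y\<^sup>2))"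
    by (simp add: ring_distribs power2_eq_square power3_eq_cube mult_ac inverse_pair_simps[OF pq] inverse_pair_simps[OF xy])
  finally have "(p\<^sup>2 * x\<^sup>2 - 1) * (1 - y\<^sup>2) = 0" using q0 unfolding 0 by simp
  then consider "p\<^sup>2 * x\<^sup>2 = 1" | "y\<^sup>2 = 1" by auto
  then show False
  proof cases
    case 1
    then have "q\<^sup>2 * (p\<^sup>2 * x\<^sup>2) = q\<^sup>2" by simp
    then have "x\<^sup>2 = q\<^sup>2" by (simp add: power2_eq_square mult_ac inverse_pair_simps[OF pq])
    then show ?thesis using x_sq(2) by blast
  next
    case 2
    then have "x\<^sup>2 * y\<^sup>2 = x\<^sup>2" by simp
    then have "q ^ 0 * x\<^sup>2 = 1" by (simp add: power2_eq_square mult_ac inverse_pair_simps[OF xy])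
    then show ?thesis using x_sq(1) by blast
  qed
qed

lemma ub_unit: "i < n + 1 \<Longrightarrow> j < 2 \<Longrightarrow> k < 2 \<Longrightarrow> ub i j k = unit_vec N ((i * 2 + j) * 2 + k)"
proof (rule vec_eqI_co)
  fix i' j' k' assume ijk: "i < n + 1" "j < (2::nat)" "k < (2::nat)" and ijk': "i' < n + 1" "j' < (2::nat)" "k' < (2::nat)"
  have "(i' * 2 + j') * 2 + k' = (i * 2 + j) * 2 + k \<longleftrightarrow> i' = i \<and> j' = j \<and> k' = k"
  proof -
    have e: "a * 2 + c = b * 2 + d \<longleftrightarrow> a = b \<and> c = d" if "c < 2" "d < 2" for a b c d :: nat
      using that by presburger
    show ?thesis by (simp only: e[OF ijk'(3) ijk(3)] e[OF ijk'(2) ijk(2)] conj_assoc)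
  qed
  then show "co (ub i j k) i' j' k' = co (unit_vec N ((i * 2 + j) * 2 + k)) i' j' k'"
    unfolding co_ub[OF ijk'] using ix_lt[OF ijk] ix_lt[OF ijk'] by (simp add: co_def)
qed simp_all

text \<open>m annihilates the four highest weight vectors and commutes with F, so its kernel
  contains everything that F generates from them. The delicate part is to reach all of level 0 of
  the tensor basis; each further level follows because F moves level i to level i + 1 with a nonzero
  coefficient.\<close>

lemma rho_faithful:
  assumes m: "cen m" and 0: "rho_hi m = 0" "rho_mid m = 0" "rho_lo m = 0"
  shows "m = 0\<^sub>m N N"
proof -
  note mc = cenD(1)[OF m]
  \<comment> \<open>A coordinate of m u, so that vector identities become linear equations between
    numbers.\<close>
  define L where "L = (\<lambda>t u. (m *\<^sub>v u) $ t)"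
  have Ladd: "L t (u + w) = L t u + L t w" "L t (c \<cdot>\<^sub>v u) = c * L t u"
    if "t < N" "u \<in> carrier_vec N" "w \<in> carrier_vec N" for t u w c
    using that mc mult_add_distrib_mat_vec[OF mc that(2,3)] mult_mat_vec[OF mc that(2)]
    unfolding L_def by (simp_all del: index_mult_mat_vec)
  note Lsm = Ladd(2)[OF _ _ ub_carrier[of 0 0 0]]
  note lin = Ladd(1) Lsm ub_carrier smult_carrier_vec add_carrier_vec
  have PF: "L t (d123 UF *\<^sub>v u) = 0" if u: "u \<in> carrier_vec N" "\<And>t. t < N \<Longrightarrow> L t u = 0" and t: "t < N" for u t
  proof -
    have mu: "m *\<^sub>v u = 0\<^sub>v N" using u(2) mc by (intro eq_vecI) (simp_all add: L_def del: index_mult_mat_vec)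
    have F0: "d123 UF *\<^sub>v 0\<^sub>v N = 0\<^sub>v N"
      using d_carrier(3)[of UF] by (intro eq_vecI) (auto simp: scalar_prod_def)
    show ?thesis
      unfolding L_def by (simp only: cenD(3)[OF m u(1), symmetric] mu F0 index_zero_vec(1)[OF t])
  qed
  have r0: "r m 0 0 0 0 = 0" "r m 0 1 0 1 = 0" "r m 0 1 1 0 = 0" "r m 1 0 0 1 = 0" "r m 1 0 1 0 = 0" "r m 1 1 1 1 = 0"
    using 0 by (simp_all add: rho_hi_def rho_mid_def rho_lo_def sc2_def zero_m2_def del: One_nat_def)
  have zz: "0 \<cdot>\<^sub>v hv f = 0\<^sub>v N" for f by (intro eq_vecI) (auto simp: hv_def V_def)
  have Lw: "L t w00 = 0" "L t w01 = 0" "L t w10 = 0" "L t w11 = 0" if "t < N" for t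
    using that unfolding L_def cen_expand[OF m] r0 zz by simp_all
  have q1': "qnum q 1 = 1" by (rule qnum_1)
  let ?a = "qnum q n" and ?b = "qnum q (n - 1)"
  have h1: "hwf f 1 j k = - (ka 0 * (sg j * sg k)) / ?a * ((if j = 0 then inverse (sg k) * f 1 k else 0) + sg j * (if k = 0 then f j 1 else 0))" for f j k
    using hwf.simps(2)[of f 0] q1' by simp
  have two: "(2::nat) = Suc 1" "1 + 1 = (2::nat)" by simp_all
  have h2: "hwf f 2 0 0 = - (ka 1 * (s * s)) / ((q + p) * ?b) * (inverse s * hwf f 1 1 0 + s * hwf f 1 0 1)" for f
    using hwf.simps(2)[of f 1] unfolding two(1)[symmetric] two(2) qnum_xy(3) by (simp add: sg_def del: One_nat_def hwf.simps)
  \<comment> \<open>The vector \<open>w00\<close> is \<open>ub 0 0 0\<close> itself.\<close>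
  have L000: "L t (ub 0 0 0) = 0" if t: "t < N" for t
    using Lw(1)[OF t] unfolding hv_expand[of "ee 0 0"] h2 h1
    using t by (simp add: lin ee_def del: One_nat_def)
  have e01: "L t (ub 0 0 1) - ka 0 * q * s / ?a * L t (ub 1 0 0) = 0" if t: "t < N" for t
    using Lw(2)[OF t] unfolding hv_expand[of "ee 0 1"] h2 h1
    using t by (simp add: lin ee_def sg_vals del: One_nat_def)
  have e10: "L t (ub 0 1 0) - ka 0 * q * inverse s / ?a * L t (ub 1 0 0) = 0" if t: "t < N" for t
    using Lw(3)[OF t] unfolding hv_expand[of "ee 1 0"] h2 h1
    using t by (simp add: lin ee_def sg_vals del: One_nat_def)
  \<comment> \<open>F applied to the kernel vector \<open>ub 0 0 0\<close> gives the third equation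
    for three unknowns.\<close>
  have F000: "p * L t (ub 1 0 0) + ka 0 * inverse s * L t (ub 0 1 0) + ka 0 * s * L t (ub 0 0 1) = 0" if t: "t < N" for t
    using PF[OF ub_carrier L000 t] F_ub[of 0 0 0] t by (simp add: lin sg_vals del: One_nat_def)
  have L100: "L t (ub 1 0 0) = 0" if t: "t < N" for t
  proof -
    have "(p + x * (q + p) / ?a) * L t (ub 1 0 0) = 0"
    proof -
      have "ka 0 * inverse s * (ka 0 * q * inverse s / ?a) + ka 0 * s * (ka 0 * q * s / ?a)
          = q * (ka 0 * ka 0) * (inverse s * inverse s + s * s) / ?a"
        by (simp add: algebra_simps add_divide_distrib)
      also have "\<dots> = x * (q + p) / ?a" unfolding ka_sq sg_vals by (simp add: inverse_pair_simps[OF pq] add.commute)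
      finally have "p + x * (q + p) / ?a = p + (ka 0 * inverse s * (ka 0 * q * inverse s / ?a) + ka 0 * s * (ka 0 * q * s / ?a))" by simp
      moreover have "L t (ub 0 1 0) = ka 0 * q * inverse s / ?a * L t (ub 1 0 0)" "L t (ub 0 0 1) = ka 0 * q * s / ?a * L t (ub 1 0 0)"
        using e01[OF t] e10[OF t] by simp_all
      ultimately show ?thesis using F000[OF t] by (simp add: algebra_simps)
    qed
    then show ?thesis using level_one_nonzero by simp
  qed
  have L0: "L t (ub 0 0 1) = 0" "L t (ub 0 1 0) = 0" if t: "t < N" for t
    using e01[OF t] e10[OF t] L100[OF t] by simp_all
  have L011: "L t (ub 0 1 1) = 0" if t: "t < N" for t
  proof -
    let ?z = "L t (ub 0 1 1)"
    \<comment> \<open>F applied to \<open>ub 0 0 1\<close>, \<open>ub 0 1 0\<close> and then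
      \<open>ub 1 0 0\<close> expresses the entries of this weight at levels 1 and 2 through the one
      unknown at \<open>ub 0 1 1\<close>; the vector \<open>w11\<close> closes the system.\<close>
    have 1: "L t (ub 1 0 1) = - (ka 0 * s * ?z)"
      using PF[OF ub_carrier L0(1) t] F_ub[of 0 1 0] t by (simp add: lin sg_vals s_simps del: One_nat_def) (simp add: eq_neg_iff_add_eq_0)
    have 2: "L t (ub 1 1 0) = - (ka 0 * inverse s * ?z)"
      using PF[OF ub_carrier L0(2) t] F_ub[of 1 0 0] t by (simp add: lin sg_vals s_simps del: One_nat_def) (simp add: eq_neg_iff_add_eq_0)
    have "p * L t (ub 2 0 0) + ka 1 * inverse s * L t (ub 1 1 0) + ka 1 * s * L t (ub 1 0 1) = 0"
      using PF[OF ub_carrier L100 t] F_ub[of 0 0 1] t unfolding two(2) by (simp add: lin sg_vals del: One_nat_def)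
    then have "p * L t (ub 2 0 0) = ka 1 * ka 0 * (inverse s * inverse s + s * s) * ?z"
      unfolding 1 2 by (simp add: algebra_simps eq_neg_iff_add_eq_0)
    then have "q * (p * L t (ub 2 0 0)) = q * (ka 1 * ka 0 * (q + p) * ?z)" unfolding sg_vals by (simp add: add.commute)
    then have 3: "L t (ub 2 0 0) = q * (ka 1 * ka 0 * (q + p) * ?z)" by (simp only: inverse_pair_simps(3)[OF pq])
    have w: "?z - ka 0 * s / ?a * L t (ub 1 0 1) - ka 0 * inverse s / ?a * L t (ub 1 1 0)
        + ka 1 * q * ka 0 / (?b * ?a) * L t (ub 2 0 0) = 0"
    proof -
      \<comment> \<open>The factor q + p of the quantum integer [2] cancels against the sum over the
        two orders of raising the spins.\<close>
      have u2: "hwf (ee 1 1) 2 0 0 = ka 1 * q * ka 0 / (?b * ?a)"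
      proof -
        define K where "K = ka 0 / ?a"
        have H: "hwf (ee 1 1) 1 1 0 = - K * inverse s" "hwf (ee 1 1) 1 0 1 = - K * s"
          unfolding h1 K_def by (simp_all add: ee_def sg_vals s_simps del: One_nat_def)
        have "inverse s * (- K * inverse s) + s * (- K * s) = - K * (inverse s * inverse s + s * s)"
          by (simp add: algebra_simps)
        also have "\<dots> = - K * (q + p)" unfolding sg_vals by (simp only: add.commute)
        finally have "hwf (ee 1 1) 2 0 0 = - (ka 1 * q) / ((q + p) * ?b) * (- K * (q + p))"
          unfolding h2 H sg_vals(3) by (simp only:)
        also have "\<dots> = ka 1 * q * K / ?b"
        proof -
          have "- X / (c * b) * (- K * c) = X * K / b" if "c \<noteq> 0" for X b c :: complex
            using that by simp
          from this[OF w_nonzero(3)] show ?thesis .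
        qed
        also have "\<dots> = ka 1 * q * ka 0 / (?b * ?a)"
          by (simp add: K_def mult.commute)
        finally show ?thesis .
      qed
      show ?thesis
        using Lw(4)[OF t] unfolding hv_expand[of "ee 1 1"] u2 h1
        using t by (simp add: lin ee_def sg_vals s_simps algebra_simps del: One_nat_def)
    qed
    have "?z * (1 + p * x * (q + p) / ?a + p\<^sup>2 * x\<^sup>2 * (q + p) / (?b * ?a)) = 0"
    proof -
      have a1: "ka 0 * s / ?a * (ka 0 * s * ?z) + ka 0 * inverse s / ?a * (ka 0 * inverse s * ?z)
          = (ka 0 * ka 0) * (s * s + inverse s * inverse s) / ?a * ?z"
        by (simp add: algebra_simps add_divide_distrib)
      have a2: "ka 1 * q * ka 0 / (?b * ?a) * (q * (ka 1 * ka 0 * (q + p) * ?z))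
          = (q * q) * (ka 1 * ka 1) * (ka 0 * ka 0) * (q + p) / (?b * ?a) * ?z"
        by (simp add: mult_ac)
      have a3: "(q * q) * (p ^ 3 * x) * (p * x) = p\<^sup>2 * x\<^sup>2"
        by (simp add: power2_eq_square power3_eq_cube mult_ac inverse_pair_simps[OF pq])
      have "?z + (ka 0 * s / ?a * (ka 0 * s * ?z) + ka 0 * inverse s / ?a * (ka 0 * inverse s * ?z))
          + ka 1 * q * ka 0 / (?b * ?a) * (q * (ka 1 * ka 0 * (q + p) * ?z)) = 0"
        using w unfolding 1 2 3 by (simp add: algebra_simps)
      then show ?thesis unfolding a1 a2 unfolding ka_sq sg_vals a3 by (simp add: algebra_simps)
    qed
    then show ?thesis using level_two_nonzero by simp
  qed
  have all: "\<forall>j<2. \<forall>k<2. \<forall>t<N. L t (ub i j k) = 0" for i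
  proof (induction i)
    case 0
    show ?case
    proof (intro allI impI)
      fix j k t assume jk: "j < (2::nat)" "k < (2::nat)" and t: "t < N"
      show "L t (ub 0 j k) = 0"
        using two_cases[OF jk(1)] two_cases[OF jk(2)] L000[OF t] L0[OF t] L011[OF t]
        by (elim disjE) (simp_all del: One_nat_def)
    qed
  next
    case (Suc i)
    show ?case
    proof (intro allI impI)
      fix j k t assume jk: "j < (2::nat)" "k < (2::nat)" and t: "t < N"
      have i: "L t (ub i j k) = 0" if "j < 2" "k < 2" "t < N" for j k t using Suc that by blast
      have "L t (d123 UF *\<^sub>v ub i j k) = 0" by (rule PF[OF ub_carrier i[OF jk] t])
      then have "inverse (sg j) * inverse (sg k) * L t (ub (i + 1) j k) = 0"
        unfolding F_ub[OF jk] using t jk i[of 1 k t] i[of j 1 t] by (simp add: lin del: One_nat_def)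
      then show "L t (ub (Suc i) j k) = 0" by simp
    qed
  qed
  show ?thesis
  proof (rule eq_matI)
    fix t l assume "t < dim_row (0\<^sub>m N N :: complex mat)" "l < dim_col (0\<^sub>m N N :: complex mat)"
    then have tl: "t < N" "l < N" by auto
    have b: "l div 2 div 2 < n + 1" "l div 2 mod 2 < 2" "l mod 2 < 2"
      using tl(2) unfolding N_def by (auto simp: less_mult_imp_div_less)
    have "unit_vec N l = ub (l div 2 div 2) (l div 2 mod 2) (l mod 2)"
      unfolding ub_unit[OF b] by (simp only: div_mult_mod_eq)
    then have "(m *\<^sub>v unit_vec N l) $ t = 0" using all b tl(1) unfolding L_def by metis
    moreover have "(m *\<^sub>v unit_vec N l) $ t = m $$ (t, l)"
      using mc tl by (simp add: scalar_prod_right_unit)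
    ultimately show "m $$ (t, l) = 0\<^sub>m N N $$ (t, l)" using tl by simp
  qed (use mc in auto)
qed

section \<open>The isomorphism and its uniqueness\<close>

abbreviation "C \<equiv> centralizer q s n 1 1"

interpretation M: unital_algebra "mat_alg N" by (rule unital_algebra_mat)

lemma C_simps:
  "m \<in> carrier C \<longleftrightarrow> cen m" "a \<otimes>\<^bsub>C\<^esub> b = a * b" "a \<oplus>\<^bsub>C\<^esub> b = a + b" "\<one>\<^bsub>C\<^esub> = 1\<^sub>m N" "c \<odot>\<^bsub>C\<^esub> a = c \<cdot>\<^sub>m a"
proof -
  have Ne: "(n + 1) * (1 + 1) * (1 + 1) = N" by (simp add: N_def)
  show "m \<in> carrier C \<longleftrightarrow> cen m" by (rule centralizer_cen)
  show "a \<otimes>\<^bsub>C\<^esub> b = a * b" "a \<oplus>\<^bsub>C\<^esub> b = a + b" "\<one>\<^bsub>C\<^esub> = 1\<^sub>m N" "c \<odot>\<^bsub>C\<^esub> a = c \<cdot>\<^sub>m a"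
    unfolding centralizer_def Let_def Ne by (simp_all add: module_mat_simps)
qed

lemma cen_carrier: "cen m \<Longrightarrow> m \<in> carrier (mat_alg N)"
  using cenD(1) by (simp add: module_mat_simps)

text \<open>Lets the lemmas on unital algebras be applied in the full matrix algebra, with
  membership in the centralizer kept as a side condition.\<close>

lemma hom_centralizer:
  "f \<in> alg_hom A C \<longleftrightarrow> f \<in> alg_hom A (mat_alg N) \<and> (\<forall>X\<in>carrier A. cen (f X))"
proof
  assume f: "f \<in> alg_hom A C"
  note fD = alg_homD[OF f, unfolded C_simps]
  have "f \<in> alg_hom A (mat_alg N)"
    unfolding alg_hom_def using fD cen_carrier by (auto intro!: ring_hom_memI simp: module_mat_simps)
  then show "f \<in> alg_hom A (mat_alg N) \<and> (\<forall>X\<in>carrier A. cen (f X))" using fD(1) by blast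
next
  assume f: "f \<in> alg_hom A (mat_alg N) \<and> (\<forall>X\<in>carrier A. cen (f X))"
  then have "f \<in> alg_hom A (mat_alg N)" by blast
  note fD = alg_homD[OF this, unfolded module_mat_simps]
  show "f \<in> alg_hom A C"
    unfolding alg_hom_def using fD f by (auto intro!: ring_hom_memI simp: C_simps simp del: One_nat_def)
qed

lemma rho_eval:
  assumes h: "\<And>g. cen (h g)"
  shows "cen (eval_free (mat_alg N) h a)"
    "rho_hi (eval_free (mat_alg N) h a) = ev (\<lambda>g. rho_hi (h g)) a"
    "rho_mid (eval_free (mat_alg N) h a) = ev (\<lambda>g. rho_mid (h g)) a"
    "rho_lo (eval_free (mat_alg N) h a) = ev (\<lambda>g. rho_lo (h g)) a"
proof -
  let ?e = "eval_free (mat_alg N) h"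
  have hc: "h g \<in> carrier (mat_alg N)" for g by (rule cen_carrier[OF h])
  note ev = M.eval_free_add[OF hc] M.eval_free_smult[OF hc] M.eval_free_one[OF hc] M.eval_free_mult[OF hc] M.eval_free_var[OF hc]
  have "cen (?e a) \<and> rho_hi (?e a) = ev (\<lambda>g. rho_hi (h g)) a \<and> rho_mid (?e a) = ev (\<lambda>g. rho_mid (h g)) a
    \<and> rho_lo (?e a) = ev (\<lambda>g. rho_lo (h g)) a"
  proof (induction a rule: var_induct)
    case (add a b)
    then have "cen (?e a)" "cen (?e b)" by auto
    then show ?case using add rho_hom[of "?e a" "?e b"] cen_closed(2)[of "?e a" "?e b"]
      unfolding ev module_mat_simps ev_simps by simp
  next
    case (smult c a)
    then have "cen (?e a)" by auto
    then show ?case using smult rho_hom[of "?e a" "?e a"] cen_closed(4)[of "?e a" c]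
      unfolding M.eval_free_smult[OF hc] module_mat_simps ev_simps by simp
  next
    case one
    then show ?case using rho_hom(10-12)[OF cen_closed(1) cen_closed(1)] cen_closed(1)
      unfolding ev module_mat_simps ev_simps by simp
  next
    case (var g a)
    then have "cen (?e a)" by auto
    then show ?case using var rho_hom[OF h[of g], of "?e a"] cen_closed(3)[OF h[of g], of "?e a"]
      unfolding ev module_mat_simps ev_simps by simp
  qed
  then show "cen (?e a)" "rho_hi (?e a) = ev (\<lambda>g. rho_hi (h g)) a" "rho_mid (?e a) = ev (\<lambda>g. rho_mid (h g)) a"
    "rho_lo (?e a) = ev (\<lambda>g. rho_lo (h g)) a" by auto
qed

lemma rho_inj:
  assumes "cen m" "cen m'" "rho_hi m = rho_hi m'" "rho_mid m = rho_mid m'" "rho_lo m = rho_lo m'"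
  shows "m = m'"
proof -
  have c: "cen ((- 1) \<cdot>\<^sub>m m')" "cen (m + (- 1) \<cdot>\<^sub>m m')" using assms cen_closed by blast+
  have neg: "w + sc2 (- 1) * w = 0" for w by (cases w) (simp add: sc2_def zero_m2_def)
  have "m + (- 1) \<cdot>\<^sub>m m' = 0\<^sub>m N N"
    by (rule rho_faithful[OF c(2)])
      (simp_all only: rho_hom(1-3)[OF assms(1) c(1)] rho_hom(7-9)[OF assms(2,2)] assms(3-5) neg)
  then have eq: "(m + (- 1) \<cdot>\<^sub>m m') $$ (i, j) = 0\<^sub>m N N $$ (i, j)" for i j by simp
  show ?thesis
  proof (rule eq_matI)
    fix i j assume "i < dim_row m'" "j < dim_col m'"
    then show "m $$ (i, j) = m' $$ (i, j)"
      using eq[of i j] cenD(1)[OF assms(1)] cenD(1)[OF assms(2)] by simp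
  qed (use cenD(1)[OF assms(1)] cenD(1)[OF assms(2)] in auto)
qed

text \<open>D solved from the third defining relation, so that its image can be obtained from the
  images of the other generators.\<close>

definition polyD :: "aw_gen free_alg" where
  "polyD = scalar (1 / (q + p)) * (var G1 * var G3 + var G2 * var GK)
     - scalar (1 / (q\<^sup>2 - p\<^sup>2)) * (scalar q * (var GA * var GB) - scalar p * (var GB * var GA))"

lemma D_rel: "var GD - polyD \<in> rel_ideal R"
  using rel_ideal_superset[OF R_mem(12)] unfolding polyD_def q_comm_def p_def[symmetric]
  by (simp add: algebra_simps)

lemma ev_D: "hi GD = ev hi polyD" "mid GD = ev mid polyD" "lo GD = ev lo polyD"
  using ev_ideal[OF D_rel] unfolding ev_simps(5,6) by (simp_all only: right_minus_eq)

lemma eval_polyD: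
  assumes B: "unital_algebra B" and h: "\<And>g. h g \<in> carrier B" "\<And>g. h' g \<in> carrier B"
    and eq: "\<And>g. g \<noteq> GD \<Longrightarrow> h g = h' g"
  shows "eval_free B h polyD = eval_free B h' polyD"
proof -
  interpret B: unital_algebra B by (rule B)
  have e: "h GA = h' GA" "h GB = h' GB" "h GK = h' GK" "h G1 = h' G1" "h G2 = h' G2" "h G3 = h' G3"
    using eq by simp_all
  show ?thesis
    unfolding polyD_def
    by (simp only: B.eval_free_diff[OF h(1)] B.eval_free_diff[OF h(2)] B.eval_free_smult[OF h(1)] B.eval_free_smult[OF h(2)]
        B.eval_free_add[OF h(1)] B.eval_free_add[OF h(2)])
      (simp only: B.eval_free_mult[OF h(1)] B.eval_free_mult[OF h(2)] B.eval_free_var[OF h(1)] B.eval_free_var[OF h(2)] e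
        B.eval_free_scalar[OF h(1)] B.eval_free_scalar[OF h(2)])
qed

text \<open>Two stages avoid circularity: \<open>img\<close> overrides the value at
  \<open>GD\<close> by evaluating \<open>polyD\<close>, an expression without D, at
  \<open>img0\<close>.\<close>

definition img0 :: "aw_gen \<Rightarrow> complex mat" where
  "img0 g = (case g of GA \<Rightarrow> C12 q s n 1 1 | GB \<Rightarrow> C23 q s n 1 1 | GK \<Rightarrow> C123 q s n 1 1
     | GD \<Rightarrow> 1\<^sub>m N | G1 \<Rightarrow> (x + y) \<cdot>\<^sub>m 1\<^sub>m N | G2 \<Rightarrow> (q\<^sup>2 + p\<^sup>2) \<cdot>\<^sub>m 1\<^sub>m N | G3 \<Rightarrow> (q\<^sup>2 + p\<^sup>2) \<cdot>\<^sub>m 1\<^sub>m N)"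

definition img :: "aw_gen \<Rightarrow> complex mat" where
  "img g = (if g = GD then eval_free (mat_alg N) img0 polyD else img0 g)"

lemma cen_img0: "cen (img0 g)"
  using cen_C cen_closed by (cases g) (simp_all add: img0_def del: One_nat_def)

lemma cen_img: "cen (img g)"
  using rho_eval(1)[of img0, OF cen_img0] cen_img0 by (simp add: img_def)

lemma rho_img: "rho_hi (img g) = hi g" "rho_mid (img g) = mid g" "rho_lo (img g) = lo g"
proof -
  note one = rho_hom(7-12)[OF cen_closed(1) cen_closed(1)]
  have ne: "rho_hi (img0 g) = hi g" "rho_mid (img0 g) = mid g" "rho_lo (img0 g) = lo g" if "g \<noteq> GD" for g
    using that rho_C one
    by (cases g; simp add: img0_def hi_def mid_def lo_def del: One_nat_def)+
  have m2: "unital_algebra m2_alg" by (rule m2.unital_algebra_axioms)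
  have "rho_hi (img GD) = hi GD" "rho_mid (img GD) = mid GD" "rho_lo (img GD) = lo GD"
    unfolding img_def using rho_eval(2-4)[of img0 polyD, OF cen_img0] unfolding ev_D
    using eval_polyD[OF m2, of "\<lambda>g. rho_hi (img0 g)" hi] eval_polyD[OF m2, of "\<lambda>g. rho_mid (img0 g)" mid]
      eval_polyD[OF m2, of "\<lambda>g. rho_lo (img0 g)" lo] ne by simp_all
  then show "rho_hi (img g) = hi g" "rho_mid (img g) = mid g" "rho_lo (img g) = lo g"
    using ne[of g] by (cases "g = GD"; simp add: img_def)+
qed

lemma rho_eval_img:
  "rho_hi (eval_free (mat_alg N) img a) = ev hi a" "rho_mid (eval_free (mat_alg N) img a) = ev mid a"
  "rho_lo (eval_free (mat_alg N) img a) = ev lo a"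
  unfolding rho_eval(2-4)[of img, OF cen_img] rho_img by (rule refl)+

lemma cen_zero: "cen (0\<^sub>m N N)" "rho_hi (0\<^sub>m N N) = 0" "rho_mid (0\<^sub>m N N) = 0" "rho_lo (0\<^sub>m N N) = 0"
proof -
  have "0 \<cdot>\<^sub>m 1\<^sub>m N = (0\<^sub>m N N :: complex mat)" by (intro eq_matI) auto
  then show "cen (0\<^sub>m N N)" "rho_hi (0\<^sub>m N N) = 0" "rho_mid (0\<^sub>m N N) = 0" "rho_lo (0\<^sub>m N N) = 0"
    using cen_closed(4)[OF cen_closed(1), of 0] rho_hom(7-9)[OF cen_closed(1) cen_closed(1), of 0]
    by (simp_all add: sc2_simps)
qed

text \<open>The block values of the evaluated matrix are the values of a in the three
  representations, and they detect zero on both sides: by \<open>rho_inj\<close> in the centralizer,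
  by \<open>ev_kernel\<close> in the quotient. Applied to the relations, this shows that the images
  satisfy them.\<close>

lemma eval_img_zero_iff: "eval_free (mat_alg N) img a = 0\<^sub>m N N \<longleftrightarrow> a \<in> rel_ideal R"
proof
  assume 0: "eval_free (mat_alg N) img a = 0\<^sub>m N N"
  show "a \<in> rel_ideal R"
    by (rule ev_kernel) (simp_all only: rho_eval_img[symmetric] 0 cen_zero)
next
  assume "a \<in> rel_ideal R"
  then show "eval_free (mat_alg N) img a = 0\<^sub>m N N"
    by (intro rho_inj rho_eval(1) cen_img cen_zero) (simp_all only: rho_eval_img ev_ideal cen_zero)
qed

definition iso :: "aw_gen free_alg set \<Rightarrow> complex mat" where
  "iso = extend_hom (mat_alg N) img"

lemma img_satisfies: "M.satisfies img R"
  unfolding M.satisfies_def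
  using cen_carrier[OF cen_img] eval_img_zero_iff rel_ideal_superset by (auto simp: module_mat_simps)

lemma iso_cls: "iso (cls R a) = eval_free (mat_alg N) img a"
  unfolding iso_def by (rule M.satisfiesD(3)[OF img_satisfies])

lemma iso_hom: "iso \<in> alg_hom (presented R) (mat_alg N)"
  unfolding iso_def by (rule M.satisfiesD(4)[OF img_satisfies])

lemma iso_generator: "iso (generator R g) = img g"
  unfolding iso_def by (rule M.satisfiesD(5)[OF img_satisfies])

text \<open>Block values serve as coordinates on both algebras. For an element of the centralizer
  \<open>ev_surj\<close> provides a polynomial with the same block values, and
  \<open>rho_inj\<close> then gives equality.\<close>

lemma iso_alg_iso: "iso \<in> alg_iso (presented R) C"
  unfolding alg_iso_def
proof (intro CollectI conjI)
  have cl: "cen (iso X)" if X: "X \<in> carrier (presented R)" for X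
  proof -
    obtain a where "X = cls R a" using X unfolding presented_simps(1) by blast
    then show ?thesis using rho_eval(1)[of img a, OF cen_img] by (simp only: iso_cls)
  qed
  then show "iso \<in> alg_hom (presented R) C" unfolding hom_centralizer using iso_hom by blast
  have hc: "img g \<in> carrier (mat_alg N)" for g by (rule cen_carrier[OF cen_img])
  show "bij_betw iso (carrier (presented R)) (carrier C)"
    unfolding bij_betw_def
  proof (intro conjI equalityI subsetI)
    show "inj_on iso (carrier (presented R))"
    proof (rule inj_onI)
      fix X Y assume "X \<in> carrier (presented R)" "Y \<in> carrier (presented R)" and eq: "iso X = iso Y"
      then obtain a b where ab: "X = cls R a" "Y = cls R b" by (auto simp: presented_simps)
      have "a - b \<in> rel_ideal R"
      proof (rule ev_kernel)
        have "ev hi a = ev hi b" "ev mid a = ev mid b" "ev lo a = ev lo b"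
          using eq unfolding ab iso_cls rho_eval_img[symmetric] by simp_all
        then show "ev hi (a - b) = 0" "ev mid (a - b) = 0" "ev lo (a - b) = 0" by (simp_all add: ev_simps)
      qed
      then show "X = Y" unfolding ab by (simp add: cls_eq_iff)
    qed
    show "m \<in> carrier C" if "m \<in> iso ` carrier (presented R)" for m
      using that cl by (auto simp: C_simps simp del: One_nat_def)
    fix m assume "m \<in> carrier C"
    then have m: "cen m" by (simp only: C_simps)
    obtain a where a: "ev hi a = rho_hi m" "ev mid a = rho_mid m" "ev lo a = rho_lo m"
      using ev_surj unfolding rho_hi_def rho_lo_def by blast
    have "iso (cls R a) = m"
      unfolding iso_cls
      by (intro rho_inj rho_eval(1) cen_img m) (simp_all only: rho_eval_img a)
    then show "m \<in> iso ` carrier (presented R)"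
      by (metis image_eqI presented_simps(1) rangeI)
  qed
qed

text \<open>The generators \<open>G1\<close>, \<open>G2\<close>, \<open>G3\<close> become scalars
  and D is a polynomial in the others, so the values at A, B and K fix a homomorphism on all
  generators.\<close>

lemma iso_unique:
  assumes f: "f \<in> alg_hom (presented R) C"
    and g: "f (generator R GA) = C12 q s n 1 1" "f (generator R GB) = C23 q s n 1 1" "f (generator R GK) = C123 q s n 1 1"
    and X: "X \<in> carrier (presented R)"
  shows "f X = iso X"
proof -
  have fm: "f \<in> alg_hom (presented R) (mat_alg N)" using f unfolding hom_centralizer by blast
  have sc: "f (generator R z) = c \<cdot>\<^sub>m 1\<^sub>m N" if "var z - scalar c \<in> R" for z c
  proof -
    have "generator R z = cls R (scalar c)" unfolding cls_eq_iff by (rule rel_ideal_superset[OF that])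
    then have "f (generator R z) = f (cls R (scalar c))" by (rule arg_cong)
    also have "cls R (scalar c) = c \<odot>\<^bsub>presented R\<^esub> cls R 1" by (simp add: presented_simps(6))
    also have "f (c \<odot>\<^bsub>presented R\<^esub> cls R 1) = c \<odot>\<^bsub>mat_alg N\<^esub> f (cls R 1)"
      by (rule alg_homD(5)[OF fm]) (simp add: presented_simps(1))
    also have "f (cls R 1) = 1\<^sub>m N"
      using alg_homD(4)[OF fm] unfolding presented_simps(2) module_mat_simps .
    finally show ?thesis unfolding module_mat_simps .
  qed
  have ne: "f (generator R z) = iso (generator R z)" if "z \<noteq> GD" for z
    unfolding iso_generator using that g sc[OF R_mem(7)] sc[OF R_mem(8)] sc[OF R_mem(9)]
    by (cases z) (simp_all add: img_def img0_def del: One_nat_def)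
  have D: "generator R GD = cls R polyD" unfolding cls_eq_iff by (rule D_rel)
  have "f (generator R GD) = f (cls R polyD)" by (rule arg_cong[OF D])
  also have "\<dots> = eval_free (mat_alg N) (\<lambda>g. f (generator R g)) polyD" by (rule hom_presented[OF unital_algebra_mat fm])
  also have "\<dots> = eval_free (mat_alg N) (\<lambda>g. iso (generator R g)) polyD"
    by (rule eval_polyD[OF unital_algebra_mat alg_homD(1)[OF fm generator_closed] alg_homD(1)[OF iso_hom generator_closed] ne])
  also have "\<dots> = iso (cls R polyD)" by (rule hom_presented[OF unital_algebra_mat iso_hom, symmetric])
  also have "\<dots> = iso (generator R GD)" by (rule arg_cong[OF D[symmetric]])
  finally have all: "f (generator R z) = iso (generator R z)" for z using ne by (cases "z = GD") blast+
  show ?thesis by (rule hom_eqI[OF unital_algebra_mat fm iso_hom all X])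
qed

end

(* The spins are j1 = j = n / 2 and j2 = j3 = 1 / 2 in the doubled encoding. *)

theorem theorem9p1:
  fixes q s :: complex and n :: nat
  assumes "q \<noteq> 0"
    and "\<And>k::nat. k > 0 \<Longrightarrow> q ^ k \<noteq> 1"
    and "s^2 = q"
    and "n \<ge> 2"
  shows "\<exists>\<phi> \<in> alg_iso (AWbar q n 1 1) (centralizer q s n 1 1).
           \<phi> (AWbar_gen q n 1 1 GA) = C12 q s n 1 1 \<and>
           \<phi> (AWbar_gen q n 1 1 GB) = C23 q s n 1 1 \<and>
           \<phi> (AWbar_gen q n 1 1 GK) = C123 q s n 1 1 \<and>
           (\<forall>\<psi> \<in> alg_hom (AWbar q n 1 1) (centralizer q s n 1 1).
              \<psi> (AWbar_gen q n 1 1 GA) = C12 q s n 1 1 \<longrightarrow>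
              \<psi> (AWbar_gen q n 1 1 GB) = C23 q s n 1 1 \<longrightarrow>
              \<psi> (AWbar_gen q n 1 1 GK) = C123 q s n 1 1 \<longrightarrow>
              (\<forall>x \<in> carrier (AWbar q n 1 1). \<psi> x = \<phi> x))"
proof -
  interpret spin_module q n s
    using assms by unfold_locales auto
  show ?thesis
  proof (intro bexI[OF _ iso_alg_iso] conjI ballI impI)
    show "iso (generator R GA) = C12 q s n 1 1" "iso (generator R GB) = C23 q s n 1 1" "iso (generator R GK) = C123 q s n 1 1"
      unfolding iso_generator by (simp_all add: img_def img0_def del: One_nat_def)
  qed (rule iso_unique)
qed

end
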